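(* Let $H$ be a $v$-noetherian weakly Krull monoid with $\emptyset\neq\mathfrak f=(H:\widehat H)\subsetneq H$ and suppose that $\mathcal C_v(H)$ is finite. Let \[ \mathcal P^*=\{\mathfrak p\in\mathfrak X(H)\mid\mathfrak p\supset\mathfrak f\},\qquad \mathcal P=\mathfrak X(H)\setminus\mathcal P^*,\qquad T=\prod_{\mathfrak p\in\mathcal P^*}(H_{\mathfrak p})_{\mathrm{red}}. \] (1) There is a transfer homomorphism $\boldsymbol\beta\colon H\to\mathcal B(G_{\mathcal P},T,\iota)$, where $G_{\mathcal P}\subset\mathcal C_v(H)$ is the set of classes containing minimal prime ideals $\mathfrak p\in\mathcal P$ and $\iota\colon T\to\mathcal C_v(H)$ is the canonical homomorphism. Moreover, $\mathcal B(G_{\mathcal P},T,\iota)$ is a $v$-noetherian weakly Krull monoid. (2) For every divisor-closed submonoid $S\subset H$ with $\mathsf v_{\mathfrak p}(aH)=0$ for all $a\in S$ and all $\mathfrak p\in\mathcal P^*$, there are a subset $G_S^*$ of $\mathcal C_v(H)$ such that $\mathcal B(G_S^* )\hookrightarrow\mathcal F(G_S^* )$ is a divisor theory, and a transfer homomorphism $\theta_S^*\colon S\to\mathcal B(G_S^* )$.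
   Context: **Monoids.** All monoids are commutative and cancellative, with $H^\times$ the group of invertible elements, $H_{\mathrm{red}}=\{aH^\times\mid a\in H\}$, and $\mathsf q(H)$ the quotient group. $\mathcal F(P)$ is the free abelian monoid with basis $P$. A submonoid $S\subset H$ is divisor-closed if $a\in S$, $b\in H$ and $b\mid a$ in $H$ imply $b\in S$. $\widehat H$ denotes the complete integral closure of $H$, i.e. the set of $x\in\mathsf q(H)$ for which there is $c\in H$ with $cx^n\in H$ for all $n\in\mathbb N$. **Ideals.** For $A,B\subset\mathsf q(H)$: $(A:B)=\{x\in\mathsf q(H)\mid xB\subset A\}$, $A^{-1}=(H:A)$, $A_v=(A^{-1})^{-1}$. An $s$-ideal is a subset $\mathfrak a\subset H$ with $\mathfrak aH=\mathfrak a$; it is prime if $\mathfrak a\neq H$ and $H\setminus\mathfrak a$ is multiplicatively closed. $\mathfrak X(H)$ is the set of minimal nonempty prime $s$-ideals of $H$. A $v$-ideal is a subset $\mathfrak a\subset H$ with $\mathfrak a_v=\mathfrak a$; $v$-multiplication is $\mathfrak a\cdot_v\mathfrak b=(\mathfrak a\mathfrak b)_v$. $\mathcal I_v^*(H)$ is the monoid of $v$-invertible $v$-ideals under $v$-multiplication, $\mathcal H=\{aH\mid a\in H\}$, and $\mathcal C_v(H)=\mathsf q(\mathcal I_v^*(H))/\mathsf q(\mathcal H)$ is the $v$-class group (written additively). $H$ is $v$-noetherian if it satisfies the ascending chain condition on $v$-ideals. $H_{\mathfrak p}$ is the localization of $H$ at $\mathfrak p$. $H$ is weakly Krull if $H=\bigcap_{\mathfrak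 p\in\mathfrak X(H)}H_{\mathfrak p}$ and $\{\mathfrak p\in\mathfrak X(H)\mid a\in\mathfrak p\}$ is finite for all $a\in H$. **The map $\iota$.** In the situation of the claim there is a canonical isomorphism $\mathcal I_v^*(H)\cong\mathcal F(\mathcal P)\times T$: for $\mathfrak a\in\mathcal I_v^*(H)$ each localization is principal, $\mathfrak a_{\mathfrak p}=a_{\mathfrak p}H_{\mathfrak p}$, and the $\mathfrak p$-component of $\mathfrak a$ is $a_{\mathfrak p}H_{\mathfrak p}^\times\in(H_{\mathfrak p})_{\mathrm{red}}$ for $\mathfrak p\in\mathfrak X(H)$; for $\mathfrak p\in\mathcal P$ one has $(H_{\mathfrak p})_{\mathrm{red}}\cong(\mathbb N_0,+)$ and the basis element $\mathfrak p$ of $\mathcal F(\mathcal P)$ corresponds to the $v$-ideal $\mathfrak p$. The homomorphism $\iota\colon T\to\mathcal C_v(H)$ sends $t\in T$ to the class of the $v$-invertible $v$-ideal corresponding to $(1,t)\in\mathcal F(\mathcal P)\times T$. For $\mathfrak p\in\mathcal P^*$, $\mathsf v_{\mathfrak p}(aH)=0$ means that the $\mathfrak p$-component of $aH$ is trivial, i.e. $a\in H_{\mathfrak p}^\times$ (equivalently $a\notin\mathfrak p$). **Zero-sum and $T$-block monoids.** Let $G$ be an additive abelian group, $G_0\subset G$; for $S=g_1\cdots g_\ell\in\mathcal F(G_0)$ put $\sigma(S)=g_1+\dots+g_\ell$. Then $\mathcal B(G_0)=\{S\in\mathcal F(G_0)\mid\sigma(S)=0\}$. For a commutative cancellative monoid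 $T$ and a homomorphism $\iota\colon T\to G$, the $T$-block monoid is $\mathcal B(G_0,T,\iota)=\{St\in\mathcal F(G_0)\times T\mid\sigma(S)+\iota(t)=0\}$. **Transfer homomorphisms and divisor theories.** A homomorphism $\theta\colon H\to B$ of atomic monoids (every non-unit a finite product of atoms) is a transfer homomorphism if (T1) $B=B^\times\theta(H)B^\times$ and $\theta^{-1}(B^\times)=H^\times$; (T2) if $u\in H$, $b,c\in B$, $\theta(u)=bc$, then there are $v,w\in H$ and $\varepsilon\in B^\times$ with $u=vw$, $\theta(v)=b\varepsilon^{-1}$, $\theta(w)=\varepsilon c$. A homomorphism $\varphi\colon H\to\mathcal F(P)$ is a divisor theory if $\varphi(a)\mid\varphi(b)$ implies $a\mid b$ for all $a,b\in H$, and for every $p\in P$ there is a finite nonempty $X\subset H$ with $p=\gcd(\varphi(X))$. *)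

theory Defs
  imports
    "HOL-Algebra.Divisibility"
    "HOL-Algebra.Coset"
    "HOL-Algebra.FiniteProduct"
    "HOL-Algebra.Product_Groups"
    "HOL-Library.Multiset"
begin

text \<open>
  A (commutative, cancellative) monoid is a record \<open>H\<close> with \<open>comm_monoid_cancel H\<close>.
  Its quotient group \<open>q(H)\<close> consists of the classes \<open>mk_frac H a b\<close> (to be read as \<open>a/b\<close>) of pairs
  in \<open>carrier H \<times> carrier H\<close>. All ideals of \<open>H\<close> are subsets of \<open>carrier (quot_grp H)\<close>; there,
  \<open>H\<close> itself is the image \<open>base H\<close> of \<open>carrier H\<close> under \<open>a \<mapsto> a/1\<close>.
\<close>

subsection \<open>Quotient group and reduced monoid\<close>

type_synonym 'a fraction = "('a \<times> 'a) set"

definition frac_rel :: "('a, 'm) monoid_scheme \<Rightarrow> (('a \<times> 'a) \<times> ('a \<times> 'a)) set" where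
  "frac_rel H = {((a, b), (c, d)). a \<in> carrier H \<and> b \<in> carrier H \<and> c \<in> carrier H \<and> d \<in> carrier H
                                   \<and> a \<otimes>\<^bsub>H\<^esub> d = c \<otimes>\<^bsub>H\<^esub> b}"

definition mk_frac :: "('a, 'm) monoid_scheme \<Rightarrow> 'a \<Rightarrow> 'a \<Rightarrow> 'a fraction" where
  "mk_frac H a b = frac_rel H `` {(a, b)}"

definition quot_grp :: "('a, 'm) monoid_scheme \<Rightarrow> 'a fraction monoid" where
  "quot_grp H =
    \<lparr> carrier = (carrier H \<times> carrier H) // frac_rel H,
      mult = (\<lambda>X Y. \<Union>(a, b)\<in>X. \<Union>(c, d)\<in>Y. mk_frac H (a \<otimes>\<^bsub>H\<^esub> c) (b \<otimes>\<^bsub>H\<^esub> d)),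
      one = mk_frac H \<one>\<^bsub>H\<^esub> \<one>\<^bsub>H\<^esub> \<rparr>"

definition emb :: "('a, 'm) monoid_scheme \<Rightarrow> 'a \<Rightarrow> 'a fraction" where
  "emb H a = mk_frac H a \<one>\<^bsub>H\<^esub>"

definition base :: "('a, 'm) monoid_scheme \<Rightarrow> 'a fraction set" where
  "base H = emb H ` carrier H"

text \<open>The quotient group \<open>q(S)\<close> of a submonoid \<open>S\<close>, as a subgroup of \<open>q(H)\<close>.\<close>

definition quot_subgrp :: "('a, 'm) monoid_scheme \<Rightarrow> 'a set \<Rightarrow> 'a fraction set" where
  "quot_subgrp H S = {mk_frac H a b | a b. a \<in> S \<and> b \<in> S}"

text \<open>The set product of \<open>aH\<^sup>\<times>\<close> and \<open>bH\<^sup>\<times>\<close> is \<open>abH\<^sup>\<times>\<close>, so the quotient construction of the library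
  gives the reduced monoid for commutative monoids as well.\<close>

definition reduced :: "('a, 'm) monoid_scheme \<Rightarrow> 'a set monoid" where
  "reduced H = H Mod (Units H)"


subsection \<open>Ideals\<close>

definition colon :: "('a, 'm) monoid_scheme \<Rightarrow> 'a fraction set \<Rightarrow> 'a fraction set \<Rightarrow> 'a fraction set" where
  "colon H A B = {x \<in> carrier (quot_grp H). \<forall>b\<in>B. x \<otimes>\<^bsub>quot_grp H\<^esub> b \<in> A}"

definition ideal_inv :: "('a, 'm) monoid_scheme \<Rightarrow> 'a fraction set \<Rightarrow> 'a fraction set" where
  "ideal_inv H A = colon H (base H) A"

definition v_closure :: "('a, 'm) monoid_scheme \<Rightarrow> 'a fraction set \<Rightarrow> 'a fraction set" where
  "v_closure H A = ideal_inv H (ideal_inv H A)"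

definition s_ideal :: "('a, 'm) monoid_scheme \<Rightarrow> 'a fraction set \<Rightarrow> bool" where
  "s_ideal H A \<longleftrightarrow> A \<subseteq> base H \<and> A <#>\<^bsub>quot_grp H\<^esub> base H = A"

definition prime_s_ideal :: "('a, 'm) monoid_scheme \<Rightarrow> 'a fraction set \<Rightarrow> bool" where
  "prime_s_ideal H P \<longleftrightarrow> s_ideal H P \<and> P \<noteq> base H \<and>
     (\<forall>x \<in> base H - P. \<forall>y \<in> base H - P. x \<otimes>\<^bsub>quot_grp H\<^esub> y \<in> base H - P)"

definition min_primes :: "('a, 'm) monoid_scheme \<Rightarrow> 'a fraction set set" where
  "min_primes H = {P. prime_s_ideal H P \<and> P \<noteq> {} \<and>
     (\<forall>P'. prime_s_ideal H P' \<and> P' \<noteq> {} \<and> P' \<subseteq> P \<longrightarrow> P' = P)}"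

definition v_ideal :: "('a, 'm) monoid_scheme \<Rightarrow> 'a fraction set \<Rightarrow> bool" where
  "v_ideal H A \<longleftrightarrow> A \<subseteq> base H \<and> v_closure H A = A"

definition v_mult :: "('a, 'm) monoid_scheme \<Rightarrow> 'a fraction set \<Rightarrow> 'a fraction set \<Rightarrow> 'a fraction set" where
  "v_mult H A B = v_closure H (A <#>\<^bsub>quot_grp H\<^esub> B)"

definition v_invertible_ideals :: "('a, 'm) monoid_scheme \<Rightarrow> 'a fraction set monoid" where
  "v_invertible_ideals H =
    \<lparr> carrier = {A. v_ideal H A \<and> v_mult H A (ideal_inv H A) = base H},
      mult = v_mult H,
      one = base H \<rparr>"

definition principal_ideal :: "('a, 'm) monoid_scheme \<Rightarrow> 'a \<Rightarrow> 'a fraction set" where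
  "principal_ideal H a = emb H a <#\<^bsub>quot_grp H\<^esub> base H"

text \<open>The \<open>v\<close>-class group, written multiplicatively.\<close>

definition v_class_group :: "('a, 'm) monoid_scheme \<Rightarrow> 'a fraction set fraction set monoid" where
  "v_class_group H = quot_grp (v_invertible_ideals H)
     Mod quot_subgrp (v_invertible_ideals H) (principal_ideal H ` carrier H)"

definition ideal_class :: "('a, 'm) monoid_scheme \<Rightarrow> 'a fraction set \<Rightarrow> 'a fraction set fraction set" where
  "ideal_class H A = quot_subgrp (v_invertible_ideals H) (principal_ideal H ` carrier H)
     #>\<^bsub>quot_grp (v_invertible_ideals H)\<^esub> emb (v_invertible_ideals H) A"

definition complete_integral_closure :: "('a, 'm) monoid_scheme \<Rightarrow> 'a fraction set" where
  "complete_integral_closure H = {x \<in> carrier (quot_grp H).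
     \<exists>c \<in> base H. \<forall>n::nat. c \<otimes>\<^bsub>quot_grp H\<^esub> x [^]\<^bsub>quot_grp H\<^esub> n \<in> base H}"

definition conductor :: "('a, 'm) monoid_scheme \<Rightarrow> 'a fraction set" where
  "conductor H = colon H (base H) (complete_integral_closure H)"


subsection \<open>Localization, weakly Krull and \<open>v\<close>-noetherian monoids\<close>

text \<open>\<open>localize H A P\<close> is the localization of \<open>A\<close> at \<open>P\<close>, that is, the set of all
  \<open>a/s\<close> with \<open>a \<in> A\<close> and \<open>s \<in> H \<setminus> P\<close>.\<close>

definition localize :: "('a, 'm) monoid_scheme \<Rightarrow> 'a fraction set \<Rightarrow> 'a fraction set \<Rightarrow> 'a fraction set" where
  "localize H A P = {a \<otimes>\<^bsub>quot_grp H\<^esub> inv\<^bsub>quot_grp H\<^esub> s | a s. a \<in> A \<and> s \<in> base H - P}"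

definition local_monoid :: "('a, 'm) monoid_scheme \<Rightarrow> 'a fraction set \<Rightarrow> 'a fraction monoid" where
  "local_monoid H P = (quot_grp H)\<lparr>carrier := localize H (base H) P\<rparr>"

definition weakly_krull :: "('a, 'm) monoid_scheme \<Rightarrow> bool" where
  "weakly_krull H \<longleftrightarrow> comm_monoid_cancel H \<and>
     base H = {x \<in> carrier (quot_grp H). \<forall>P \<in> min_primes H. x \<in> carrier (local_monoid H P)} \<and>
     (\<forall>a \<in> base H. finite {P \<in> min_primes H. a \<in> P})"

definition v_noetherian :: "('a, 'm) monoid_scheme \<Rightarrow> bool" where
  "v_noetherian H \<longleftrightarrow> comm_monoid_cancel H \<and>
     (\<forall>A :: nat \<Rightarrow> 'a fraction set.
        (\<forall>n. v_ideal H (A n)) \<and> (\<forall>n. A n \<subseteq> A (Suc n)) \<longrightarrow> (\<exists>N. \<forall>n\<ge>N. A n = A N))"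


subsection \<open>The monoid \<open>T\<close> and the map \<open>\<iota>\<close>\<close>

definition Pstar :: "('a, 'm) monoid_scheme \<Rightarrow> 'a fraction set set" where
  "Pstar H = {P \<in> min_primes H. conductor H \<subseteq> P}"

definition Preg :: "('a, 'm) monoid_scheme \<Rightarrow> 'a fraction set set" where
  "Preg H = min_primes H - Pstar H"

definition T_monoid :: "('a, 'm) monoid_scheme \<Rightarrow> ('a fraction set \<Rightarrow> 'a fraction set) monoid" where
  "T_monoid H = product_group (Pstar H) (\<lambda>P. reduced (local_monoid H P))"

text \<open>If the localization of \<open>A\<close> at \<open>P\<close> is the principal ideal \<open>a H\<^sub>P\<close>, then its set of generators
  is the coset \<open>a H\<^sub>P\<^sup>\<times>\<close>, which is the \<open>P\<close>-component of \<open>A\<close>.\<close>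

definition p_component :: "('a, 'm) monoid_scheme \<Rightarrow> 'a fraction set \<Rightarrow> 'a fraction set \<Rightarrow> 'a fraction set" where
  "p_component H P A = {x \<in> carrier (local_monoid H P).
     localize H A P = x <#\<^bsub>quot_grp H\<^esub> carrier (local_monoid H P)}"

text \<open>The \<open>v\<close>-invertible \<open>v\<close>-ideal corresponding to \<open>(1, t)\<close>: it has the prescribed components at the
  primes in \<open>Pstar H\<close> and trivial components at the primes in \<open>Preg H\<close>.\<close>

definition T_ideal :: "('a, 'm) monoid_scheme \<Rightarrow> ('a fraction set \<Rightarrow> 'a fraction set) \<Rightarrow> 'a fraction set" where
  "T_ideal H t = (THE A. A \<in> carrier (v_invertible_ideals H) \<and>
     (\<forall>P \<in> Pstar H. p_component H P A = t P) \<and>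
     (\<forall>P \<in> Preg H. p_component H P A = \<one>\<^bsub>reduced (local_monoid H P)\<^esub>))"

definition iota :: "('a, 'm) monoid_scheme \<Rightarrow> ('a fraction set \<Rightarrow> 'a fraction set) \<Rightarrow> 'a fraction set fraction set" where
  "iota H t = ideal_class H (T_ideal H t)"

definition G_P :: "('a, 'm) monoid_scheme \<Rightarrow> 'a fraction set fraction set set" where
  "G_P H = ideal_class H ` Preg H"


subsection \<open>Free abelian monoids and block monoids\<close>

definition free_abelian_monoid :: "'p set \<Rightarrow> 'p multiset monoid" where
  "free_abelian_monoid P = \<lparr> carrier = {S. set_mset S \<subseteq> P}, mult = (+), one = {#} \<rparr>"

text \<open>The abelian group \<open>G\<close> is a multiplicative record, so \<open>seq_sum G S\<close> is the sum \<open>\<sigma>(S)\<close> of the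
  terms of \<open>S\<close>, counted with multiplicity, and the zero of \<open>G\<close> is \<open>\<one>\<^bsub>G\<^esub>\<close>.\<close>

definition seq_sum :: "('g, 'm) monoid_scheme \<Rightarrow> 'g multiset \<Rightarrow> 'g" where
  "seq_sum G S = (\<Otimes>\<^bsub>G\<^esub>g \<in> set_mset S. g [^]\<^bsub>G\<^esub> count S g)"

definition block_monoid :: "('g, 'm) monoid_scheme \<Rightarrow> 'g set \<Rightarrow> 'g multiset monoid" where
  "block_monoid G G0 = (free_abelian_monoid G0)
     \<lparr>carrier := {S \<in> carrier (free_abelian_monoid G0). seq_sum G S = \<one>\<^bsub>G\<^esub>}\<rparr>"

definition T_block_monoid ::
    "('g, 'm) monoid_scheme \<Rightarrow> 'g set \<Rightarrow> ('t, 'n) monoid_scheme \<Rightarrow> ('t \<Rightarrow> 'g) \<Rightarrow> ('g multiset \<times> 't) monoid" where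
  "T_block_monoid G G0 T \<iota> = (free_abelian_monoid G0 \<times>\<times> T)
     \<lparr>carrier := {(S, t) \<in> carrier (free_abelian_monoid G0 \<times>\<times> T). seq_sum G S \<otimes>\<^bsub>G\<^esub> \<iota> t = \<one>\<^bsub>G\<^esub>}\<rparr>"


subsection \<open>Transfer homomorphisms and divisor theories\<close>

definition atomic :: "('a, 'm) monoid_scheme \<Rightarrow> bool" where
  "atomic H \<longleftrightarrow> comm_monoid_cancel H \<and>
     (\<forall>a \<in> carrier H - Units H. \<exists>fs. set fs \<subseteq> carrier H \<and> factors H fs a)"

text \<open>The library's \<open>hom\<close> does not ask for preservation of \<open>\<one>\<close>.\<close>

definition monoid_hom :: "('a, 'm) monoid_scheme \<Rightarrow> ('b, 'n) monoid_scheme \<Rightarrow> ('a \<Rightarrow> 'b) \<Rightarrow> bool" where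
  "monoid_hom H B \<theta> \<longleftrightarrow> \<theta> \<in> hom H B \<and> \<theta> \<one>\<^bsub>H\<^esub> = \<one>\<^bsub>B\<^esub>"

definition transfer_hom :: "('a, 'm) monoid_scheme \<Rightarrow> ('b, 'n) monoid_scheme \<Rightarrow> ('a \<Rightarrow> 'b) \<Rightarrow> bool" where
  "transfer_hom H B \<theta> \<longleftrightarrow> atomic H \<and> atomic B \<and> monoid_hom H B \<theta> \<and>
     carrier B = Units B <#>\<^bsub>B\<^esub> \<theta> ` carrier H <#>\<^bsub>B\<^esub> Units B \<and>
     {u \<in> carrier H. \<theta> u \<in> Units B} = Units H \<and>
     (\<forall>u \<in> carrier H. \<forall>b \<in> carrier B. \<forall>c \<in> carrier B. \<theta> u = b \<otimes>\<^bsub>B\<^esub> c \<longrightarrow>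
        (\<exists>v \<in> carrier H. \<exists>w \<in> carrier H. \<exists>\<epsilon> \<in> Units B.
           u = v \<otimes>\<^bsub>H\<^esub> w \<and> \<theta> v = b \<otimes>\<^bsub>B\<^esub> inv\<^bsub>B\<^esub> \<epsilon> \<and> \<theta> w = \<epsilon> \<otimes>\<^bsub>B\<^esub> c))"

text \<open>A greatest element among the common divisors of \<open>Y\<close>; in a free abelian monoid it is unique.\<close>

definition is_gcd :: "('a, 'm) monoid_scheme \<Rightarrow> 'a \<Rightarrow> 'a set \<Rightarrow> bool" where
  "is_gcd M d Y \<longleftrightarrow> greatest (division_rel M) d (Lower (division_rel M) Y)"

definition divisor_theory :: "('a, 'm) monoid_scheme \<Rightarrow> 'p set \<Rightarrow> ('a \<Rightarrow> 'p multiset) \<Rightarrow> bool" where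
  "divisor_theory H P \<phi> \<longleftrightarrow> comm_monoid_cancel H \<and> monoid_hom H (free_abelian_monoid P) \<phi> \<and>
     (\<forall>a \<in> carrier H. \<forall>b \<in> carrier H.
        \<phi> a divides\<^bsub>free_abelian_monoid P\<^esub> \<phi> b \<longrightarrow> a divides\<^bsub>H\<^esub> b) \<and>
     (\<forall>p \<in> P. \<exists>X. finite X \<and> X \<noteq> {} \<and> X \<subseteq> carrier H \<and> is_gcd (free_abelian_monoid P) {#p#} (\<phi> ` X))"

definition divisor_closed :: "'a set \<Rightarrow> ('a, 'm) monoid_scheme \<Rightarrow> bool" where
  "divisor_closed S H \<longleftrightarrow> submonoid S H \<and>
     (\<forall>a \<in> S. \<forall>b \<in> carrier H. b divides\<^bsub>H\<^esub> a \<longrightarrow> b \<in> S)"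

end

theory Submission
  imports Defs "HOL-Algebra.Multiplicative_Group"
begin

text \<open>
  The proof describes the \<open>v\<close>-invertible \<open>v\<close>-ideals of \<open>H\<close> by their local generators, and then reads off factorizations from
  this description. Fractions are avoided as far as possible: \<open>b/a\<close> multiplies a set \<open>A\<close> into \<open>H\<close> if and only if \<open>a\<close>
  divides \<open>by\<close> for all \<open>y\<close> in \<open>A\<close>, so the \<open>v\<close>-closure and all the conditions on \<open>H\<close> can be expressed by
  divisibility in \<open>H\<close> (\<open>v_closure_emb\<close>, \<open>weakly_krull_iff\<close>).

  Since \<open>H\<close> is \<open>v\<close>-noetherian, finitely many elements of a set decide which fractions multiply it into \<open>H\<close>, so local
  divisibility relations have a common denominator (\<open>common_denominator\<close>). Hence a \<open>v\<close>-ideal is \<open>v\<close>-invertible if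
  and only if it is locally principal at all minimal primes. As \<open>H\<close> is the intersection of its localizations, such an
  ideal is determined by its local generators, and since the localizations at minimal primes are primary, all families
  of generators with finite support occur (\<open>ideal_of_generator\<close>, \<open>v_invertible_carrier\<close>, \<open>vcl_mult_ideal_of\<close>). For a prime
  \<open>P\<close> that does not contain the conductor, the maximal ideal of the localization is principal: otherwise \<open>P\<^sup>-\<^sup>1\<close> would
  contain an almost integral element outside \<open>H\<^sub>P\<close> (\<open>discrete_localization\<close>). Together this gives the isomorphism of
  \<open>F(\<P>) \<times> T\<close> with the monoid of \<open>v\<close>-invertible \<open>v\<close>-ideals (\<open>div_ideal_bij\<close>, \<open>div_ideal_mult\<close>); an element is
  principal if and only if its class is trivial.

  Now replace each prime in \<open>F(\<P>) \<times> T\<close> by its class. Whether an element is principal can still be seen afterwards. So if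
  the image of \<open>u\<close> in the \<open>T\<close>-block monoid \<open>B\<close> is a product of two elements of \<open>B\<close>, then the ideal \<open>uH\<close> is
  the product of two ideals above them, and these are principal. This is the transfer property
  (\<open>transfer_hom_via_divisors\<close>, \<open>transfer_to_B\<close>).

  There are only finitely many classes, and finitely many primes over the conductor. So \<open>B\<close> embeds into a finite product of
  primary monoids, divisibility in \<open>B\<close> is divisibility of the components, and all powers with exponent \<open>|C|\<close> of elements
  of the product lie in \<open>B\<close>. Therefore \<open>B\<close> is \<open>v\<close>-noetherian since the components are, and its minimal primes
  correspond to the components, which makes it weakly Krull (locale \<open>finite_components\<close>).

  For a divisor-closed submonoid \<open>S\<close> away from the conductor the factor \<open>T\<close> disappears, and the same argument gives a transfer
  homomorphism to the block monoid over the classes of the primes that divide elements of \<open>S\<close> (\<open>transfer_from_S\<close>). Over a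
  subset \<open>G\<^sub>0\<close> of a finite group, the block monoid has the inclusion as a divisor theory if each \<open>g\<close> in \<open>G\<^sub>0\<close> is in the
  subgroup generated by the others. If this fails for \<open>g\<close>, then all multiplicities of \<open>g\<close> in blocks are divisible by some
  \<open>m > 1\<close>, and blocks can be transferred to the set where \<open>g\<close> is replaced by its \<open>m\<close>-th multiple. The sum of the
  orders decreases, so finitely many such steps lead to a divisor theory (\<open>transfer_to_divisor_theory\<close>).
\<close>

section \<open>The quotient group\<close>

context comm_monoid_cancel
begin

lemma frac_rel_equiv: "equiv (carrier G \<times> carrier G) (frac_rel G)"
proof (rule equivI)
  show "frac_rel G \<subseteq> (carrier G \<times> carrier G) \<times> (carrier G \<times> carrier G)"
    by (auto simp: frac_rel_def)
  show "refl_on (carrier G \<times> carrier G) (frac_rel G)"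
    by (auto simp: refl_on_def frac_rel_def)
  show "sym (frac_rel G)"
    by (auto simp: sym_def frac_rel_def)
  show "trans (frac_rel G)"
  proof (rule transI)
    fix x y z assume "(x, y) \<in> frac_rel G" "(y, z) \<in> frac_rel G"
    then obtain a b c d e f where eq: "x = (a, b)" "y = (c, d)" "z = (e, f)"
      and in_carrier: "a \<in> carrier G" "b \<in> carrier G" "c \<in> carrier G" "d \<in> carrier G" "e \<in> carrier G" "f \<in> carrier G"
      and "a \<otimes> d = c \<otimes> b" "c \<otimes> f = e \<otimes> d"
      by (auto simp: frac_rel_def)
    then have "d \<otimes> (a \<otimes> f) = d \<otimes> (e \<otimes> b)"
      by (metis m_assoc m_comm m_closed)
    then have "a \<otimes> f = e \<otimes> b"
      using in_carrier l_cancel by (metis m_closed)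
    then show "(x, z) \<in> frac_rel G"
      using in_carrier by (simp add: frac_rel_def eq)
  qed
qed

lemma mk_frac_eq_iff:
  assumes "a \<in> carrier G" "b \<in> carrier G" "c \<in> carrier G" "d \<in> carrier G"
  shows "mk_frac G a b = mk_frac G c d \<longleftrightarrow> a \<otimes> d = c \<otimes> b"
proof -
  have "mk_frac G a b = mk_frac G c d \<longleftrightarrow> ((a, b), (c, d)) \<in> frac_rel G"
    unfolding mk_frac_def using eq_equiv_class_iff[OF frac_rel_equiv] assms by simp
  then show ?thesis
    using assms by (simp add: frac_rel_def)
qed

lemma mk_frac_in_carrier [simp]:
  "a \<in> carrier G \<Longrightarrow> b \<in> carrier G \<Longrightarrow> mk_frac G a b \<in> carrier (quot_grp G)"
  by (auto simp: quot_grp_def mk_frac_def quotient_def)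

lemma quot_grp_cases:
  assumes "x \<in> carrier (quot_grp G)"
  obtains a b where "a \<in> carrier G" "b \<in> carrier G" "x = mk_frac G a b"
  using assms by (auto simp: quot_grp_def mk_frac_def quotient_def)

lemma mk_frac_mult [simp]:
  assumes "a \<in> carrier G" "b \<in> carrier G" "c \<in> carrier G" "d \<in> carrier G"
  shows "mk_frac G a b \<otimes>\<^bsub>quot_grp G\<^esub> mk_frac G c d = mk_frac G (a \<otimes> c) (b \<otimes> d)"
proof -
  have const: "mk_frac G (a' \<otimes> c') (b' \<otimes> d') = mk_frac G (a \<otimes> c) (b \<otimes> d)"
    if "(a', b') \<in> mk_frac G a b" "(c', d') \<in> mk_frac G c d" for a' b' c' d'
  proof -
    from that have in_carrier: "a' \<in> carrier G" "b' \<in> carrier G" "c' \<in> carrier G" "d' \<in> carrier G"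
      and eqs: "a \<otimes> b' = a' \<otimes> b" "c \<otimes> d' = c' \<otimes> d"
      by (auto simp: mk_frac_def frac_rel_def)
    have "(a' \<otimes> c') \<otimes> (b \<otimes> d) = (a' \<otimes> b) \<otimes> (c' \<otimes> d)"
      using assms in_carrier by (simp add: m_ac)
    also have "\<dots> = (a \<otimes> b') \<otimes> (c \<otimes> d')"
      by (simp add: eqs)
    also have "\<dots> = (a \<otimes> c) \<otimes> (b' \<otimes> d')"
      using assms in_carrier by (simp add: m_ac)
    finally show ?thesis
      using assms in_carrier by (simp add: mk_frac_eq_iff)
  qed
  have "(a, b) \<in> mk_frac G a b" "(c, d) \<in> mk_frac G c d"
    using assms by (auto simp: mk_frac_def frac_rel_def)
  then have nonempty: "mk_frac G a b \<noteq> {}" "mk_frac G c d \<noteq> {}" by auto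
  have "(\<Union>(a', b')\<in>mk_frac G a b. \<Union>(c', d')\<in>mk_frac G c d. mk_frac G (a' \<otimes> c') (b' \<otimes> d'))
      = (\<Union>_\<in>mk_frac G a b. \<Union>_\<in>mk_frac G c d. mk_frac G (a \<otimes> c) (b \<otimes> d))"
    by (intro SUP_cong refl) (clarify, intro SUP_cong refl, clarify, rule const)
  also have "\<dots> = mk_frac G (a \<otimes> c) (b \<otimes> d)"
    using nonempty by simp
  finally have "(\<Union>(a', b')\<in>mk_frac G a b. \<Union>(c', d')\<in>mk_frac G c d. mk_frac G (a' \<otimes> c') (b' \<otimes> d'))
      = mk_frac G (a \<otimes> c) (b \<otimes> d)" .
  then show ?thesis
    by (simp add: quot_grp_def)
qed

lemma one_quot_grp: "\<one>\<^bsub>quot_grp G\<^esub> = mk_frac G \<one> \<one>"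
  by (simp add: quot_grp_def)

lemma mk_frac_self: "a \<in> carrier G \<Longrightarrow> mk_frac G a a = \<one>\<^bsub>quot_grp G\<^esub>"
  by (simp add: one_quot_grp mk_frac_eq_iff m_comm)

lemma quot_grp_comm_group: "comm_group (quot_grp G)"
proof (rule comm_groupI)
  fix x y assume "x \<in> carrier (quot_grp G)" "y \<in> carrier (quot_grp G)"
  then show "x \<otimes>\<^bsub>quot_grp G\<^esub> y \<in> carrier (quot_grp G)"
    by (auto elim!: quot_grp_cases)
  from \<open>x \<in> _\<close> \<open>y \<in> _\<close> show "x \<otimes>\<^bsub>quot_grp G\<^esub> y = y \<otimes>\<^bsub>quot_grp G\<^esub> x"
    by (auto elim!: quot_grp_cases simp: m_comm)
next
  show "\<one>\<^bsub>quot_grp G\<^esub> \<in> carrier (quot_grp G)"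
    by (simp add: one_quot_grp)
next
  fix x y z
  assume "x \<in> carrier (quot_grp G)" "y \<in> carrier (quot_grp G)" "z \<in> carrier (quot_grp G)"
  then show "x \<otimes>\<^bsub>quot_grp G\<^esub> y \<otimes>\<^bsub>quot_grp G\<^esub> z = x \<otimes>\<^bsub>quot_grp G\<^esub> (y \<otimes>\<^bsub>quot_grp G\<^esub> z)"
    by (auto elim!: quot_grp_cases simp: m_assoc)
next
  fix x assume "x \<in> carrier (quot_grp G)"
  then show "\<one>\<^bsub>quot_grp G\<^esub> \<otimes>\<^bsub>quot_grp G\<^esub> x = x"
    by (auto elim!: quot_grp_cases simp: one_quot_grp)
next
  fix x assume "x \<in> carrier (quot_grp G)"
  then obtain a b where "a \<in> carrier G" "b \<in> carrier G" "x = mk_frac G a b"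
    by (rule quot_grp_cases)
  then show "\<exists>y\<in>carrier (quot_grp G). y \<otimes>\<^bsub>quot_grp G\<^esub> x = \<one>\<^bsub>quot_grp G\<^esub>"
    by (intro bexI[of _ "mk_frac G b a"]) (auto simp: m_comm mk_frac_self)
qed

interpretation Q: comm_group "quot_grp G"
  by (rule quot_grp_comm_group)

lemma inv_mk_frac [simp]:
  assumes "a \<in> carrier G" "b \<in> carrier G"
  shows "inv\<^bsub>quot_grp G\<^esub> mk_frac G a b = mk_frac G b a"
  using assms by (intro Q.inv_equality) (auto simp: m_comm mk_frac_self)

lemma mk_frac_pow [simp]:
  assumes "a \<in> carrier G" "b \<in> carrier G"
  shows "mk_frac G a b [^]\<^bsub>quot_grp G\<^esub> (n::nat) = mk_frac G (a [^] n) (b [^] n)"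
  using assms by (induction n) (auto simp: one_quot_grp)

lemma emb_closed [simp]: "a \<in> carrier G \<Longrightarrow> emb G a \<in> carrier (quot_grp G)"
  by (simp add: emb_def)

lemma emb_mult [simp]:
  "a \<in> carrier G \<Longrightarrow> b \<in> carrier G \<Longrightarrow> emb G a \<otimes>\<^bsub>quot_grp G\<^esub> emb G b = emb G (a \<otimes> b)"
  by (simp add: emb_def)

lemma emb_one: "emb G \<one> = \<one>\<^bsub>quot_grp G\<^esub>"
  by (simp add: emb_def one_quot_grp)

lemma emb_eq_iff [simp]:
  "a \<in> carrier G \<Longrightarrow> b \<in> carrier G \<Longrightarrow> emb G a = emb G b \<longleftrightarrow> a = b"
  by (simp add: emb_def mk_frac_eq_iff)

lemma emb_image_iff:
  "A \<subseteq> carrier G \<Longrightarrow> a \<in> carrier G \<Longrightarrow> emb G a \<in> emb G ` A \<longleftrightarrow> a \<in> A"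
  by (auto simp: image_iff subset_iff)

lemma mk_frac_eq_emb:
  "a \<in> carrier G \<Longrightarrow> b \<in> carrier G \<Longrightarrow> mk_frac G b a = emb G b \<otimes>\<^bsub>quot_grp G\<^esub> inv\<^bsub>quot_grp G\<^esub> emb G a"
  by (simp add: emb_def)

lemma mk_frac_in_emb_image:
  assumes "a \<in> carrier G" "b \<in> carrier G" "A \<subseteq> carrier G"
  shows "mk_frac G b a \<in> emb G ` A \<longleftrightarrow> (\<exists>c\<in>A. b = a \<otimes> c)"
proof -
  have "mk_frac G b a = emb G c \<longleftrightarrow> b = a \<otimes> c" if "c \<in> A" for c
    using that assms by (simp add: emb_def mk_frac_eq_iff m_comm subset_iff)
  then show ?thesis by (auto simp: image_iff)
qed

lemma mk_frac_in_base:
  "a \<in> carrier G \<Longrightarrow> b \<in> carrier G \<Longrightarrow> mk_frac G b a \<in> base G \<longleftrightarrow> a divides b"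
  by (simp add: base_def mk_frac_in_emb_image factor_def)

lemma base_subset: "base G \<subseteq> carrier (quot_grp G)"
  by (auto simp: base_def)

text \<open>Ideals are sets of fractions; \<open>pull A\<close> is the ideal \<open>A\<close> seen inside the monoid, where divisibility can be
  used instead of fractions.\<close>

definition pull :: "'a fraction set \<Rightarrow> 'a set"
  where "pull A = {a \<in> carrier G. emb G a \<in> A}"

lemma pull_subset: "pull A \<subseteq> carrier G"
  by (auto simp: pull_def)

lemma emb_pull: "A \<subseteq> base G \<Longrightarrow> emb G ` pull A = A"
  by (auto simp: pull_def base_def)

lemma pull_emb: "A \<subseteq> carrier G \<Longrightarrow> pull (emb G ` A) = A"
  by (auto simp: pull_def)

lemma emb_image_eq_iff:
  "A \<subseteq> carrier G \<Longrightarrow> B \<subseteq> carrier G \<Longrightarrow> emb G ` A = emb G ` B \<longleftrightarrow> A = B"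
proof (intro iffI)
  assume sub: "A \<subseteq> carrier G" "B \<subseteq> carrier G" and eq: "emb G ` A = emb G ` B"
  have "A = pull (emb G ` A)" using sub by (simp add: pull_emb)
  also have "\<dots> = pull (emb G ` B)" by (simp only: eq)
  also have "\<dots> = B" using sub by (simp add: pull_emb)
  finally show "A = B" .
qed simp

lemma emb_set_mult:
  assumes "A \<subseteq> carrier G" "B \<subseteq> carrier G"
  shows "emb G ` A <#>\<^bsub>quot_grp G\<^esub> emb G ` B = emb G ` {x \<otimes> y | x y. x \<in> A \<and> y \<in> B}"
proof (intro equalityI subsetI)
  fix z assume "z \<in> emb G ` A <#>\<^bsub>quot_grp G\<^esub> emb G ` B"
  then obtain x y where "x \<in> A" "y \<in> B" "z = emb G x \<otimes>\<^bsub>quot_grp G\<^esub> emb G y"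
    by (auto simp: set_mult_def)
  moreover then have "x \<in> carrier G" "y \<in> carrier G" using assms by auto
  ultimately show "z \<in> emb G ` {x \<otimes> y | x y. x \<in> A \<and> y \<in> B}" by auto
next
  fix z assume "z \<in> emb G ` {x \<otimes> y | x y. x \<in> A \<and> y \<in> B}"
  then obtain x y where "x \<in> A" "y \<in> B" "z = emb G (x \<otimes> y)"
    by auto
  moreover then have "emb G (x \<otimes> y) = emb G x \<otimes>\<^bsub>quot_grp G\<^esub> emb G y" using assms by (simp add: subsetD)
  ultimately show "z \<in> emb G ` A <#>\<^bsub>quot_grp G\<^esub> emb G ` B"
    by (auto simp: set_mult_def)
qed

lemma principal_ideal_eq:
  "a \<in> carrier G \<Longrightarrow> principal_ideal G a = emb G ` {x \<in> carrier G. a divides x}"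
  by (auto simp: principal_ideal_def l_coset_def base_def factor_def image_iff)

section \<open>The \<open>v\<close>-closure in terms of divisibility\<close>

text \<open>The pairs \<open>(b, a)\<close> with \<open>a\<close> dividing \<open>by\<close> for all \<open>y\<close> in \<open>A\<close> are the fractions \<open>b/a\<close> in \<open>A\<^sup>-\<^sup>1\<close>,
  so this is the \<open>v\<close>-closure of \<open>A\<close> written without fractions.\<close>

definition vcl :: "'a set \<Rightarrow> 'a set"
  where "vcl A = {x \<in> carrier G. \<forall>a\<in>carrier G. \<forall>b\<in>carrier G.
           (\<forall>y\<in>A. a divides b \<otimes> y) \<longrightarrow> a divides b \<otimes> x}"

lemma vcl_subset: "vcl A \<subseteq> carrier G"
  by (auto simp: vcl_def)

lemma vcl_mem: "x \<in> vcl A \<longleftrightarrow> x \<in> carrier G \<and> (\<forall>a\<in>carrier G. \<forall>b\<in>carrier G.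
           (\<forall>y\<in>A. a divides b \<otimes> y) \<longrightarrow> a divides b \<otimes> x)"
  by (simp add: vcl_def)

lemma vclD: "x \<in> vcl A \<Longrightarrow> a \<in> carrier G \<Longrightarrow> b \<in> carrier G \<Longrightarrow> (\<And>y. y \<in> A \<Longrightarrow> a divides b \<otimes> y) \<Longrightarrow> a divides b \<otimes> x"
  by (simp add: vcl_def)

lemma subset_vcl: "A \<subseteq> carrier G \<Longrightarrow> A \<subseteq> vcl A"
  by (auto simp: vcl_def)

lemma vcl_idem: "vcl (vcl A) = vcl A"
  by (auto simp: vcl_def)

lemma mk_frac_in_ideal_inv:
  assumes "A \<subseteq> carrier G" "a \<in> carrier G" "b \<in> carrier G"
  shows "mk_frac G b a \<in> ideal_inv G (emb G ` A) \<longleftrightarrow> (\<forall>y\<in>A. a divides b \<otimes> y)"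
proof -
  have "mk_frac G b a \<otimes>\<^bsub>quot_grp G\<^esub> emb G y \<in> base G \<longleftrightarrow> a divides b \<otimes> y" if "y \<in> A" for y
    using that assms by (auto simp: emb_def mk_frac_in_base)
  then show ?thesis
    using assms by (simp add: ideal_inv_def colon_def)
qed

lemma v_closure_emb:
  assumes A: "A \<subseteq> carrier G"
  shows "v_closure G (emb G ` A) = emb G ` vcl A"
proof (intro equalityI subsetI)
  fix x assume x: "x \<in> v_closure G (emb G ` A)"
  then have "x \<in> carrier (quot_grp G)"
    and *: "\<And>z. z \<in> ideal_inv G (emb G ` A) \<Longrightarrow> x \<otimes>\<^bsub>quot_grp G\<^esub> z \<in> base G"
    by (auto simp: v_closure_def ideal_inv_def colon_def)
  have "mk_frac G \<one> \<one> \<in> ideal_inv G (emb G ` A)"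
    using A by (auto simp: mk_frac_in_ideal_inv)
  with * have "x \<otimes>\<^bsub>quot_grp G\<^esub> \<one>\<^bsub>quot_grp G\<^esub> \<in> base G"
    by (simp add: one_quot_grp)
  then obtain x' where x': "x' \<in> carrier G" "x = emb G x'"
    using \<open>x \<in> carrier _\<close> by (auto simp: base_def)
  have "a divides b \<otimes> x'" if "a \<in> carrier G" "b \<in> carrier G" "\<forall>y\<in>A. a divides b \<otimes> y" for a b
  proof -
    have "emb G x' \<otimes>\<^bsub>quot_grp G\<^esub> mk_frac G b a \<in> base G"
      using * that A x' by (simp add: mk_frac_in_ideal_inv)
    then show ?thesis
      using that x' by (simp add: emb_def mk_frac_in_base m_comm)
  qed
  then show "x \<in> emb G ` vcl A"
    using x' by (auto simp: vcl_def)
next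
  fix x assume "x \<in> emb G ` vcl A"
  then obtain x' where x': "x' \<in> vcl A" "x = emb G x'" by auto
  then have "x' \<in> carrier G" by (simp add: vcl_def)
  have "emb G x' \<otimes>\<^bsub>quot_grp G\<^esub> z \<in> base G" if z: "z \<in> ideal_inv G (emb G ` A)" for z
  proof -
    have "z \<in> carrier (quot_grp G)"
      using z by (simp add: ideal_inv_def colon_def)
    then obtain a b where ab: "a \<in> carrier G" "b \<in> carrier G" "z = mk_frac G b a"
      by (rule quot_grp_cases)
    then have "a divides b \<otimes> x'"
      using z A x' by (auto simp: mk_frac_in_ideal_inv vcl_def)
    then show ?thesis
      using ab \<open>x' \<in> carrier G\<close> by (simp add: emb_def mk_frac_in_base m_comm)
  qed
  then show "x \<in> v_closure G (emb G ` A)"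
    using x' \<open>x' \<in> carrier G\<close>
    by (simp add: v_closure_def colon_def ideal_inv_def[of G "ideal_inv G (emb G ` A)"])
qed

lemma v_ideal_emb:
  assumes "A \<subseteq> carrier G"
  shows "v_ideal G (emb G ` A) \<longleftrightarrow> vcl A = A"
proof -
  have "emb G ` vcl A = emb G ` A \<longleftrightarrow> vcl A = A"
    using assms vcl_subset by (intro emb_image_eq_iff)
  moreover have "emb G ` A \<subseteq> base G"
    using assms by (auto simp: base_def)
  ultimately show ?thesis
    by (simp add: v_ideal_def v_closure_emb assms)
qed

text \<open>Every set \<open>A\<close> contains a finite \<open>E\<close> with \<open>E\<^sup>-\<^sup>1 = A\<^sup>-\<^sup>1\<close>. This is equivalent to the ascending chain condition on
  \<open>v\<close>-ideals, but as a statement about divisibility it passes to localizations and can be checked in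
  the components of a finite product.\<close>

definition v_fin :: bool where
  "v_fin \<longleftrightarrow> (\<forall>A\<subseteq>carrier G. \<exists>E\<subseteq>A. finite E \<and> (\<forall>a\<in>carrier G. \<forall>b\<in>carrier G.
      (\<forall>y\<in>E. a divides b \<otimes> y) \<longrightarrow> (\<forall>y\<in>A. a divides b \<otimes> y)))"

lemma v_finE:
  assumes v_fin "A \<subseteq> carrier G"
  obtains E where "E \<subseteq> A" "finite E"
    "\<forall>a\<in>carrier G. \<forall>b\<in>carrier G. (\<forall>y\<in>E. a divides b \<otimes> y) \<longrightarrow> (\<forall>y\<in>A. a divides b \<otimes> y)"
proof -
  from assms have "\<exists>E\<subseteq>A. finite E \<and> (\<forall>a\<in>carrier G. \<forall>b\<in>carrier G.
      (\<forall>y\<in>E. a divides b \<otimes> y) \<longrightarrow> (\<forall>y\<in>A. a divides b \<otimes> y))"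
    unfolding v_fin_def by (elim allE impE)
  then obtain E where "E \<subseteq> A" "finite E" "\<forall>a\<in>carrier G. \<forall>b\<in>carrier G.
      (\<forall>y\<in>E. a divides b \<otimes> y) \<longrightarrow> (\<forall>y\<in>A. a divides b \<otimes> y)"
    by (elim exE conjE)
  then show ?thesis by (intro that) auto
qed

text \<open>A finite set that generates the union of a chain already lies in a member of the chain.\<close>

lemma v_fin_imp_v_noetherian:
  assumes fin: v_fin
  shows "v_noetherian G"
  unfolding v_noetherian_def
proof (intro conjI allI impI)
  show "comm_monoid_cancel G" by (rule is_comm_monoid_cancel)
  fix A :: "nat \<Rightarrow> 'a fraction set"
  assume A: "(\<forall>n. v_ideal G (A n)) \<and> (\<forall>n. A n \<subseteq> A (Suc n))"
  define B where "B n = pull (A n)" for n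
  have AB: "A n = emb G ` B n" for n
    using A by (simp add: B_def v_ideal_def emb_pull)
  have B: "B n \<subseteq> carrier G" "vcl (B n) = B n" for n
  proof -
    show B: "B n \<subseteq> carrier G" by (simp add: B_def pull_subset)
    show "vcl (B n) = B n"
      using A B AB by (simp flip: v_ideal_emb)
  qed
  have mono: "B m \<subseteq> B n" if "m \<le> n" for m n
    using lift_Suc_mono_le[of A m n] A that by (auto simp: B_def pull_def)
  have "(\<Union>n. B n) \<subseteq> carrier G" using B by blast
  from fin this obtain E where E: "E \<subseteq> (\<Union>n. B n)" "finite E"
    "\<forall>a\<in>carrier G. \<forall>b\<in>carrier G. (\<forall>y\<in>E. a divides b \<otimes> y) \<longrightarrow> (\<forall>y\<in>(\<Union>n. B n). a divides b \<otimes> y)"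
    by (rule v_finE)
  obtain f where f: "\<forall>e\<in>E. e \<in> B (f e)"
    using bchoice[of E "\<lambda>e n. e \<in> B n"] E(1) by blast
  define N where "N = Max (insert 0 (f ` E))"
  have "E \<subseteq> B N"
  proof
    fix e assume "e \<in> E"
    then have "f e \<le> N" unfolding N_def using E(2) by (intro Max_ge) auto
    with f \<open>e \<in> E\<close> show "e \<in> B N" using mono by blast
  qed
  have "B n \<subseteq> B N" for n
  proof
    fix x assume x: "x \<in> B n"
    have "x \<in> vcl (B N)"
      unfolding vcl_mem
    proof (intro conjI ballI impI)
      show "x \<in> carrier G" using x B by blast
      fix a b assume "a \<in> carrier G" "b \<in> carrier G" "\<forall>y\<in>B N. a divides b \<otimes> y"
      then show "a divides b \<otimes> x"
        using E(3) \<open>E \<subseteq> B N\<close> x by blast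
    qed
    then show "x \<in> B N" by (simp add: B)
  qed
  then have "A n = A N" if "n \<ge> N" for n
    unfolding AB using mono[OF that] by (intro arg_cong[where f = "image (emb G)"] subset_antisym) blast+
  then show "\<exists>N. \<forall>n\<ge>N. A n = A N" by blast
qed

text \<open>If no finite subset of \<open>A\<close> has the same closure, then choosing elements of \<open>A\<close> outside the
  closures of the previous choices gives an infinite chain of \<open>v\<close>-ideals.\<close>

lemma v_noetherian_imp_v_fin:
  assumes noeth: "v_noetherian G"
  shows v_fin
  unfolding v_fin_def
proof (intro allI impI, rule ccontr)
  fix A assume A: "A \<subseteq> carrier G"
    and no: "\<not> (\<exists>E\<subseteq>A. finite E \<and> (\<forall>a\<in>carrier G. \<forall>b\<in>carrier G.
      (\<forall>y\<in>E. a divides b \<otimes> y) \<longrightarrow> (\<forall>y\<in>A. a divides b \<otimes> y)))"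
  have ex: "\<exists>y\<in>A. y \<notin> vcl E" if "E \<subseteq> A" "finite E" for E
  proof (rule ccontr)
    assume "\<not> (\<exists>y\<in>A. y \<notin> vcl E)"
    then have "A \<subseteq> vcl E" by blast
    then have "\<forall>a\<in>carrier G. \<forall>b\<in>carrier G. (\<forall>y\<in>E. a divides b \<otimes> y) \<longrightarrow> (\<forall>y\<in>A. a divides b \<otimes> y)"
      by (auto simp: vcl_def subset_iff)
    with no that show False by blast
  qed
  define pick where "pick E = (SOME y. y \<in> A \<and> y \<notin> vcl E)" for E
  have pick: "pick E \<in> A" "pick E \<notin> vcl E" if "E \<subseteq> A" "finite E" for E
    using someI_ex[of "\<lambda>y. y \<in> A \<and> y \<notin> vcl E"] ex[OF that] by (auto simp: pick_def)
  define E where "E = rec_nat {} (\<lambda>_ E. insert (pick E) E)"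
  have E_Suc: "E (Suc n) = insert (pick (E n)) (E n)" and E_0: "E 0 = {}" for n
    by (simp_all add: E_def)
  have E: "E n \<subseteq> A \<and> finite (E n)" for n
    by (induction n) (auto simp: E_Suc E_0 pick)
  have in_carrier: "E n \<subseteq> carrier G" for n
    using E A by blast
  have "v_ideal G (emb G ` vcl (E n))" for n
    using vcl_subset by (simp add: v_ideal_emb vcl_idem)
  moreover have "emb G ` vcl (E n) \<subseteq> emb G ` vcl (E (Suc n))" for n
    by (intro image_mono) (auto simp: vcl_def E_Suc)
  ultimately have "(\<forall>n. v_ideal G (emb G ` vcl (E n))) \<and> (\<forall>n. emb G ` vcl (E n) \<subseteq> emb G ` vcl (E (Suc n)))"
    by blast
  with noeth have "\<exists>N. \<forall>n\<ge>N. emb G ` vcl (E n) = emb G ` vcl (E N)"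
    unfolding v_noetherian_def by (elim conjE allE[of _ "\<lambda>n. emb G ` vcl (E n)"]) simp
  then obtain N where "emb G ` vcl (E (Suc N)) = emb G ` vcl (E N)"
  proof (elim exE)
    fix N assume stable: "\<forall>n\<ge>N. emb G ` vcl (E n) = emb G ` vcl (E N)"
    show ?thesis by (rule that, rule stable[rule_format, of "Suc N"]) simp
  qed
  then have "vcl (E (Suc N)) = vcl (E N)"
    using vcl_subset by (simp add: emb_image_eq_iff)
  moreover have "pick (E N) \<in> vcl (E (Suc N))"
    using subset_vcl[OF in_carrier[of "Suc N"]] by (auto simp: E_Suc)
  ultimately show False
    using pick(2)[of "E N"] E by simp
qed

section \<open>Prime ideals and weakly Krull monoids\<close>

definition ideal_set :: "'a set \<Rightarrow> bool" where
  "ideal_set P \<longleftrightarrow> P \<subseteq> carrier G \<and> (\<forall>x\<in>P. \<forall>y\<in>carrier G. x \<otimes> y \<in> P)"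

definition prime_set :: "'a set \<Rightarrow> bool" where
  "prime_set P \<longleftrightarrow> ideal_set P \<and> \<one> \<notin> P \<and>
     (\<forall>x \<in> carrier G - P. \<forall>y \<in> carrier G - P. x \<otimes> y \<notin> P)"

lemma s_ideal_emb:
  assumes "A \<subseteq> carrier G"
  shows "s_ideal G (emb G ` A) \<longleftrightarrow> ideal_set A"
proof -
  have eq: "emb G ` A <#>\<^bsub>quot_grp G\<^esub> base G = emb G ` {x \<otimes> y | x y. x \<in> A \<and> y \<in> carrier G}"
    using assms by (simp add: base_def emb_set_mult)
  have sub: "{x \<otimes> y | x y. x \<in> A \<and> y \<in> carrier G} \<subseteq> carrier G"
    using assms by auto
  have "emb G ` {x \<otimes> y | x y. x \<in> A \<and> y \<in> carrier G} = emb G ` A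
      \<longleftrightarrow> {x \<otimes> y | x y. x \<in> A \<and> y \<in> carrier G} = A"
    using assms sub by (intro emb_image_eq_iff)
  also have "\<dots> \<longleftrightarrow> ideal_set A"
    using assms by (auto simp: ideal_set_def) (metis (no_types, lifting) one_closed r_one subsetD)
  finally have "emb G ` A <#>\<^bsub>quot_grp G\<^esub> base G = emb G ` A \<longleftrightarrow> ideal_set A"
    by (simp only: eq)
  moreover have "emb G ` A \<subseteq> base G"
    using assms by (auto simp: base_def)
  ultimately show ?thesis
    by (simp add: s_ideal_def)
qed

lemma prime_s_ideal_emb:
  assumes "A \<subseteq> carrier G"
  shows "prime_s_ideal G (emb G ` A) \<longleftrightarrow> prime_set A"
proof -
  have "emb G ` A \<noteq> base G \<longleftrightarrow> A \<noteq> carrier G"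
    using assms by (simp add: base_def emb_image_eq_iff)
  moreover have "(\<forall>x \<in> base G - emb G ` A. \<forall>y \<in> base G - emb G ` A. x \<otimes>\<^bsub>quot_grp G\<^esub> y \<in> base G - emb G ` A)
      \<longleftrightarrow> (\<forall>x \<in> carrier G - A. \<forall>y \<in> carrier G - A. x \<otimes> y \<notin> A)" (is "?l \<longleftrightarrow> ?r")
  proof
    assume l: ?l
    show ?r
    proof (intro ballI)
      fix x y assume "x \<in> carrier G - A" "y \<in> carrier G - A"
      then have "emb G x \<in> base G - emb G ` A" "emb G y \<in> base G - emb G ` A"
        using assms by (auto simp: base_def emb_image_iff)
      with l have "emb G x \<otimes>\<^bsub>quot_grp G\<^esub> emb G y \<notin> emb G ` A" by blast
      then show "x \<otimes> y \<notin> A"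
        using \<open>x \<in> _\<close> \<open>y \<in> _\<close> by auto
    qed
  next
    assume r: ?r
    show ?l
    proof (intro ballI)
      fix x y assume "x \<in> base G - emb G ` A" "y \<in> base G - emb G ` A"
      then obtain x' y' where "x' \<in> carrier G - A" "y' \<in> carrier G - A" "x = emb G x'" "y = emb G y'"
        by (auto simp: base_def)
      moreover then have "x' \<otimes> y' \<notin> A" using r by blast
      ultimately show "x \<otimes>\<^bsub>quot_grp G\<^esub> y \<in> base G - emb G ` A"
        using assms by (auto simp: base_def emb_image_iff)
    qed
  qed
  moreover have "A \<noteq> carrier G \<longleftrightarrow> \<one> \<notin> A" if "ideal_set A"
  proof
    assume "A \<noteq> carrier G"
    show "\<one> \<notin> A"
    proof
      assume "\<one> \<in> A"
      then have "\<one> \<otimes> y \<in> A" if "y \<in> carrier G" for y using that \<open>ideal_set A\<close> by (auto simp: ideal_set_def)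
      then show False using \<open>A \<noteq> carrier G\<close> assms by auto
    qed
  qed auto
  ultimately show ?thesis
    using assms by (auto simp: prime_s_ideal_def prime_set_def s_ideal_emb)
qed

definition min_prime_set :: "'a set \<Rightarrow> bool" where
  "min_prime_set P \<longleftrightarrow> prime_set P \<and> P \<noteq> {} \<and> (\<forall>P'. prime_set P' \<and> P' \<noteq> {} \<and> P' \<subseteq> P \<longrightarrow> P' = P)"

lemma prime_s_ideal_pull:
  assumes "prime_s_ideal G P"
  shows "P = emb G ` pull P" "prime_set (pull P)"
proof -
  show eq: "P = emb G ` pull P"
    using assms by (auto simp: prime_s_ideal_def s_ideal_def emb_pull)
  show "prime_set (pull P)"
    using assms eq pull_subset[of P] prime_s_ideal_emb[of "pull P"] by simp
qed

lemma min_primes_emb: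
  assumes "A \<subseteq> carrier G"
  shows "emb G ` A \<in> min_primes G \<longleftrightarrow> min_prime_set A"
proof
  assume l: "emb G ` A \<in> min_primes G"
  show "min_prime_set A"
    unfolding min_prime_set_def
  proof (intro conjI allI impI)
    show "prime_set A" "A \<noteq> {}"
      using l assms by (auto simp: min_primes_def prime_s_ideal_emb)
    fix P' assume P': "prime_set P' \<and> P' \<noteq> {} \<and> P' \<subseteq> A"
    then have "P' \<subseteq> carrier G" using assms by blast
    then have "prime_s_ideal G (emb G ` P')" "emb G ` P' \<noteq> {}" "emb G ` P' \<subseteq> emb G ` A"
      using P' by (auto simp: prime_s_ideal_emb)
    then have "emb G ` P' = emb G ` A"
      using l by (auto simp: min_primes_def)
    then show "P' = A"
      using assms \<open>P' \<subseteq> carrier G\<close> by (simp add: emb_image_eq_iff)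
  qed
next
  assume r: "min_prime_set A"
  have "P' = emb G ` A" if P': "prime_s_ideal G P'" "P' \<noteq> {}" "P' \<subseteq> emb G ` A" for P'
  proof -
    note eq = prime_s_ideal_pull[OF P'(1)]
    have "pull P' \<noteq> {}" using eq P' by auto
    moreover have "pull P' \<subseteq> A"
    proof
      fix x assume "x \<in> pull P'"
      then have "x \<in> carrier G" "emb G x \<in> emb G ` A" using P'(3) by (auto simp: pull_def)
      then show "x \<in> A" using emb_image_iff[OF assms] by simp
    qed
    ultimately have "pull P' = A"
      using r eq by (auto simp: min_prime_set_def)
    then show ?thesis using eq by simp
  qed
  then show "emb G ` A \<in> min_primes G"
    using r assms by (auto simp: min_primes_def min_prime_set_def prime_s_ideal_emb)
qed

lemma min_primes_pull:
  assumes "P \<in> min_primes G"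
  shows "P = emb G ` pull P" "min_prime_set (pull P)"
proof -
  show eq: "P = emb G ` pull P"
    using assms by (auto simp: min_primes_def dest: prime_s_ideal_pull)
  show "min_prime_set (pull P)"
    using assms eq pull_subset[of P] min_primes_emb[of "pull P"] by simp
qed

lemma localize_base:
  assumes "P \<subseteq> carrier G" "a \<in> carrier G" "b \<in> carrier G"
  shows "mk_frac G b a \<in> localize G (base G) (emb G ` P) \<longleftrightarrow> (\<exists>s\<in>carrier G - P. a divides s \<otimes> b)"
proof
  assume "mk_frac G b a \<in> localize G (base G) (emb G ` P)"
  then obtain c s where cs: "c \<in> carrier G" "s \<in> carrier G" "emb G s \<notin> emb G ` P"
      "mk_frac G b a = emb G c \<otimes>\<^bsub>quot_grp G\<^esub> inv\<^bsub>quot_grp G\<^esub> emb G s"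
    by (auto simp: localize_def base_def)
  then have "b \<otimes> s = c \<otimes> a"
    using assms by (simp add: mk_frac_eq_iff flip: mk_frac_eq_emb)
  then have "s \<otimes> b = a \<otimes> c"
    using assms cs by (simp add: m_comm)
  then show "\<exists>s\<in>carrier G - P. a divides s \<otimes> b"
    using cs by (intro bexI[of _ s]) auto
next
  assume "\<exists>s\<in>carrier G - P. a divides s \<otimes> b"
  then obtain c s where cs: "c \<in> carrier G" "s \<in> carrier G - P" "s \<otimes> b = a \<otimes> c"
    by (auto simp: factor_def)
  then have "mk_frac G b a = emb G c \<otimes>\<^bsub>quot_grp G\<^esub> inv\<^bsub>quot_grp G\<^esub> emb G s"
    using assms by (simp add: mk_frac_eq_iff m_comm flip: mk_frac_eq_emb)
  moreover have "emb G c \<in> base G" "emb G s \<in> base G - emb G ` P"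
    using cs assms by (auto simp: base_def emb_image_iff)
  ultimately show "mk_frac G b a \<in> localize G (base G) (emb G ` P)"
    by (auto simp: localize_def)
qed

text \<open>The fraction \<open>b/a\<close> lies in \<open>H\<close> if and only if \<open>a\<close> divides \<open>b\<close>, and in \<open>H\<^sub>P\<close> if and only if \<open>a\<close> divides
  some \<open>sb\<close> with \<open>s\<close> outside \<open>P\<close>.\<close>

lemma weakly_krull_iff:
  "weakly_krull G \<longleftrightarrow>
     (\<forall>a\<in>carrier G. \<forall>b\<in>carrier G.
        (\<forall>P. min_prime_set P \<longrightarrow> (\<exists>s\<in>carrier G - P. a divides s \<otimes> b)) \<longrightarrow> a divides b) \<and>
     (\<forall>a\<in>carrier G. finite {P. min_prime_set P \<and> a \<in> P})"
proof -
  have sub: "P \<subseteq> carrier G" if "min_prime_set P" for P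
    using that by (auto simp: min_prime_set_def prime_set_def ideal_set_def)
  have all: "(\<forall>P\<in>min_primes G. \<Phi> P) \<longleftrightarrow> (\<forall>P. min_prime_set P \<longrightarrow> \<Phi> (emb G ` P))" for \<Phi>
  proof (intro iffI allI impI ballI)
    fix P assume "\<forall>P\<in>min_primes G. \<Phi> P" "min_prime_set P"
    then show "\<Phi> (emb G ` P)" using sub min_primes_emb by simp
  next
    fix P assume *: "\<forall>P. min_prime_set P \<longrightarrow> \<Phi> (emb G ` P)" and "P \<in> min_primes G"
    then have "\<Phi> (emb G ` pull P)" using min_primes_pull(2)[of P] by simp
    then show "\<Phi> P" using min_primes_pull(1)[OF \<open>P \<in> min_primes G\<close>] by simp
  qed
  have local: "(\<forall>P\<in>min_primes G. mk_frac G b a \<in> carrier (local_monoid G P)) \<longleftrightarrow>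
      (\<forall>P. min_prime_set P \<longrightarrow> (\<exists>s\<in>carrier G - P. a divides s \<otimes> b))"
    if "a \<in> carrier G" "b \<in> carrier G" for a b
    unfolding all using sub that by (simp add: local_monoid_def localize_base)
  have "base G \<subseteq> {x \<in> carrier (quot_grp G). \<forall>P \<in> min_primes G. x \<in> carrier (local_monoid G P)}"
  proof (intro subsetI CollectI conjI)
    fix x assume x: "x \<in> base G"
    then show "x \<in> carrier (quot_grp G)" using base_subset by blast
    from x obtain b where "b \<in> carrier G" "x = mk_frac G b \<one>" by (auto simp: base_def emb_def)
    then show "\<forall>P \<in> min_primes G. x \<in> carrier (local_monoid G P)"
      using local[of \<one> b] by (auto simp: min_prime_set_def prime_set_def intro!: bexI[of _ \<one>])
  qed
  moreover have "{x \<in> carrier (quot_grp G). \<forall>P \<in> min_primes G. x \<in> carrier (local_monoid G P)} \<subseteq> base G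
    \<longleftrightarrow> (\<forall>a\<in>carrier G. \<forall>b\<in>carrier G.
        (\<forall>P. min_prime_set P \<longrightarrow> (\<exists>s\<in>carrier G - P. a divides s \<otimes> b)) \<longrightarrow> a divides b)"
    (is "?l \<longleftrightarrow> ?r")
  proof
    assume l: ?l
    show ?r
    proof (intro ballI impI)
      fix a b assume ab: "a \<in> carrier G" "b \<in> carrier G"
        and "\<forall>P. min_prime_set P \<longrightarrow> (\<exists>s\<in>carrier G - P. a divides s \<otimes> b)"
      then have "mk_frac G b a \<in> base G"
        using l local[OF ab] by auto
      then show "a divides b" using ab by (simp add: mk_frac_in_base)
    qed
  next
    assume r: ?r
    show ?l
    proof
      fix x assume x: "x \<in> {x \<in> carrier (quot_grp G). \<forall>P \<in> min_primes G. x \<in> carrier (local_monoid G P)}"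
      then have "x \<in> carrier (quot_grp G)" by simp
      then obtain a b where ab: "a \<in> carrier G" "b \<in> carrier G" "x = mk_frac G b a"
        by (rule quot_grp_cases)
      have "\<forall>P\<in>min_primes G. mk_frac G b a \<in> carrier (local_monoid G P)"
        using x unfolding ab(3) by blast
      then have "a divides b"
        using r ab(1,2) unfolding local[OF ab(1,2)] by blast
      then show "x \<in> base G"
        using ab by (simp add: mk_frac_in_base)
    qed
  qed
  moreover have "finite {P \<in> min_primes G. emb G a \<in> P} \<longleftrightarrow> finite {P. min_prime_set P \<and> a \<in> P}"
    if "a \<in> carrier G" for a
  proof -
    have "{P \<in> min_primes G. emb G a \<in> P} = (\<lambda>P. emb G ` P) ` {P. min_prime_set P \<and> a \<in> P}"
    proof (intro equalityI subsetI)
      fix P assume P: "P \<in> {P \<in> min_primes G. emb G a \<in> P}"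
      then have "a \<in> pull P" using that by (simp add: pull_def)
      then show "P \<in> (\<lambda>P. emb G ` P) ` {P. min_prime_set P \<and> a \<in> P}"
        using P min_primes_pull by blast
    next
      fix P assume "P \<in> (\<lambda>P. emb G ` P) ` {P. min_prime_set P \<and> a \<in> P}"
      then show "P \<in> {P \<in> min_primes G. emb G a \<in> P}"
        using sub min_primes_emb by auto
    qed
    moreover have "inj_on (\<lambda>P. emb G ` P) {P. min_prime_set P \<and> a \<in> P}"
      using sub by (intro inj_onI) (simp add: emb_image_eq_iff)
    ultimately show ?thesis
      by (simp add: finite_image_iff)
  qed
  then have "(\<forall>x\<in>base G. finite {P \<in> min_primes G. x \<in> P}) \<longleftrightarrow>
      (\<forall>a\<in>carrier G. finite {P. min_prime_set P \<and> a \<in> P})"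
    by (auto simp: base_def)
  ultimately show ?thesis
    unfolding weakly_krull_def using is_comm_monoid_cancel by blast
qed

text \<open>The divisors of products of powers of \<open>x\<close> and elements outside \<open>P\<close> form a divisor-closed submonoid. Its complement is
  a prime ideal properly contained in the minimal prime \<open>P\<close>, hence empty.\<close>

lemma min_prime_primary:
  assumes P: "min_prime_set P" and "a \<in> carrier G" and "x \<in> P"
  shows "\<exists>s\<in>carrier G - P. \<exists>n::nat. a divides s \<otimes> x [^] n"
proof (rule ccontr)
  assume no: "\<not> ?thesis"
  have x: "x \<in> carrier G" using P \<open>x \<in> P\<close> by (auto simp: min_prime_set_def prime_set_def ideal_set_def)
  define P' where "P' = {y \<in> carrier G. \<not> (\<exists>s\<in>carrier G - P. \<exists>n::nat. y divides s \<otimes> x [^] n)}"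
  have one: "\<one> \<in> carrier G - P" using P by (simp add: min_prime_set_def prime_set_def)
  have "prime_set P'"
    unfolding prime_set_def ideal_set_def
  proof (intro conjI ballI)
    show "P' \<subseteq> carrier G" by (auto simp: P'_def)
    fix y z assume yz: "y \<in> P'" "z \<in> carrier G"
    have "y divides s \<otimes> x [^] n" if "y \<otimes> z divides s \<otimes> x [^] n" "s \<in> carrier G" for s and n :: nat
    proof -
      have "y divides y \<otimes> z" using yz by (auto simp: P'_def)
      from divides_trans[OF this that(1)] show ?thesis using yz by (simp add: P'_def)
    qed
    then show "y \<otimes> z \<in> P'"
      using yz by (auto simp: P'_def)
  next
    show "\<one> \<notin> P'"
      using one x by (auto simp: P'_def intro!: bexI[of _ \<one>] exI[of _ "0::nat"])
  next
    fix y z assume "y \<in> carrier G - P'" "z \<in> carrier G - P'"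
    then obtain s n t m where yz: "y \<in> carrier G" "z \<in> carrier G"
      and "s \<in> carrier G - P" "t \<in> carrier G - P"
      and dv: "y divides s \<otimes> x [^] (n::nat)" "z divides t \<otimes> x [^] (m::nat)"
      by (auto simp: P'_def)
    moreover have "y \<otimes> z divides (s \<otimes> t) \<otimes> x [^] (n + m)"
    proof -
      obtain u v where uv: "u \<in> carrier G" "v \<in> carrier G" "s \<otimes> x [^] n = y \<otimes> u" "t \<otimes> x [^] m = z \<otimes> v"
        using dv by (auto simp: factor_def)
      have "(s \<otimes> t) \<otimes> x [^] (n + m) = (s \<otimes> x [^] n) \<otimes> (t \<otimes> x [^] m)"
        using x \<open>s \<in> _\<close> \<open>t \<in> _\<close> by (simp add: nat_pow_mult[symmetric] m_ac)
      also have "\<dots> = (y \<otimes> z) \<otimes> (u \<otimes> v)"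
        unfolding uv(3,4) using uv(1,2) yz by (simp add: m_ac)
      finally show ?thesis using uv by auto
    qed
    moreover have "s \<otimes> t \<in> carrier G - P"
      using P \<open>s \<in> _\<close> \<open>t \<in> _\<close> by (auto simp: min_prime_set_def prime_set_def)
    ultimately show "y \<otimes> z \<notin> P'"
      by (auto simp: P'_def)
  qed
  moreover have "a \<in> P'" using no \<open>a \<in> carrier G\<close> by (auto simp: P'_def)
  moreover have "P' \<subseteq> P"
  proof
    fix y assume "y \<in> P'"
    show "y \<in> P"
    proof (rule ccontr)
      assume "y \<notin> P"
      with \<open>y \<in> P'\<close> have "y \<in> carrier G - P" "y divides y \<otimes> x [^] (0::nat)"
        by (auto simp: P'_def)
      with \<open>y \<in> P'\<close> show False unfolding P'_def by blast
    qed
  qed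
  ultimately have "P' = P"
    using P by (auto simp: min_prime_set_def)
  moreover have "x \<notin> P'"
  proof -
    have "x divides \<one> \<otimes> x [^] (1::nat)" using x by simp
    then show ?thesis using one unfolding P'_def by blast
  qed
  ultimately show False using \<open>x \<in> P\<close> by simp
qed

end

section \<open>Reduced monoids\<close>

context comm_monoid_cancel
begin

lemma unit_coset: "x \<in> Units G #> a \<longleftrightarrow> (\<exists>u\<in>Units G. x = u \<otimes> a)"
  by (auto simp: r_coset_def)

lemma unit_coset_associated:
  assumes "a \<in> carrier G" "x \<in> carrier G"
  shows "x \<in> Units G #> a \<longleftrightarrow> x \<sim> a"
proof
  assume "x \<in> Units G #> a"
  then obtain u where u: "u \<in> Units G" "x = u \<otimes> a"
    by (auto simp: unit_coset)
  then have "x = a \<otimes> u"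
    using assms by (simp add: m_comm Units_closed)
  with u show "x \<sim> a"
    using assms by (intro associatedI2')
next
  assume "x \<sim> a"
  then obtain u where "u \<in> Units G" "x = a \<otimes> u"
    using assms associatedD2 by blast
  moreover then have "x = u \<otimes> a"
    using assms by (simp add: m_comm Units_closed)
  ultimately show "x \<in> Units G #> a"
    unfolding unit_coset by blast
qed

lemma unit_coset_subset: "a \<in> carrier G \<Longrightarrow> Units G #> a \<subseteq> carrier G"
  by (auto simp: r_coset_def)

lemma unit_coset_eq_iff:
  assumes "a \<in> carrier G" "b \<in> carrier G"
  shows "Units G #> a = Units G #> b \<longleftrightarrow> a \<sim> b"
proof
  assume "Units G #> a = Units G #> b"
  moreover have "a \<in> Units G #> a" using assms by (simp add: unit_coset_associated)
  ultimately show "a \<sim> b" using assms by (simp add: unit_coset_associated)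
next
  assume ab: "a \<sim> b"
  show "Units G #> a = Units G #> b"
  proof (rule Set.set_eqI)
    fix x
    show "x \<in> Units G #> a \<longleftrightarrow> x \<in> Units G #> b"
    proof (cases "x \<in> carrier G")
      case True
      then show ?thesis
        using assms ab associated_trans[OF _ ab] associated_trans[OF _ associated_sym[OF ab]]
        by (auto simp: unit_coset_associated)
    next
      case False
      then show ?thesis using unit_coset_subset assms by blast
    qed
  qed
qed

lemma reduced_carrier: "carrier (reduced G) = (\<lambda>a. Units G #> a) ` carrier G"
  by (auto simp: reduced_def FactGroup_def RCOSETS_def)

lemma reduced_mult:
  assumes "a \<in> carrier G" "b \<in> carrier G"
  shows "(Units G #> a) \<otimes>\<^bsub>reduced G\<^esub> (Units G #> b) = Units G #> (a \<otimes> b)"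
proof -
  have "(Units G #> a) <#> (Units G #> b) = Units G #> (a \<otimes> b)"
  proof (intro equalityI subsetI)
    fix x assume "x \<in> (Units G #> a) <#> (Units G #> b)"
    then obtain u v where uv: "u \<in> Units G" "v \<in> Units G" "x = (u \<otimes> a) \<otimes> (v \<otimes> b)"
      by (auto simp: set_mult_def unit_coset)
    moreover then have "x = (u \<otimes> v) \<otimes> (a \<otimes> b)"
      using assms by (simp add: m_ac Units_closed)
    ultimately show "x \<in> Units G #> (a \<otimes> b)"
      unfolding unit_coset by (intro bexI[of _ "u \<otimes> v"]) auto
  next
    fix x assume "x \<in> Units G #> (a \<otimes> b)"
    then obtain u where u: "u \<in> Units G" "x = u \<otimes> (a \<otimes> b)"
      by (auto simp: unit_coset)
    then have "x = (u \<otimes> a) \<otimes> (\<one> \<otimes> b)"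
      using assms by (simp add: m_ac Units_closed)
    moreover have "u \<otimes> a \<in> Units G #> a" "\<one> \<otimes> b \<in> Units G #> b"
      using u Units_one_closed unfolding unit_coset by blast+
    ultimately show "x \<in> (Units G #> a) <#> (Units G #> b)"
      unfolding set_mult_def by blast
  qed
  then show ?thesis by (simp add: reduced_def FactGroup_def)
qed

lemma reduced_one: "\<one>\<^bsub>reduced G\<^esub> = Units G #> \<one>"
  using Units_closed by (auto simp: reduced_def FactGroup_def r_coset_def)

lemma reduced_divides:
  assumes "a \<in> carrier G" "b \<in> carrier G"
  shows "(Units G #> a) divides\<^bsub>reduced G\<^esub> (Units G #> b) \<longleftrightarrow> a divides b"
proof
  assume "(Units G #> a) divides\<^bsub>reduced G\<^esub> (Units G #> b)"
  then obtain c where "c \<in> carrier G" "Units G #> b = Units G #> (a \<otimes> c)"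
    using assms by (auto simp: factor_def reduced_carrier reduced_mult)
  then have "b \<sim> a \<otimes> c" using assms by (simp add: unit_coset_eq_iff)
  then have "a \<otimes> c divides b" by (auto simp: associated_def)
  moreover have "a divides a \<otimes> c" using \<open>c \<in> _\<close> by auto
  ultimately show "a divides b" using assms divides_trans by blast
next
  assume "a divides b"
  then show "(Units G #> a) divides\<^bsub>reduced G\<^esub> (Units G #> b)"
    using assms by (auto simp: factor_def reduced_carrier reduced_mult)
qed

lemma reduced_cancel: "comm_monoid_cancel (reduced G)"
proof (rule comm_monoid_cancelI)
  show "comm_monoid (reduced G)"
    by (rule comm_monoidI) (auto simp: reduced_carrier reduced_mult reduced_one m_ac)
  fix a b c
  assume "a \<otimes>\<^bsub>reduced G\<^esub> c = b \<otimes>\<^bsub>reduced G\<^esub> c"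
    and "a \<in> carrier (reduced G)" "b \<in> carrier (reduced G)" "c \<in> carrier (reduced G)"
  moreover from this obtain x y z where "x \<in> carrier G" "y \<in> carrier G" "z \<in> carrier G"
      and eqs: "a = Units G #> x" "b = Units G #> y" "c = Units G #> z"
    by (auto simp: reduced_carrier)
  ultimately have "x \<otimes> z \<sim> y \<otimes> z"
    by (simp add: reduced_mult unit_coset_eq_iff)
  then have "x \<sim> y"
    using \<open>x \<in> _\<close> \<open>y \<in> _\<close> \<open>z \<in> _\<close> by (rule assoc_r_cancel)
  then show "a = b"
    using \<open>x \<in> _\<close> \<open>y \<in> _\<close> by (simp add: eqs unit_coset_eq_iff)
qed

lemma reduced_Units: "Units (reduced G) = {\<one>\<^bsub>reduced G\<^esub>}"
proof -
  interpret R: comm_monoid_cancel "reduced G" by (rule reduced_cancel)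
  have "x = \<one>\<^bsub>reduced G\<^esub>" if "x \<in> Units (reduced G)" for x
  proof -
    have "x \<in> carrier (reduced G)" using that by (rule R.Units_closed)
    then obtain a where a: "a \<in> carrier G" "x = Units G #> a"
      by (auto simp: reduced_carrier)
    have "x divides\<^bsub>reduced G\<^esub> \<one>\<^bsub>reduced G\<^esub>"
      using that R.Unit_eq_dividesone[of x] R.Units_closed by simp
    then have "a divides \<one>" using a by (simp add: reduced_one reduced_divides)
    then show ?thesis using a unit_divides[of \<one> a]
      by (simp add: reduced_one unit_coset_eq_iff associated_def)
  qed
  then show ?thesis using R.Units_one_closed by blast
qed

end

lemma (in comm_monoid_cancel) reduced_antisym:
  assumes "Units G = {\<one>}" "a \<in> carrier G" "b \<in> carrier G" "a divides b" "b divides a"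
  shows "a = b"
proof -
  have "a \<sim> b" using assms by (simp add: associated_def)
  then obtain u where "u \<in> Units G" "a = b \<otimes> u" using assms associatedD2 by blast
  then show ?thesis using assms by simp
qed


section \<open>Reduced localizations\<close>

context comm_monoid_cancel
begin

interpretation Q: comm_group "quot_grp G"
  by (rule quot_grp_comm_group)

text \<open>The coset \<open>aH\<^sub>P\<^sup>\<times>\<close>, that is, the \<open>P\<close>-component of \<open>aH\<close>. As each element of \<open>H\<^sub>P\<close> is an element of \<open>H\<close> up to
  a unit of \<open>H\<^sub>P\<close>, all of \<open>(H\<^sub>P)\<^sub>r\<^sub>e\<^sub>d\<close> is obtained in this way, and divisibility there can be expressed
  by divisibility in \<open>H\<close>.\<close>

definition loc_res :: "'a fraction set \<Rightarrow> 'a \<Rightarrow> 'a fraction set" where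
  "loc_res P a = Units (local_monoid G P) #>\<^bsub>local_monoid G P\<^esub> emb G a"

context
  fixes P assumes prime: "prime_s_ideal G P"
begin

lemma prime_pull: "prime_set (pull P)"
  using prime by (rule prime_s_ideal_pull)

lemma mk_frac_in_local:
  "a \<in> carrier G \<Longrightarrow> b \<in> carrier G \<Longrightarrow>
     mk_frac G b a \<in> carrier (local_monoid G P) \<longleftrightarrow> (\<exists>s\<in>carrier G - pull P. a divides s \<otimes> b)"
  using localize_base[of "pull P" a b] prime_s_ideal_pull(1)[OF prime, symmetric]
  by (simp add: local_monoid_def pull_subset)

lemma local_simps:
  "mult (local_monoid G P) = mult (quot_grp G)" "one (local_monoid G P) = one (quot_grp G)"
  by (auto simp: local_monoid_def)

lemma local_carrier_sub: "x \<in> carrier (local_monoid G P) \<Longrightarrow> x \<in> carrier (quot_grp G)"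
  using base_subset by (auto simp: local_monoid_def localize_def)

lemma local_cases:
  assumes "x \<in> carrier (local_monoid G P)"
  obtains c s where "c \<in> carrier G" "s \<in> carrier G - pull P" "x = mk_frac G c s"
proof -
  from assms obtain c s where "c \<in> carrier G" "s \<in> carrier G" "emb G s \<notin> P"
      "x = emb G c \<otimes>\<^bsub>quot_grp G\<^esub> inv\<^bsub>quot_grp G\<^esub> emb G s"
    by (auto simp: local_monoid_def localize_def base_def)
  then show ?thesis by (intro that[of c s]) (auto simp: pull_def mk_frac_eq_emb)
qed

lemma mk_frac_local: "c \<in> carrier G \<Longrightarrow> s \<in> carrier G - pull P \<Longrightarrow> mk_frac G c s \<in> carrier (local_monoid G P)"
  using m_comm[of s c] by (subst mk_frac_in_local) (auto intro!: bexI[of _ s])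

lemma not_in_pull_mult: "s \<in> carrier G - pull P \<Longrightarrow> t \<in> carrier G - pull P \<Longrightarrow> s \<otimes> t \<in> carrier G - pull P"
  using prime_pull by (auto simp: prime_set_def)

lemma one_not_in_pull: "\<one> \<in> carrier G - pull P"
  using prime_pull by (auto simp: prime_set_def)

lemma emb_local: "a \<in> carrier G \<Longrightarrow> emb G a \<in> carrier (local_monoid G P)"
  using mk_frac_local[of a \<one>] one_not_in_pull by (simp add: emb_def)

lemma local_cancel: "comm_monoid_cancel (local_monoid G P)"
proof (rule comm_monoid_cancelI)
  show "comm_monoid (local_monoid G P)"
  proof (rule comm_monoidI, unfold local_simps)
    fix x y assume x: "x \<in> carrier (local_monoid G P)" and y: "y \<in> carrier (local_monoid G P)"
    obtain c s where c: "c \<in> carrier G" "s \<in> carrier G - pull P" "x = mk_frac G c s"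
      using x by (rule local_cases)
    obtain d t where d: "d \<in> carrier G" "t \<in> carrier G - pull P" "y = mk_frac G d t"
      using y by (rule local_cases)
    have "s \<in> carrier G" "t \<in> carrier G" using c d by auto
    then show "x \<otimes>\<^bsub>quot_grp G\<^esub> y \<in> carrier (local_monoid G P)"
      using c d not_in_pull_mult by (simp add: mk_frac_local)
    show "x \<otimes>\<^bsub>quot_grp G\<^esub> y = y \<otimes>\<^bsub>quot_grp G\<^esub> x"
      using x y local_carrier_sub by (simp add: Q.m_comm)
  next
    show "\<one>\<^bsub>quot_grp G\<^esub> \<in> carrier (local_monoid G P)"
      using emb_local[of \<one>] by (simp add: emb_one)
  qed (simp_all add: local_carrier_sub Q.m_assoc)
qed (auto simp: local_simps dest!: local_carrier_sub)

lemma emb_divides_local: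
  assumes "a \<in> carrier G" "b \<in> carrier G"
  shows "emb G a divides\<^bsub>local_monoid G P\<^esub> emb G b \<longleftrightarrow> (\<exists>s\<in>carrier G - pull P. a divides s \<otimes> b)"
proof -
  have "emb G b = emb G a \<otimes>\<^bsub>quot_grp G\<^esub> z \<longleftrightarrow> z = mk_frac G b a" if z: "z \<in> carrier (local_monoid G P)" for z
  proof -
    have "emb G a \<otimes>\<^bsub>quot_grp G\<^esub> mk_frac G b a = emb G b"
      using assms by (simp add: emb_def mk_frac_eq_iff m_comm)
    then have "emb G b = emb G a \<otimes>\<^bsub>quot_grp G\<^esub> z \<longleftrightarrow>
        emb G a \<otimes>\<^bsub>quot_grp G\<^esub> mk_frac G b a = emb G a \<otimes>\<^bsub>quot_grp G\<^esub> z" by simp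
    then show ?thesis
      using assms local_carrier_sub[OF z] by auto
  qed
  then have "emb G a divides\<^bsub>local_monoid G P\<^esub> emb G b \<longleftrightarrow> mk_frac G b a \<in> carrier (local_monoid G P)"
    by (auto simp: factor_def local_simps)
  then show ?thesis using assms by (simp add: mk_frac_in_local)
qed

lemma loc_res_closed: "a \<in> carrier G \<Longrightarrow> loc_res P a \<in> carrier (reduced (local_monoid G P))"
  using comm_monoid_cancel.reduced_carrier[OF local_cancel] emb_local by (simp add: loc_res_def)

lemma loc_res_mult:
  "a \<in> carrier G \<Longrightarrow> b \<in> carrier G \<Longrightarrow>
     loc_res P (a \<otimes> b) = loc_res P a \<otimes>\<^bsub>reduced (local_monoid G P)\<^esub> loc_res P b"
  using comm_monoid_cancel.reduced_mult[OF local_cancel emb_local emb_local, of a b]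
  by (simp add: loc_res_def local_simps)

lemma loc_res_one: "loc_res P \<one> = \<one>\<^bsub>reduced (local_monoid G P)\<^esub>"
  using comm_monoid_cancel.reduced_one[OF local_cancel] by (simp add: loc_res_def emb_one local_simps)

lemma loc_res_divides:
  "a \<in> carrier G \<Longrightarrow> b \<in> carrier G \<Longrightarrow>
     loc_res P a divides\<^bsub>reduced (local_monoid G P)\<^esub> loc_res P b \<longleftrightarrow>
       (\<exists>s\<in>carrier G - pull P. a divides s \<otimes> b)"
  using comm_monoid_cancel.reduced_divides[OF local_cancel emb_local emb_local, of a b]
  by (simp add: loc_res_def emb_divides_local)

lemma loc_res_surj:
  assumes "f \<in> carrier (reduced (local_monoid G P))"
  shows "\<exists>a\<in>carrier G. f = loc_res P a"
proof -
  interpret L: comm_monoid_cancel "local_monoid G P" by (rule local_cancel)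
  from assms obtain x where x: "x \<in> carrier (local_monoid G P)" "f = Units (local_monoid G P) #>\<^bsub>local_monoid G P\<^esub> x"
    by (auto simp: L.reduced_carrier)
  from x(1) obtain c s where c: "c \<in> carrier G" "s \<in> carrier G - pull P" "x = mk_frac G c s"
    by (rule local_cases)
  have s: "s \<in> carrier G" using c by simp
  have e1: "emb G c = x \<otimes>\<^bsub>local_monoid G P\<^esub> emb G s"
    using c s by (simp add: local_simps emb_def mk_frac_eq_iff m_comm)
  have e2: "emb G c \<otimes>\<^bsub>local_monoid G P\<^esub> mk_frac G \<one> s = x"
    using c s by (simp add: local_simps emb_def mk_frac_eq_iff m_comm)
  have "x divides\<^bsub>local_monoid G P\<^esub> emb G c" using e1 emb_local[OF s] by (auto simp: factor_def)
  moreover have "emb G c divides\<^bsub>local_monoid G P\<^esub> x"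
    using e2 mk_frac_local[OF one_closed c(2)] by (auto simp: factor_def)
  ultimately have "f = loc_res P c"
    unfolding loc_res_def x(2) using x(1) emb_local[OF c(1)]
    by (subst L.unit_coset_eq_iff) (auto simp: associated_def)
  then show ?thesis using c by blast
qed

lemma loc_res_eq_one_iff:
  assumes "a \<in> carrier G"
  shows "loc_res P a = \<one>\<^bsub>reduced (local_monoid G P)\<^esub> \<longleftrightarrow> a \<notin> pull P"
proof -
  interpret L: comm_monoid_cancel "local_monoid G P" by (rule local_cancel)
  interpret R: comm_monoid_cancel "reduced (local_monoid G P)" by (rule L.reduced_cancel)
  have "loc_res P a = \<one>\<^bsub>reduced (local_monoid G P)\<^esub> \<longleftrightarrow> loc_res P a \<in> Units (reduced (local_monoid G P))"
    by (simp add: L.reduced_Units)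
  also have "\<dots> \<longleftrightarrow> loc_res P a divides\<^bsub>reduced (local_monoid G P)\<^esub> loc_res P \<one>"
    using R.Unit_eq_dividesone loc_res_closed[OF assms] by (simp add: loc_res_one)
  also have "\<dots> \<longleftrightarrow> (\<exists>s\<in>carrier G - pull P. a divides s)"
    using assms by (auto simp: loc_res_divides)
  also have "\<dots> \<longleftrightarrow> a \<notin> pull P"
    using assms prime_pull by (auto simp: prime_set_def ideal_set_def factor_def)
  finally show ?thesis .
qed

text \<open>If \<open>c\<close> generates \<open>A\<close> locally, then the other local generators are the associates of \<open>c\<close> in \<open>H\<^sub>P\<close>, and these
  form the coset \<open>cH\<^sub>P\<^sup>\<times>\<close>.\<close>

lemma p_component_eq:
  assumes A: "ideal_set A" and c: "c \<in> A"
    and gen: "\<And>x. x \<in> A \<Longrightarrow> loc_res P c divides\<^bsub>reduced (local_monoid G P)\<^esub> loc_res P x"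
  shows "p_component G P (emb G ` A) = loc_res P c"
proof -
  interpret L: comm_monoid_cancel "local_monoid G P" by (rule local_cancel)
  have sub: "A \<subseteq> carrier G" using A by (simp add: ideal_set_def)
  then have cC: "c \<in> carrier G" using c by blast
  have "localize G (emb G ` A) P = emb G c <#\<^bsub>quot_grp G\<^esub> carrier (local_monoid G P)"
  proof (intro equalityI subsetI)
    fix z assume "z \<in> localize G (emb G ` A) P"
    then obtain y s where ys: "y \<in> A" "s \<in> carrier G - pull P" "z = emb G y \<otimes>\<^bsub>quot_grp G\<^esub> inv\<^bsub>quot_grp G\<^esub> emb G s"
      by (auto simp: localize_def base_def pull_def)
    then have yC: "y \<in> carrier G" and sC: "s \<in> carrier G" using sub by auto
    have z: "z = mk_frac G y s" using ys yC sC by (simp add: mk_frac_eq_emb)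
    obtain t where t: "t \<in> carrier G - pull P" "c divides t \<otimes> y"
      using gen[OF ys(1)] cC yC by (auto simp: loc_res_divides)
    have tC: "t \<in> carrier G" using t by simp
    have "c \<otimes> s divides (t \<otimes> y) \<otimes> s"
      using t(2) tC yC sC cC by (intro divides_mult_rI) auto
    also have "(t \<otimes> y) \<otimes> s = (t \<otimes> s) \<otimes> y" using tC yC sC by (simp add: m_ac)
    finally have "mk_frac G y (c \<otimes> s) \<in> carrier (local_monoid G P)"
      using not_in_pull_mult[OF t(1) ys(2)] cC sC yC by (subst mk_frac_in_local) auto
    moreover have "z = emb G c \<otimes>\<^bsub>quot_grp G\<^esub> mk_frac G y (c \<otimes> s)"
      unfolding z emb_def using cC sC yC by (simp add: mk_frac_eq_iff m_ac)
    ultimately show "z \<in> emb G c <#\<^bsub>quot_grp G\<^esub> carrier (local_monoid G P)"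
      by (auto simp: l_coset_def)
  next
    fix z assume "z \<in> emb G c <#\<^bsub>quot_grp G\<^esub> carrier (local_monoid G P)"
    then obtain x where x: "x \<in> carrier (local_monoid G P)" "z = emb G c \<otimes>\<^bsub>quot_grp G\<^esub> x"
      by (auto simp: l_coset_def)
    from x(1) obtain d s where d: "d \<in> carrier G" "s \<in> carrier G - pull P" "x = mk_frac G d s"
      by (rule local_cases)
    have sC: "s \<in> carrier G" using d by simp
    have "z = emb G (c \<otimes> d) \<otimes>\<^bsub>quot_grp G\<^esub> inv\<^bsub>quot_grp G\<^esub> emb G s"
      using x d sC cC by (simp add: emb_def)
    moreover have "c \<otimes> d \<in> A" using A c d by (simp add: ideal_set_def)
    moreover have "emb G s \<in> base G - P" using d by (auto simp: base_def pull_def)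
    ultimately show "z \<in> localize G (emb G ` A) P"
      by (auto simp: localize_def)
  qed
  then have "p_component G P (emb G ` A) = {x \<in> carrier (local_monoid G P).
      emb G c <#\<^bsub>local_monoid G P\<^esub> carrier (local_monoid G P) = x <#\<^bsub>local_monoid G P\<^esub> carrier (local_monoid G P)}"
    by (simp add: p_component_def l_coset_def local_simps)
  also have "\<dots> = {x \<in> carrier (local_monoid G P). x \<in> loc_res P c}"
  proof (rule Collect_cong, rule conj_cong[OF refl])
    fix x assume x: "x \<in> carrier (local_monoid G P)"
    have "y <#\<^bsub>local_monoid G P\<^esub> carrier (local_monoid G P) = {z. y divides\<^bsub>local_monoid G P\<^esub> z}" for y
      by (auto simp: l_coset_def factor_def)
    then have "emb G c <#\<^bsub>local_monoid G P\<^esub> carrier (local_monoid G P) = x <#\<^bsub>local_monoid G P\<^esub> carrier (local_monoid G P)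
        \<longleftrightarrow> {z. emb G c divides\<^bsub>local_monoid G P\<^esub> z} = {z. x divides\<^bsub>local_monoid G P\<^esub> z}"
      by simp
    also have "\<dots> \<longleftrightarrow> x \<sim>\<^bsub>local_monoid G P\<^esub> emb G c"
    proof
      assume eq: "{z. emb G c divides\<^bsub>local_monoid G P\<^esub> z} = {z. x divides\<^bsub>local_monoid G P\<^esub> z}"
      have "emb G c divides\<^bsub>local_monoid G P\<^esub> emb G c" "x divides\<^bsub>local_monoid G P\<^esub> x"
        using x emb_local[OF cC] by auto
      then have "x divides\<^bsub>local_monoid G P\<^esub> emb G c" "emb G c divides\<^bsub>local_monoid G P\<^esub> x"
        using eq by blast+
      then show "x \<sim>\<^bsub>local_monoid G P\<^esub> emb G c" by (simp add: associated_def)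
    next
      assume "x \<sim>\<^bsub>local_monoid G P\<^esub> emb G c"
      then show "{z. emb G c divides\<^bsub>local_monoid G P\<^esub> z} = {z. x divides\<^bsub>local_monoid G P\<^esub> z}"
        using x emb_local[OF cC] by (auto simp: associated_def intro: L.divides_trans)
    qed
    also have "\<dots> \<longleftrightarrow> x \<in> loc_res P c"
      unfolding loc_res_def using L.unit_coset_associated x emb_local[OF cC] by simp
    finally show "(emb G c <#\<^bsub>local_monoid G P\<^esub> carrier (local_monoid G P) = x <#\<^bsub>local_monoid G P\<^esub> carrier (local_monoid G P))
       = (x \<in> loc_res P c)" .
  qed
  also have "\<dots> = loc_res P c"
    using L.unit_coset_subset[OF emb_local[OF cC]] by (auto simp: loc_res_def)
  finally show ?thesis .
qed

end

end

section \<open>Families of primary localizations\<close>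

text \<open>The properties of a \<open>v\<close>-noetherian weakly Krull monoid \<open>H\<close> on which the theory of its \<open>v\<close>-invertible ideals
  rests. Here \<open>r P\<close> is the map from \<open>H\<close> to \<open>R P = (H\<^sub>P)\<^sub>r\<^sub>e\<^sub>d\<close>, and \<open>r P s = 1\<close> says that \<open>s\<close> is not in \<open>P\<close>. In this
  form \<open>global\<close> is \<open>H = \<Inter>H\<^sub>P\<close>, while \<open>primary\<close> and \<open>separate\<close> express that the primes are minimal.\<close>

locale primary_family = comm_monoid_cancel G for G :: "('a, 'm) monoid_scheme" (structure) +
  fixes X :: "'i set" and R :: "'i \<Rightarrow> ('b, 'n) monoid_scheme" and r :: "'i \<Rightarrow> 'a \<Rightarrow> 'b"
  assumes R_cancel: "P \<in> X \<Longrightarrow> comm_monoid_cancel (R P)"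
    and R_reduced: "P \<in> X \<Longrightarrow> Units (R P) = {\<one>\<^bsub>R P\<^esub>}"
    and r_closed [simp]: "P \<in> X \<Longrightarrow> a \<in> carrier G \<Longrightarrow> r P a \<in> carrier (R P)"
    and r_mult [simp]: "P \<in> X \<Longrightarrow> a \<in> carrier G \<Longrightarrow> b \<in> carrier G \<Longrightarrow> r P (a \<otimes> b) = r P a \<otimes>\<^bsub>R P\<^esub> r P b"
    and r_one [simp]: "P \<in> X \<Longrightarrow> r P \<one> = \<one>\<^bsub>R P\<^esub>"
    and r_surj: "P \<in> X \<Longrightarrow> f \<in> carrier (R P) \<Longrightarrow> \<exists>a\<in>carrier G. f = r P a"
    and r_divides: "P \<in> X \<Longrightarrow> a \<in> carrier G \<Longrightarrow> b \<in> carrier G \<Longrightarrow>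
        r P a divides\<^bsub>R P\<^esub> r P b \<longleftrightarrow> (\<exists>s\<in>carrier G. r P s = \<one>\<^bsub>R P\<^esub> \<and> a divides s \<otimes> b)"
    and global: "a \<in> carrier G \<Longrightarrow> b \<in> carrier G \<Longrightarrow> (\<And>P. P \<in> X \<Longrightarrow> r P a divides\<^bsub>R P\<^esub> r P b) \<Longrightarrow> a divides b"
    and finite_support: "a \<in> carrier G \<Longrightarrow> finite {P \<in> X. r P a \<noteq> \<one>\<^bsub>R P\<^esub>}"
    and primary: "P \<in> X \<Longrightarrow> x \<in> carrier G \<Longrightarrow> y \<in> carrier G \<Longrightarrow> r P x \<noteq> \<one>\<^bsub>R P\<^esub> \<Longrightarrow>
        \<exists>n::nat. r P y divides\<^bsub>R P\<^esub> r P (x [^] n)"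
    and nontrivial: "P \<in> X \<Longrightarrow> \<exists>e\<in>carrier G. r P e \<noteq> \<one>\<^bsub>R P\<^esub>"
    and separate: "P \<in> X \<Longrightarrow> Q \<in> X \<Longrightarrow> P \<noteq> Q \<Longrightarrow> \<exists>e\<in>carrier G. r P e = \<one>\<^bsub>R P\<^esub> \<and> r Q e \<noteq> \<one>\<^bsub>R Q\<^esub>"
    and fin: v_fin
    and X_nonempty: "X \<noteq> {}"
begin

lemma r_pow [simp]: "P \<in> X \<Longrightarrow> a \<in> carrier G \<Longrightarrow> r P (a [^] (n::nat)) = r P a [^]\<^bsub>R P\<^esub> n"
proof (induction n)
  case 0
  interpret R: comm_monoid_cancel "R P" by (rule R_cancel) fact
  show ?case using 0 by simp
next
  case (Suc n)
  interpret R: comm_monoid_cancel "R P" by (rule R_cancel) fact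
  show ?case using Suc by simp
qed

lemma r_divides_global:
  "P \<in> X \<Longrightarrow> a divides b \<Longrightarrow> a \<in> carrier G \<Longrightarrow> r P a divides\<^bsub>R P\<^esub> r P b"
  by (auto simp: factor_def)

lemma divides_iff:
  "a \<in> carrier G \<Longrightarrow> b \<in> carrier G \<Longrightarrow> a divides b \<longleftrightarrow> (\<forall>P\<in>X. r P a divides\<^bsub>R P\<^esub> r P b)"
  by (auto intro: global r_divides_global)

lemma R_antisym:
  assumes "P \<in> X" "f \<in> carrier (R P)" "g \<in> carrier (R P)" "f divides\<^bsub>R P\<^esub> g" "g divides\<^bsub>R P\<^esub> f"
  shows "f = g"
  using comm_monoid_cancel.reduced_antisym[OF R_cancel R_reduced] assms by blast

lemma R_one_divides: "P \<in> X \<Longrightarrow> f \<in> carrier (R P) \<Longrightarrow> \<one>\<^bsub>R P\<^esub> divides\<^bsub>R P\<^esub> f"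
proof -
  assume "P \<in> X" "f \<in> carrier (R P)"
  then interpret R: comm_monoid_cancel "R P" by (intro R_cancel)
  show ?thesis using \<open>f \<in> _\<close> by (auto simp: factor_def)
qed

lemma R_divides_one: "P \<in> X \<Longrightarrow> f \<in> carrier (R P) \<Longrightarrow> f divides\<^bsub>R P\<^esub> \<one>\<^bsub>R P\<^esub> \<longleftrightarrow> f = \<one>\<^bsub>R P\<^esub>"
proof -
  assume "P \<in> X" "f \<in> carrier (R P)"
  then interpret R: comm_monoid_cancel "R P" by (intro R_cancel)
  show ?thesis using \<open>f \<in> _\<close> \<open>P \<in> X\<close> R.Unit_eq_dividesone[of f] by (simp add: R_reduced)
qed

text \<open>Finitely many local divisibility relations can be cleared by a common denominator; by
  \<open>v\<close>-finiteness, so can infinitely many.\<close>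

lemma common_denominator:
  assumes "P \<in> X" "a \<in> carrier G" "b \<in> carrier G" "A \<subseteq> carrier G"
    and local: "\<And>y. y \<in> A \<Longrightarrow> r P a divides\<^bsub>R P\<^esub> r P (b \<otimes> y)"
  shows "\<exists>s\<in>carrier G. r P s = \<one>\<^bsub>R P\<^esub> \<and> (\<forall>y\<in>A. a divides (s \<otimes> b) \<otimes> y)"
proof -
  interpret R: comm_monoid_cancel "R P" by (rule R_cancel) fact
  from fin \<open>A \<subseteq> carrier G\<close> obtain E where E: "E \<subseteq> A" "finite E"
    and EA: "\<forall>a\<in>carrier G. \<forall>b\<in>carrier G. (\<forall>y\<in>E. a divides b \<otimes> y) \<longrightarrow> (\<forall>y\<in>A. a divides b \<otimes> y)"
    by (rule v_finE)
  from E(2,1) have "\<exists>s\<in>carrier G. r P s = \<one>\<^bsub>R P\<^esub> \<and> (\<forall>y\<in>E. a divides (s \<otimes> b) \<otimes> y)"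
  proof (induction E)
    case empty
    then show ?case using assms by (auto intro!: bexI[of _ \<one>])
  next
    case (insert y E)
    then obtain s where s: "s \<in> carrier G" "r P s = \<one>\<^bsub>R P\<^esub>" "\<forall>y\<in>E. a divides (s \<otimes> b) \<otimes> y"
      by auto
    have y: "y \<in> carrier G" using insert assms by blast
    obtain t where t: "t \<in> carrier G" "r P t = \<one>\<^bsub>R P\<^esub>" "a divides t \<otimes> (b \<otimes> y)"
      using local[of y] insert.prems assms(1-3) y by (auto simp: r_divides simp del: r_mult)
    have "a divides (s \<otimes> t \<otimes> b) \<otimes> z" if zE: "z \<in> insert y E" for z
    proof -
      have z: "z \<in> carrier G" using zE y insert.prems assms by blast
      consider "z = y" | "z \<in> E" using zE by blast
      then show ?thesis
      proof cases
        case 1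
        have "a divides s \<otimes> (t \<otimes> (b \<otimes> y))" using t s y assms by (intro divides_prod_l[OF _ _ _ t(3)]) auto
        also have "s \<otimes> (t \<otimes> (b \<otimes> y)) = (s \<otimes> t \<otimes> b) \<otimes> z" using 1 t s y assms by (simp add: m_ac)
        finally show ?thesis .
      next
        case 2
        then have "a divides (s \<otimes> b) \<otimes> z" using s by blast
        from divides_prod_l[OF _ _ _ this] have "a divides t \<otimes> ((s \<otimes> b) \<otimes> z)" using t s z assms by auto
        also have "t \<otimes> ((s \<otimes> b) \<otimes> z) = (s \<otimes> t \<otimes> b) \<otimes> z" using t(1) s(1) z assms by (simp add: m_ac)
        finally show ?thesis .
      qed
    qed
    then show ?case
      using s t assms(1) by (intro bexI[of _ "s \<otimes> t"]) auto
  qed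
  then obtain s where "s \<in> carrier G" "r P s = \<one>\<^bsub>R P\<^esub>" "\<forall>y\<in>E. a divides (s \<otimes> b) \<otimes> y" by blast
  then show ?thesis
    using EA[rule_format, of a "s \<otimes> b"] assms by (intro bexI[of _ s]) auto
qed

text \<open>A common denominator \<open>s\<close> turns the local bound into a fraction \<open>sb/a\<close> in \<open>A\<^sup>-\<^sup>1\<close>, which also multiplies the
  \<open>v\<close>-closure of \<open>A\<close> into \<open>H\<close>.\<close>

lemma local_vcl:
  assumes "P \<in> X" "a \<in> carrier G" "b \<in> carrier G" "A \<subseteq> carrier G"
    and local: "\<And>y. y \<in> A \<Longrightarrow> r P a divides\<^bsub>R P\<^esub> r P (b \<otimes> y)"
    and x: "x \<in> vcl A"
  shows "r P a divides\<^bsub>R P\<^esub> r P (b \<otimes> x)"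
proof -
  have xC: "x \<in> carrier G" using x by (simp add: vcl_def)
  obtain s where s: "s \<in> carrier G" "r P s = \<one>\<^bsub>R P\<^esub>" "\<forall>y\<in>A. a divides (s \<otimes> b) \<otimes> y"
    using common_denominator[OF assms(1-5)] by blast
  then have "a divides (s \<otimes> b) \<otimes> x"
    using assms by (intro vclD[OF x]) auto
  also have "(s \<otimes> b) \<otimes> x = s \<otimes> (b \<otimes> x)" using s assms xC by (simp add: m_assoc)
  finally show ?thesis
    using assms(1-3) s xC by (subst r_divides) auto
qed

text \<open>\<open>P\<^sup>-\<^sup>1\<close> contains a fraction \<open>b/a\<close> outside \<open>H\<^sub>P\<close>. Start with \<open>b = 1\<close> and a non-unit \<open>a\<close> of \<open>H\<^sub>P\<close>. For one of the
  finitely many \<open>v\<close>-generators \<open>y\<close> of \<open>P\<close> after the other, multiply \<open>b\<close> by the last power of \<open>y\<close> for which \<open>a\<close>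
  does not divide the product locally; it exists since \<open>H\<^sub>P\<close> is primary.\<close>

lemma inverse_of_prime:
  assumes P: "P \<in> X"
  obtains a b where "a \<in> carrier G" "b \<in> carrier G"
    "\<And>y. y \<in> carrier G \<Longrightarrow> r P y \<noteq> \<one>\<^bsub>R P\<^esub> \<Longrightarrow> a divides b \<otimes> y" "\<not> r P a divides\<^bsub>R P\<^esub> r P b"
proof -
  interpret R: comm_monoid_cancel "R P" by (rule R_cancel) fact
  obtain a where a: "a \<in> carrier G" "r P a \<noteq> \<one>\<^bsub>R P\<^esub>" using nontrivial[OF P] by blast
  define A where "A = {y \<in> carrier G. r P y \<noteq> \<one>\<^bsub>R P\<^esub>}"
  have "A \<subseteq> carrier G" by (auto simp: A_def)
  with fin obtain E where E: "E \<subseteq> A" "finite E"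
    and EA: "\<forall>a\<in>carrier G. \<forall>b\<in>carrier G. (\<forall>y\<in>E. a divides b \<otimes> y) \<longrightarrow> (\<forall>y\<in>A. a divides b \<otimes> y)"
    by (rule v_finE)
  from E(2,1) have "\<exists>b\<in>carrier G. \<not> r P a divides\<^bsub>R P\<^esub> r P b \<and> (\<forall>y\<in>E. r P a divides\<^bsub>R P\<^esub> r P (b \<otimes> y))"
  proof (induction E)
    case empty
    then show ?case using P a by (intro bexI[of _ \<one>]) (auto simp: R_divides_one)
  next
    case (insert y E)
    then obtain b where b: "b \<in> carrier G" "\<not> r P a divides\<^bsub>R P\<^esub> r P b"
        "\<And>y. y \<in> E \<Longrightarrow> r P a divides\<^bsub>R P\<^esub> r P (b \<otimes> y)"
      by auto
    have y: "y \<in> carrier G" "r P y \<noteq> \<one>\<^bsub>R P\<^esub>" using insert.prems by (auto simp: A_def)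
    obtain n where "r P a divides\<^bsub>R P\<^esub> r P (y [^] (n::nat))"
      using primary[OF P y(1) a(1) y(2)] by blast
    then have ex: "\<exists>n. r P a divides\<^bsub>R P\<^esub> r P (b \<otimes> y [^] (n::nat))"
      using P a b y by (intro exI[of _ n]) (auto intro!: R.divides_prod_l)
    define m where "m = (LEAST n. r P a divides\<^bsub>R P\<^esub> r P (b \<otimes> y [^] (n::nat)))"
    have m: "r P a divides\<^bsub>R P\<^esub> r P (b \<otimes> y [^] m)"
      unfolding m_def by (rule LeastI_ex[OF ex])
    with b P have "m \<noteq> 0" by (cases "m = 0") auto
    then obtain k where k: "m = Suc k" by (cases m) auto
    have notk: "\<not> r P a divides\<^bsub>R P\<^esub> r P (b \<otimes> y [^] k)"
      using not_less_Least[of k "\<lambda>n. r P a divides\<^bsub>R P\<^esub> r P (b \<otimes> y [^] n)"] k by (simp add: m_def)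
    have "r P a divides\<^bsub>R P\<^esub> r P ((b \<otimes> y [^] k) \<otimes> z)" if "z \<in> insert y E" for z
    proof (cases "z = y")
      case True
      then show ?thesis using m k b y P by (simp add: R.m_assoc)
    next
      case False
      then have z: "z \<in> E" using that by blast
      then have zC: "z \<in> carrier G" using insert.prems by (auto simp: A_def)
      have "r P a divides\<^bsub>R P\<^esub> r P (y [^] k) \<otimes>\<^bsub>R P\<^esub> r P (b \<otimes> z)"
        using b(3)[OF z] P a b y zC by (intro R.divides_prod_l) auto
      also have "r P (y [^] k) \<otimes>\<^bsub>R P\<^esub> r P (b \<otimes> z) = r P ((b \<otimes> y [^] k) \<otimes> z)"
        using P b y zC by (simp add: R.m_ac)
      finally show ?thesis .
    qed
    then show ?case using notk b y by (intro bexI[of _ "b \<otimes> y [^] k"]) auto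
  qed
  then obtain b where b: "b \<in> carrier G" "\<not> r P a divides\<^bsub>R P\<^esub> r P b"
      "\<forall>y\<in>E. r P a divides\<^bsub>R P\<^esub> r P (b \<otimes> y)" by blast
  have "\<exists>s\<in>carrier G. r P s = \<one>\<^bsub>R P\<^esub> \<and> (\<forall>y\<in>E. a divides (s \<otimes> b) \<otimes> y)"
    using b E P a \<open>A \<subseteq> carrier G\<close> by (intro common_denominator) auto
  then obtain s where s: "s \<in> carrier G" "r P s = \<one>\<^bsub>R P\<^esub>" "\<forall>y\<in>E. a divides (s \<otimes> b) \<otimes> y" by blast
  then have "\<forall>y\<in>A. a divides (s \<otimes> b) \<otimes> y"
    using EA[rule_format, of a "s \<otimes> b"] a b by auto
  moreover have "\<not> r P a divides\<^bsub>R P\<^esub> r P (s \<otimes> b)"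
    using b s P by simp
  ultimately show ?thesis
    using a b s by (intro that[of a "s \<otimes> b"]) (auto simp: A_def)
qed

section \<open>Invertible ideals and families of local generators\<close>

definition families :: "('i \<Rightarrow> 'b) set" where
  "families = {f \<in> (\<Pi>\<^sub>E P\<in>X. carrier (R P)). finite {P \<in> X. f P \<noteq> \<one>\<^bsub>R P\<^esub>}}"

text \<open>The ideal \<open>\<Inter>f\<^sub>PH\<^sub>P\<close> with prescribed local generators.\<close>

definition ideal_of :: "('i \<Rightarrow> 'b) \<Rightarrow> 'a set" where
  "ideal_of f = {x \<in> carrier G. \<forall>P\<in>X. f P divides\<^bsub>R P\<^esub> r P x}"

lemma families_closed [simp]: "f \<in> families \<Longrightarrow> P \<in> X \<Longrightarrow> f P \<in> carrier (R P)"
  by (auto simp: families_def)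

lemma ideal_of_subset: "ideal_of f \<subseteq> carrier G"
  by (auto simp: ideal_of_def)

lemma ideal_of_is_ideal: "f \<in> families \<Longrightarrow> ideal_set (ideal_of f)"
  unfolding ideal_set_def
proof (intro conjI ballI)
  fix x y assume f: "f \<in> families" and x: "x \<in> ideal_of f" and y: "y \<in> carrier G"
  have "f P divides\<^bsub>R P\<^esub> r P (x \<otimes> y)" if P: "P \<in> X" for P
  proof -
    interpret R: comm_monoid_cancel "R P" by (rule R_cancel) fact
    show ?thesis using f x y P by (auto simp: ideal_of_def intro!: R.divides_prod_r)
  qed
  then show "x \<otimes> y \<in> ideal_of f" using x y by (auto simp: ideal_of_def)
qed (rule ideal_of_subset)

text \<open>A local generator \<open>f\<^sub>P\<close> has to be moved into \<open>f\<^sub>QH\<^sub>Q\<close> for the finitely many other primes \<open>Q\<close> of the support without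
  changing it at \<open>P\<close>. This is done by a high power of an element of \<open>Q\<close> outside \<open>P\<close>.\<close>

lemma ideal_of_generator:
  assumes f: "f \<in> families" and P: "P \<in> X"
  shows "\<exists>c\<in>ideal_of f. r P c = f P"
proof -
  interpret R: comm_monoid_cancel "R P" by (rule R_cancel) fact
  have supp: "\<exists>s\<in>carrier G. r P s = \<one>\<^bsub>R P\<^esub> \<and> (\<forall>Q\<in>F. f Q divides\<^bsub>R Q\<^esub> r Q s)"
    if "finite F" "F \<subseteq> X - {P}" for F
    using that
  proof (induction F)
    case empty
    then show ?case using P by (auto intro!: bexI[of _ \<one>])
  next
    case (insert Q F)
    then obtain s where s: "s \<in> carrier G" "r P s = \<one>\<^bsub>R P\<^esub>" "\<forall>Q\<in>F. f Q divides\<^bsub>R Q\<^esub> r Q s" by auto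
    have Q: "Q \<in> X" "P \<noteq> Q" using insert.prems by auto
    obtain e where e: "e \<in> carrier G" "r P e = \<one>\<^bsub>R P\<^esub>" "r Q e \<noteq> \<one>\<^bsub>R Q\<^esub>"
      using separate[OF P Q] by blast
    obtain a where a: "a \<in> carrier G" "f Q = r Q a" using r_surj[OF Q(1) families_closed[OF f Q(1)]] by blast
    obtain n where n: "r Q a divides\<^bsub>R Q\<^esub> r Q (e [^] (n::nat))"
      using primary[OF Q(1) e(1) a(1) e(3)] by blast
    have "f Q' divides\<^bsub>R Q'\<^esub> r Q' (s \<otimes> e [^] n)" if Q': "Q' \<in> insert Q F" for Q'
    proof -
      have "Q' \<in> X" using Q' Q insert.prems by blast
      interpret R': comm_monoid_cancel "R Q'" by (rule R_cancel) fact
      show ?thesis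
      proof (cases "Q' = Q")
        case True
        have "f Q' divides\<^bsub>R Q'\<^esub> r Q' (e [^] n)" using n a True by simp
        from R'.divides_prod_l[OF _ _ _ this, of "r Q' s"] show ?thesis using a(1) e s f \<open>Q' \<in> X\<close> by simp
      next
        case False
        then show ?thesis using Q' e s f \<open>Q' \<in> X\<close> by (auto intro!: R'.divides_prod_r)
      qed
    qed
    then show ?case
      using s e P by (intro bexI[of _ "s \<otimes> e [^] n"]) auto
  qed
  have "finite ({Q \<in> X. f Q \<noteq> \<one>\<^bsub>R Q\<^esub>} - {P})" "{Q \<in> X. f Q \<noteq> \<one>\<^bsub>R Q\<^esub>} - {P} \<subseteq> X - {P}"
    using f by (auto simp: families_def)
  from supp[OF this] obtain s where s: "s \<in> carrier G" "r P s = \<one>\<^bsub>R P\<^esub>"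
      "\<forall>Q\<in>{Q \<in> X. f Q \<noteq> \<one>\<^bsub>R Q\<^esub>} - {P}. f Q divides\<^bsub>R Q\<^esub> r Q s" by blast
  obtain a where a: "a \<in> carrier G" "f P = r P a" using r_surj[OF P families_closed[OF f P]] by blast
  have "f Q divides\<^bsub>R Q\<^esub> r Q (a \<otimes> s)" if Q: "Q \<in> X" for Q
  proof -
    interpret R': comm_monoid_cancel "R Q" by (rule R_cancel) fact
    consider "Q = P" | "f Q = \<one>\<^bsub>R Q\<^esub>" | "Q \<in> {Q \<in> X. f Q \<noteq> \<one>\<^bsub>R Q\<^esub>} - {P}" using Q by blast
    then show ?thesis
    proof cases
      case 1 then show ?thesis using a s P by simp
    next
      case 2 then show ?thesis using a s Q by (simp add: R_one_divides)
    next
      case 3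
      then have "f Q divides\<^bsub>R Q\<^esub> r Q s" using s by blast
      then show ?thesis using a s f Q by (auto intro!: R'.divides_prod_l)
    qed
  qed
  then have "a \<otimes> s \<in> ideal_of f" using a s by (simp add: ideal_of_def)
  then show ?thesis using a s P by (intro bexI[of _ "a \<otimes> s"]) auto
qed

text \<open>Local bounds pass to the \<open>v\<close>-closure; conversely, local generators in \<open>A\<close> show locally, hence globally, that each
  fraction in \<open>A\<^sup>-\<^sup>1\<close> multiplies \<open>ideal_of f\<close> into \<open>H\<close>. This determines \<open>v\<close>-products of ideals, and the
  \<open>v\<close>-product of an ideal and its inverse.\<close>

lemma vcl_eq_ideal_of:
  assumes A: "A \<subseteq> carrier G" and f: "\<And>P. P \<in> X \<Longrightarrow> f P \<in> carrier (R P)"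
    and gen: "\<And>P. P \<in> X \<Longrightarrow> \<exists>c\<in>A. r P c = f P"
    and bound: "\<And>P x. P \<in> X \<Longrightarrow> x \<in> A \<Longrightarrow> f P divides\<^bsub>R P\<^esub> r P x"
  shows "vcl A = ideal_of f"
proof (intro equalityI subsetI)
  fix x assume x: "x \<in> vcl A"
  then have xC: "x \<in> carrier G" by (simp add: vcl_def)
  have "f P divides\<^bsub>R P\<^esub> r P x" if P: "P \<in> X" for P
  proof -
    interpret R: comm_monoid_cancel "R P" by (rule R_cancel) fact
    obtain a where a: "a \<in> carrier G" "f P = r P a" using r_surj[OF P f[OF P]] by auto
    have "r P a divides\<^bsub>R P\<^esub> r P (\<one> \<otimes> x)"
      using P a A x bound[OF P] by (intro local_vcl[of P a \<one> A x]) (auto simp: subset_iff)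
    then show ?thesis using a xC by simp
  qed
  then show "x \<in> ideal_of f" using xC by (simp add: ideal_of_def)
next
  fix x assume x: "x \<in> ideal_of f"
  then have xC: "x \<in> carrier G" by (simp add: ideal_of_def)
  show "x \<in> vcl A"
    unfolding vcl_mem
  proof (intro conjI ballI impI)
    fix a b assume a: "a \<in> carrier G" and b: "b \<in> carrier G" and all: "\<forall>y\<in>A. a divides b \<otimes> y"
    show "a divides b \<otimes> x"
    proof (rule global)
      fix P assume P: "P \<in> X"
      interpret R: comm_monoid_cancel "R P" by (rule R_cancel) fact
      obtain c where c: "c \<in> A" "r P c = f P" using gen[OF P] by blast
      then have cC: "c \<in> carrier G" using A by blast
      have "r P a divides\<^bsub>R P\<^esub> r P (b \<otimes> c)"
        using all c P a by (intro r_divides_global) auto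
      also have "r P (b \<otimes> c) divides\<^bsub>R P\<^esub> r P (b \<otimes> x)"
        using P b cC xC c x f[OF P] by (simp add: ideal_of_def)
      finally show "r P a divides\<^bsub>R P\<^esub> r P (b \<otimes> x)" using a P by simp
    qed (use a b xC in auto)
  qed fact
qed

lemma vcl_ideal_of:
  assumes f: "f \<in> families"
  shows "vcl (ideal_of f) = ideal_of f"
  using ideal_of_subset ideal_of_generator[OF f] f
  by (intro vcl_eq_ideal_of) (auto simp: ideal_of_def)

lemma ideal_of_inj:
  assumes f: "f \<in> families" and g: "g \<in> families" and eq: "ideal_of f = ideal_of g"
  shows "f = g"
proof (rule PiE_ext)
  show "f \<in> (\<Pi>\<^sub>E P\<in>X. carrier (R P))" "g \<in> (\<Pi>\<^sub>E P\<in>X. carrier (R P))"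
    using f g by (auto simp: families_def)
  fix P assume P: "P \<in> X"
  obtain c where c: "c \<in> ideal_of f" "r P c = f P" using ideal_of_generator[OF f P] by blast
  obtain d where d: "d \<in> ideal_of g" "r P d = g P" using ideal_of_generator[OF g P] by blast
  from c d have "c \<in> ideal_of g" "d \<in> ideal_of f" using eq by simp_all
  then have "f P divides\<^bsub>R P\<^esub> g P" "g P divides\<^bsub>R P\<^esub> f P"
    using P c(2) d(2) by (auto simp: ideal_of_def)
  then show "f P = g P" using R_antisym[OF P] f g P by simp
qed

lemma vcl_mult_ideal_of:
  assumes f: "f \<in> families" and g: "g \<in> families"
  shows "vcl {x \<otimes> y | x y. x \<in> ideal_of f \<and> y \<in> ideal_of g} = ideal_of (\<lambda>P\<in>X. f P \<otimes>\<^bsub>R P\<^esub> g P)"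
proof (rule vcl_eq_ideal_of)
  show "{x \<otimes> y | x y. x \<in> ideal_of f \<and> y \<in> ideal_of g} \<subseteq> carrier G"
    using ideal_of_subset by auto
  fix P assume P: "P \<in> X"
  interpret R: comm_monoid_cancel "R P" by (rule R_cancel) fact
  show "(\<lambda>P\<in>X. f P \<otimes>\<^bsub>R P\<^esub> g P) P \<in> carrier (R P)" using P f g by simp
  obtain c where c: "c \<in> ideal_of f" "r P c = f P" using ideal_of_generator[OF f P] by blast
  obtain d where d: "d \<in> ideal_of g" "r P d = g P" using ideal_of_generator[OF g P] by blast
  have "r P (c \<otimes> d) = f P \<otimes>\<^bsub>R P\<^esub> g P" using c d P ideal_of_subset by (subst r_mult) auto
  then show "\<exists>c\<in>{x \<otimes> y | x y. x \<in> ideal_of f \<and> y \<in> ideal_of g}. r P c = (\<lambda>P\<in>X. f P \<otimes>\<^bsub>R P\<^esub> g P) P"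
    using c d P by auto
  fix z assume "z \<in> {x \<otimes> y | x y. x \<in> ideal_of f \<and> y \<in> ideal_of g}"
  then obtain x y where xy: "x \<in> ideal_of f" "y \<in> ideal_of g" "z = x \<otimes> y" by blast
  then have "f P divides\<^bsub>R P\<^esub> r P x" "g P divides\<^bsub>R P\<^esub> r P y"
    using P by (auto simp: ideal_of_def)
  then obtain u v where "u \<in> carrier (R P)" "v \<in> carrier (R P)"
      and eqs: "r P x = f P \<otimes>\<^bsub>R P\<^esub> u" "r P y = g P \<otimes>\<^bsub>R P\<^esub> v"
    unfolding factor_def by blast
  then have "r P x \<otimes>\<^bsub>R P\<^esub> r P y = (f P \<otimes>\<^bsub>R P\<^esub> g P) \<otimes>\<^bsub>R P\<^esub> (u \<otimes>\<^bsub>R P\<^esub> v)"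
    using f g P by (simp add: R.m_ac)
  moreover have "r P z = r P x \<otimes>\<^bsub>R P\<^esub> r P y"
    unfolding xy(3) using xy(1,2) P by (auto simp: ideal_of_def)
  ultimately show "(\<lambda>P\<in>X. f P \<otimes>\<^bsub>R P\<^esub> g P) P divides\<^bsub>R P\<^esub> r P z"
    using P \<open>u \<in> _\<close> \<open>v \<in> _\<close> by auto
qed

end

context comm_monoid_cancel
begin

interpretation Q: comm_group "quot_grp G"
  by (rule quot_grp_comm_group)

text \<open>The set \<open>A A\<^sup>-\<^sup>1\<close>, as a subset of the monoid.\<close>

definition inv_product :: "'a set \<Rightarrow> 'a set" where
  "inv_product A = {w \<in> carrier G. \<exists>y\<in>A. \<exists>a\<in>carrier G. \<exists>b\<in>carrier G.
     (\<forall>y'\<in>A. a divides b \<otimes> y') \<and> b \<otimes> y = a \<otimes> w}"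

lemma emb_inv_product:
  assumes A: "A \<subseteq> carrier G"
  shows "emb G ` A <#>\<^bsub>quot_grp G\<^esub> ideal_inv G (emb G ` A) = emb G ` inv_product A"
proof (intro equalityI subsetI)
  fix z assume "z \<in> emb G ` A <#>\<^bsub>quot_grp G\<^esub> ideal_inv G (emb G ` A)"
  then obtain y x where y: "y \<in> A" and x: "x \<in> ideal_inv G (emb G ` A)" and z: "z = emb G y \<otimes>\<^bsub>quot_grp G\<^esub> x"
    by (auto simp: set_mult_def)
  have yC: "y \<in> carrier G" using y A by blast
  have "x \<in> carrier (quot_grp G)" using x by (simp add: ideal_inv_def colon_def)
  then obtain b a where ab: "b \<in> carrier G" "a \<in> carrier G" "x = mk_frac G b a"
    by (rule quot_grp_cases)
  have dv: "\<forall>y\<in>A. a divides b \<otimes> y" using x A ab by (simp add: mk_frac_in_ideal_inv)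
  then obtain w where w: "w \<in> carrier G" "b \<otimes> y = a \<otimes> w" using y by (auto simp: factor_def)
  then have "z = emb G w"
    using z ab yC by (simp add: emb_def mk_frac_eq_iff m_comm)
  moreover have "w \<in> inv_product A" using w y ab dv by (auto simp: inv_product_def)
  ultimately show "z \<in> emb G ` inv_product A" by blast
next
  fix z assume "z \<in> emb G ` inv_product A"
  then obtain w y a b where w: "w \<in> carrier G" "z = emb G w" "y \<in> A" "a \<in> carrier G" "b \<in> carrier G"
      "\<forall>y'\<in>A. a divides b \<otimes> y'" "b \<otimes> y = a \<otimes> w"
    by (auto simp: inv_product_def)
  then have "y \<in> carrier G" using A by blast
  then have "z = emb G y \<otimes>\<^bsub>quot_grp G\<^esub> mk_frac G b a"
    using w by (simp add: emb_def mk_frac_eq_iff m_comm)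
  moreover have "mk_frac G b a \<in> ideal_inv G (emb G ` A)"
    using w A by (simp add: mk_frac_in_ideal_inv)
  ultimately show "z \<in> emb G ` A <#>\<^bsub>quot_grp G\<^esub> ideal_inv G (emb G ` A)"
    using w by (auto simp: set_mult_def)
qed

lemma v_mult_emb:
  assumes "A \<subseteq> carrier G" "B \<subseteq> carrier G"
  shows "v_mult G (emb G ` A) (emb G ` B) = emb G ` vcl {x \<otimes> y | x y. x \<in> A \<and> y \<in> B}"
  using assms by (auto simp: v_mult_def emb_set_mult intro!: v_closure_emb)

lemma v_invertible_emb:
  assumes A: "A \<subseteq> carrier G"
  shows "emb G ` A \<in> carrier (v_invertible_ideals G) \<longleftrightarrow> vcl A = A \<and> vcl (inv_product A) = carrier G"
proof -
  have "v_mult G (emb G ` A) (ideal_inv G (emb G ` A)) = emb G ` vcl (inv_product A)"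
    unfolding v_mult_def emb_inv_product[OF A] by (rule v_closure_emb) (auto simp: inv_product_def)
  moreover have "emb G ` vcl (inv_product A) = base G \<longleftrightarrow> vcl (inv_product A) = carrier G"
    unfolding base_def using vcl_subset by (intro emb_image_eq_iff) auto
  ultimately show ?thesis
    using A by (simp add: v_invertible_ideals_def v_ideal_emb)
qed

end

context primary_family
begin

text \<open>If \<open>AA\<^sup>-\<^sup>1\<close> were contained in \<open>P\<close>, then \<open>P\<^sup>-\<^sup>1\<close> would be contained in \<open>(AA\<^sup>-\<^sup>1)\<^sup>-\<^sup>1 = H\<close>. So there are \<open>y\<close> in \<open>A\<close> and
  \<open>b/a\<close> in \<open>A\<^sup>-\<^sup>1\<close> whose product is a local unit, and this \<open>y\<close> generates \<open>A\<close> locally.\<close>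

lemma inv_product_local:
  assumes A: "A \<subseteq> carrier G" and inv: "vcl (inv_product A) = carrier G" and P: "P \<in> X"
  shows "\<exists>c\<in>A. \<forall>x\<in>A. r P c divides\<^bsub>R P\<^esub> r P x"
proof -
  interpret R: comm_monoid_cancel "R P" by (rule R_cancel) fact
  obtain a b where ab: "a \<in> carrier G" "b \<in> carrier G"
    "\<And>y. y \<in> carrier G \<Longrightarrow> r P y \<noteq> \<one>\<^bsub>R P\<^esub> \<Longrightarrow> a divides b \<otimes> y" "\<not> r P a divides\<^bsub>R P\<^esub> r P b"
    using inverse_of_prime[OF P] by blast
  have "\<exists>w\<in>inv_product A. r P w = \<one>\<^bsub>R P\<^esub>"
  proof (rule ccontr)
    assume "\<not> ?thesis"
    moreover have "inv_product A \<subseteq> carrier G" by (auto simp: inv_product_def)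
    ultimately have "\<And>w. w \<in> inv_product A \<Longrightarrow> a divides b \<otimes> w"
      using ab(3) by blast
    moreover have one: "\<one> \<in> vcl (inv_product A)" using inv by simp
    ultimately have "a divides b \<otimes> \<one>" using ab(1,2) by (intro vclD[OF one])
    then show False using ab P r_divides_global[of P a b] by simp
  qed
  then obtain w where wA: "w \<in> inv_product A" "r P w = \<one>\<^bsub>R P\<^esub>" by blast
  then obtain y a b where w: "w \<in> carrier G" "r P w = \<one>\<^bsub>R P\<^esub>" "y \<in> A" "a \<in> carrier G" "b \<in> carrier G"
      and dv: "\<forall>y'\<in>A. a divides b \<otimes> y'" and eq: "b \<otimes> y = a \<otimes> w"
    unfolding inv_product_def by blast
  have yC: "y \<in> carrier G" using w A by blast
  have eq': "r P a = r P b \<otimes>\<^bsub>R P\<^esub> r P y"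
    using arg_cong[OF eq, of "r P"] w yC P by simp
  have "r P y divides\<^bsub>R P\<^esub> r P x" if "x \<in> A" for x
  proof -
    have "x \<in> carrier G" using that A by blast
    have "r P a divides\<^bsub>R P\<^esub> r P (b \<otimes> x)" using dv that P w by (intro r_divides_global) auto
    then show ?thesis using eq' \<open>x \<in> carrier G\<close> w yC P by simp
  qed
  then show ?thesis using w by blast
qed

lemma invertible_imp_family:
  assumes A: "A \<subseteq> carrier G" and closed: "vcl A = A" and inv: "vcl (inv_product A) = carrier G"
  shows "\<exists>f\<in>families. A = ideal_of f"
proof -
  from inv_product_local[OF A inv]
  have "\<forall>P\<in>X. \<exists>c. c \<in> A \<and> (\<forall>x\<in>A. r P c divides\<^bsub>R P\<^esub> r P x)" by blast
  from bchoice[OF this] obtain c where c: "\<And>P. P \<in> X \<Longrightarrow> c P \<in> A"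
      "\<And>P x. P \<in> X \<Longrightarrow> x \<in> A \<Longrightarrow> r P (c P) divides\<^bsub>R P\<^esub> r P x" by blast
  define f where "f = (\<lambda>P\<in>X. r P (c P))"
  have cC: "c P \<in> carrier G" if "P \<in> X" for P using c that A by blast
  obtain P0 where "P0 \<in> X" using X_nonempty by blast
  then obtain y where y: "y \<in> A" "y \<in> carrier G" using c cC by blast
  have "{P \<in> X. f P \<noteq> \<one>\<^bsub>R P\<^esub>} \<subseteq> {P \<in> X. r P y \<noteq> \<one>\<^bsub>R P\<^esub>}"
  proof safe
    fix P assume P: "P \<in> X" "f P \<noteq> \<one>\<^bsub>R P\<^esub>" "r P y = \<one>\<^bsub>R P\<^esub>"
    have "r P (c P) divides\<^bsub>R P\<^esub> \<one>\<^bsub>R P\<^esub>" using c(2)[OF P(1) y(1)] P by simp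
    then show False using P cC by (simp add: R_divides_one f_def)
  qed
  then have "finite {P \<in> X. f P \<noteq> \<one>\<^bsub>R P\<^esub>}" using finite_support[OF y(2)] by (rule finite_subset)
  then have "f \<in> families" using cC by (auto simp: families_def f_def)
  moreover have "vcl A = ideal_of f"
    using A c cC by (intro vcl_eq_ideal_of) (auto simp: f_def)
  ultimately show ?thesis using closed by auto
qed

text \<open>If \<open>c\<close> is a local generator at \<open>P\<close> and \<open>s\<close> a common denominator for the quotients by \<open>c\<close>, then \<open>s/c\<close> lies in the inverse
  ideal, and \<open>s\<close> is an element of the product outside \<open>P\<close>.\<close>

lemma family_invertible:
  assumes f: "f \<in> families"
  shows "vcl (inv_product (ideal_of f)) = carrier G"
proof -
  have "vcl (inv_product (ideal_of f)) = ideal_of (\<lambda>P. \<one>\<^bsub>R P\<^esub>)"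
  proof (rule vcl_eq_ideal_of)
    show sub: "inv_product (ideal_of f) \<subseteq> carrier G" by (auto simp: inv_product_def)
    fix P assume P: "P \<in> X"
    interpret R: comm_monoid_cancel "R P" by (rule R_cancel) fact
    show "\<one>\<^bsub>R P\<^esub> \<in> carrier (R P)" by simp
    show "\<one>\<^bsub>R P\<^esub> divides\<^bsub>R P\<^esub> r P x" if "x \<in> inv_product (ideal_of f)" for x
      using that sub P by (intro R_one_divides) auto
    obtain c where c: "c \<in> ideal_of f" "r P c = f P" using ideal_of_generator[OF f P] by blast
    then have cC: "c \<in> carrier G" using ideal_of_subset by blast
    have "\<exists>s\<in>carrier G. r P s = \<one>\<^bsub>R P\<^esub> \<and> (\<forall>y\<in>ideal_of f. c divides (s \<otimes> \<one>) \<otimes> y)"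
    proof (rule common_denominator)
      fix y assume "y \<in> ideal_of f"
      then show "r P c divides\<^bsub>R P\<^esub> r P (\<one> \<otimes> y)"
        using P c by (simp add: ideal_of_def)
    qed (use P cC ideal_of_subset in auto)
    then obtain s where "s \<in> carrier G" "r P s = \<one>\<^bsub>R P\<^esub>" "\<forall>y\<in>ideal_of f. c divides s \<otimes> y" by auto
    moreover then have "s \<in> inv_product (ideal_of f)"
      unfolding inv_product_def using c cC m_comm[of s c] by blast
    ultimately show "\<exists>c\<in>inv_product (ideal_of f). r P c = \<one>\<^bsub>R P\<^esub>" by blast
  qed
  also have "\<dots> = carrier G"
    by (auto simp: ideal_of_def R_one_divides)
  finally show ?thesis .
qed

lemma v_invertible_carrier:
  "carrier (v_invertible_ideals G) = (\<lambda>f. emb G ` ideal_of f) ` families"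
proof (intro equalityI subsetI)
  fix A assume A: "A \<in> carrier (v_invertible_ideals G)"
  then have "A = emb G ` pull A"
    by (simp add: v_invertible_ideals_def v_ideal_def emb_pull)
  then have "vcl (pull A) = pull A" "vcl (inv_product (pull A)) = carrier G"
    using A v_invertible_emb[OF pull_subset, of A] by simp_all
  then obtain f where "f \<in> families" "pull A = ideal_of f"
    using invertible_imp_family[OF pull_subset] by blast
  then show "A \<in> (\<lambda>f. emb G ` ideal_of f) ` families" using \<open>A = emb G ` pull A\<close> by auto
next
  fix A assume "A \<in> (\<lambda>f. emb G ` ideal_of f) ` families"
  then show "A \<in> carrier (v_invertible_ideals G)"
    using v_invertible_emb[OF ideal_of_subset] vcl_ideal_of family_invertible by auto
qed

lemma v_mult_ideal_of:
  assumes "f \<in> families" "g \<in> families"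
  shows "v_mult G (emb G ` ideal_of f) (emb G ` ideal_of g) = emb G ` ideal_of (\<lambda>P\<in>X. f P \<otimes>\<^bsub>R P\<^esub> g P)"
  using assms by (simp add: v_mult_emb ideal_of_subset vcl_mult_ideal_of)

lemma principal_family: "a \<in> carrier G \<Longrightarrow> (\<lambda>P\<in>X. r P a) \<in> families"
proof -
  assume a: "a \<in> carrier G"
  have "{P \<in> X. (\<lambda>P\<in>X. r P a) P \<noteq> \<one>\<^bsub>R P\<^esub>} = {P \<in> X. r P a \<noteq> \<one>\<^bsub>R P\<^esub>}" by auto
  then show ?thesis using finite_support[OF a] a by (auto simp: families_def)
qed

lemma principal_ideal_of: "a \<in> carrier G \<Longrightarrow> principal_ideal G a = emb G ` ideal_of (\<lambda>P\<in>X. r P a)"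
  by (auto simp: principal_ideal_eq ideal_of_def divides_iff intro!: arg_cong[where f = "image (emb G)"])

section \<open>Discrete localizations\<close>

text \<open>If some element outside \<open>P\<close> multiplies every almost integral element into \<open>H\<close>, then a fraction
  \<open>b/a\<close> in \<open>P\<^sup>-\<^sup>1\<close> that is not locally integral cannot map \<open>P\<close> into itself, as it would then be almost
  integral. So \<open>b/a\<close> maps some \<open>p\<close> in \<open>P\<close> to a local unit, and this \<open>p\<close> generates \<open>P\<close> locally.\<close>

lemma discrete_localization:
  assumes P: "P \<in> X" and d: "d \<in> carrier G" "r P d = \<one>\<^bsub>R P\<^esub>"
    and almost: "\<And>a b c. a \<in> carrier G \<Longrightarrow> b \<in> carrier G \<Longrightarrow> c \<in> carrier G \<Longrightarrow>
       (\<And>n::nat. a [^] n divides c \<otimes> b [^] n) \<Longrightarrow> a divides d \<otimes> b"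
  shows "\<exists>p\<in>carrier (R P). p \<noteq> \<one>\<^bsub>R P\<^esub> \<and> (\<forall>x\<in>carrier (R P). \<exists>n::nat. x = p [^]\<^bsub>R P\<^esub> n)"
proof -
  interpret R: comm_monoid_cancel "R P" by (rule R_cancel) fact
  obtain a b where ab: "a \<in> carrier G" "b \<in> carrier G"
    "\<And>y. y \<in> carrier G \<Longrightarrow> r P y \<noteq> \<one>\<^bsub>R P\<^esub> \<Longrightarrow> a divides b \<otimes> y" "\<not> r P a divides\<^bsub>R P\<^esub> r P b"
    using inverse_of_prime[OF P] by blast
  have "\<exists>p\<in>carrier G. \<exists>u\<in>carrier G. r P p \<noteq> \<one>\<^bsub>R P\<^esub> \<and> r P u = \<one>\<^bsub>R P\<^esub> \<and> b \<otimes> p = a \<otimes> u"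
  proof (rule ccontr)
    assume no: "\<not> ?thesis"
    obtain c where c: "c \<in> carrier G" "r P c \<noteq> \<one>\<^bsub>R P\<^esub>" using nontrivial[OF P] by blast
    have "\<exists>w\<in>carrier G. r P w \<noteq> \<one>\<^bsub>R P\<^esub> \<and> c \<otimes> b [^] n = a [^] n \<otimes> w" for n :: nat
    proof (induction n)
      case 0
      then show ?case using c by auto
    next
      case (Suc n)
      then obtain w where w: "w \<in> carrier G" "r P w \<noteq> \<one>\<^bsub>R P\<^esub>" "c \<otimes> b [^] n = a [^] n \<otimes> w" by blast
      then obtain w' where w': "w' \<in> carrier G" "b \<otimes> w = a \<otimes> w'" using ab(3) by (auto simp: factor_def)
      then have "r P w' \<noteq> \<one>\<^bsub>R P\<^esub>" using no w by blast
      have "c \<otimes> b [^] Suc n = (c \<otimes> b [^] n) \<otimes> b" using c ab by (simp add: m_assoc)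
      also have "\<dots> = a [^] n \<otimes> (b \<otimes> w)" unfolding w(3) using w(1) ab(1,2) by (simp add: m_ac)
      also have "\<dots> = a [^] Suc n \<otimes> w'" unfolding w'(2) using w'(1) ab(1) by (simp add: m_assoc)
      finally show ?case using w' \<open>r P w' \<noteq> _\<close> by blast
    qed
    then have "a [^] n divides c \<otimes> b [^] n" for n :: nat by (auto simp: factor_def)
    then have "a divides d \<otimes> b" using almost ab c by blast
    then have "r P a divides\<^bsub>R P\<^esub> r P (d \<otimes> b)" using P ab by (intro r_divides_global) auto
    then show False using ab d P by simp
  qed
  then obtain p u where p: "p \<in> carrier G" "r P p \<noteq> \<one>\<^bsub>R P\<^esub>" and u: "u \<in> carrier G" "r P u = \<one>\<^bsub>R P\<^esub>"
      and bp: "b \<otimes> p = a \<otimes> u" by blast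
  have gen: "r P p divides\<^bsub>R P\<^esub> r P y" if y: "y \<in> carrier G" "r P y \<noteq> \<one>\<^bsub>R P\<^esub>" for y
  proof -
    obtain y' where y': "y' \<in> carrier G" "b \<otimes> y = a \<otimes> y'" using ab(3)[OF y] by (auto simp: factor_def)
    have "a \<otimes> (u \<otimes> y) = (b \<otimes> p) \<otimes> y" unfolding bp using ab(1) u y(1) by (simp add: m_assoc)
    also have "\<dots> = (b \<otimes> y) \<otimes> p" using ab(2) p(1) y(1) by (simp add: m_ac)
    also have "\<dots> = a \<otimes> (p \<otimes> y')" unfolding y'(2) using ab(1) p(1) y'(1) by (simp add: m_ac)
    finally have "u \<otimes> y = p \<otimes> y'" using ab(1) u(1) y(1) p(1) y'(1) by (auto dest: l_cancel)
    then have "r P (u \<otimes> y) = r P (p \<otimes> y')" by simp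
    then have "r P y = r P p \<otimes>\<^bsub>R P\<^esub> r P y'" using P u y p y' by simp
    then show ?thesis using P y' by auto
  qed
  have "\<exists>n::nat. r P x = r P p [^]\<^bsub>R P\<^esub> n" if x: "x \<in> carrier G" for x
  proof -
    have ex: "\<exists>n::nat. r P x divides\<^bsub>R P\<^esub> r P p [^]\<^bsub>R P\<^esub> n"
      using primary[OF P p(1) x p(2)] P p by simp
    define m where "m = (LEAST n::nat. r P x divides\<^bsub>R P\<^esub> r P p [^]\<^bsub>R P\<^esub> n)"
    have "r P x divides\<^bsub>R P\<^esub> r P p [^]\<^bsub>R P\<^esub> m"
      unfolding m_def by (rule LeastI_ex[OF ex])
    then obtain g where g: "g \<in> carrier (R P)" "r P p [^]\<^bsub>R P\<^esub> m = r P x \<otimes>\<^bsub>R P\<^esub> g" by (auto simp: factor_def)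
    obtain y where y: "y \<in> carrier G" "g = r P y" using r_surj[OF P g(1)] by blast
    show ?thesis
    proof (cases "g = \<one>\<^bsub>R P\<^esub>")
      case True
      then show ?thesis using g P x by (intro exI[of _ m]) simp
    next
      case False
      then have "r P p divides\<^bsub>R P\<^esub> g" using gen y by simp
      then obtain h where h: "h \<in> carrier (R P)" "g = r P p \<otimes>\<^bsub>R P\<^esub> h" by (auto simp: factor_def)
      show ?thesis
      proof (cases m)
        case 0
        then have "r P x divides\<^bsub>R P\<^esub> \<one>\<^bsub>R P\<^esub>" using g by (auto simp: factor_def)
        then have "r P x = \<one>\<^bsub>R P\<^esub>" using P x by (simp add: R_divides_one)
        then show ?thesis by (intro exI[of _ 0]) simp
      next
        case (Suc k)
        have "r P p \<otimes>\<^bsub>R P\<^esub> (r P p [^]\<^bsub>R P\<^esub> k) = r P p [^]\<^bsub>R P\<^esub> m"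
          using P p Suc by (simp add: R.m_comm)
        also have "\<dots> = r P p \<otimes>\<^bsub>R P\<^esub> (r P x \<otimes>\<^bsub>R P\<^esub> h)"
          unfolding g(2) h(2) using h(1) P p(1) x by (simp add: R.m_ac)
        finally have "r P p [^]\<^bsub>R P\<^esub> k = r P x \<otimes>\<^bsub>R P\<^esub> h"
          using P p(1) x h(1) R.l_cancel[of "r P p" "r P p [^]\<^bsub>R P\<^esub> k" "r P x \<otimes>\<^bsub>R P\<^esub> h"] by simp
        then have "r P x divides\<^bsub>R P\<^esub> r P p [^]\<^bsub>R P\<^esub> k" using h(1) by (auto simp: factor_def)
        then have "m \<le> k" unfolding m_def by (rule Least_le)
        then show ?thesis using Suc by simp
      qed
    qed
  qed
  then show ?thesis
    using p P r_surj[OF P] by (intro bexI[of _ "r P p"]) auto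
qed

lemma local_v_fin:
  assumes P: "P \<in> X"
  shows "comm_monoid_cancel.v_fin (R P)"
proof -
  interpret R: comm_monoid_cancel "R P" by (rule R_cancel) fact
  show ?thesis
    unfolding R.v_fin_def
  proof (intro allI impI)
    fix B assume B: "B \<subseteq> carrier (R P)"
    define A where "A = {x \<in> carrier G. r P x \<in> B}"
    have "A \<subseteq> carrier G" by (auto simp: A_def)
    with fin obtain E where E: "E \<subseteq> A" "finite E"
      and EA: "\<forall>a\<in>carrier G. \<forall>b\<in>carrier G. (\<forall>y\<in>E. a divides b \<otimes> y) \<longrightarrow> (\<forall>y\<in>A. a divides b \<otimes> y)"
      by (rule v_finE)
    have "f divides\<^bsub>R P\<^esub> g \<otimes>\<^bsub>R P\<^esub> z"
      if fg: "f \<in> carrier (R P)" "g \<in> carrier (R P)" "\<forall>y\<in>r P ` E. f divides\<^bsub>R P\<^esub> g \<otimes>\<^bsub>R P\<^esub> y" "z \<in> B" for f g z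
    proof -
      obtain a b where ab: "a \<in> carrier G" "f = r P a" "b \<in> carrier G" "g = r P b"
        using r_surj[OF P] fg by metis
      obtain x where x: "x \<in> carrier G" "z = r P x" using r_surj[OF P] fg(4) B by blast
      have "\<exists>s\<in>carrier G. r P s = \<one>\<^bsub>R P\<^esub> \<and> (\<forall>y\<in>E. a divides (s \<otimes> b) \<otimes> y)"
      proof (rule common_denominator)
        fix y assume y: "y \<in> E"
        then have "y \<in> carrier G" using E by (auto simp: A_def)
        then show "r P a divides\<^bsub>R P\<^esub> r P (b \<otimes> y)" using fg(3) y ab P by simp
      qed (use E ab P in \<open>auto simp: A_def\<close>)
      then obtain s where s: "s \<in> carrier G" "r P s = \<one>\<^bsub>R P\<^esub>" "\<forall>y\<in>E. a divides (s \<otimes> b) \<otimes> y" by blast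
      have "x \<in> A" using x fg by (simp add: A_def)
      then have "a divides (s \<otimes> b) \<otimes> x" using s ab EA[rule_format, of a "s \<otimes> b" x] by simp
      then have "r P a divides\<^bsub>R P\<^esub> r P ((s \<otimes> b) \<otimes> x)" using P ab by (intro r_divides_global) auto
      then show ?thesis using P ab s x by simp
    qed
    then show "\<exists>E\<subseteq>B. finite E \<and> (\<forall>a\<in>carrier (R P). \<forall>b\<in>carrier (R P).
        (\<forall>y\<in>E. a divides\<^bsub>R P\<^esub> b \<otimes>\<^bsub>R P\<^esub> y) \<longrightarrow> (\<forall>y\<in>B. a divides\<^bsub>R P\<^esub> b \<otimes>\<^bsub>R P\<^esub> y))"
      using E by (intro exI[of _ "r P ` E"]) (auto simp: A_def)
  qed
qed

end

section \<open>Atomicity\<close>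

text \<open>A factorization up to a unit becomes an exact one when the unit is absorbed in one of the atoms.\<close>

lemma atomicI_wf:
  assumes "comm_monoid_cancel H"
    and "wf {(x, y). x \<in> carrier H \<and> y \<in> carrier H \<and> properfactor H x y}"
  shows "atomic H"
proof -
  interpret divisor_chain_condition_monoid H
    using assms by (simp add: divisor_chain_condition_monoid_def divisor_chain_condition_monoid_axioms_def)
  have "\<exists>fs. set fs \<subseteq> carrier H \<and> factors H fs a" if a: "a \<in> carrier H - Units H" for a
  proof -
    obtain fs where fs: "set fs \<subseteq> carrier H" "wfactors H fs a" using wfactors_exist[of a] a by auto
    have fsC: "foldr (\<otimes>\<^bsub>H\<^esub>) fs \<one>\<^bsub>H\<^esub> \<in> carrier H" using fs(1) by simp
    have "a \<sim>\<^bsub>H\<^esub> foldr (\<otimes>\<^bsub>H\<^esub>) fs \<one>\<^bsub>H\<^esub>" using fs a by (auto simp: wfactors_def intro: associated_sym)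
    then obtain u where u: "u \<in> Units H" "a = foldr (\<otimes>\<^bsub>H\<^esub>) fs \<one>\<^bsub>H\<^esub> \<otimes>\<^bsub>H\<^esub> u"
      using a fsC associatedD2 by blast
    obtain x xs where xs: "fs = x # xs" using u a by (cases fs) auto
    have c: "x \<in> carrier H" "set xs \<subseteq> carrier H" "u \<in> carrier H" using xs fs u by auto
    have "factors H ((x \<otimes>\<^bsub>H\<^esub> u) # xs) a"
      unfolding factors_def
    proof
      show "\<forall>y\<in>set ((x \<otimes>\<^bsub>H\<^esub> u) # xs). irreducible H y"
        using fs(2) xs c u by (auto simp: wfactors_def intro: irreducible_prod_rI)
      show "foldr (\<otimes>\<^bsub>H\<^esub>) ((x \<otimes>\<^bsub>H\<^esub> u) # xs) \<one>\<^bsub>H\<^esub> = a"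
        using u(2) xs c by (simp add: m_ac)
    qed
    then show ?thesis using c by (intro exI[of _ "(x \<otimes>\<^bsub>H\<^esub> u) # xs"]) auto
  qed
  then show ?thesis using assms by (simp add: atomic_def)
qed

lemma (in comm_monoid_cancel) v_fin_wf:
  assumes v_fin
  shows "wf {(x, y). x \<in> carrier G \<and> y \<in> carrier G \<and> properfactor G x y}"
  unfolding wf_iff_no_infinite_down_chain
proof
  assume "\<exists>x. \<forall>i::nat. (x (Suc i), x i) \<in> {(x, y). x \<in> carrier G \<and> y \<in> carrier G \<and> properfactor G x y}"
  then obtain x :: "nat \<Rightarrow> 'a" where x: "\<And>i. x i \<in> carrier G" "\<And>i. properfactor G (x (Suc i)) (x i)" by blast
  have chain: "x n divides x m" if "m \<le> n" for m n
    using that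
  proof (induction n rule: dec_induct)
    case base
    then show ?case using x by simp
  next
    case (step n)
    have "x (Suc n) divides x n" using x(2) by (simp add: properfactor_def)
    also note step.IH
    finally show ?case using x by simp
  qed
  have "range x \<subseteq> carrier G" using x by blast
  with assms obtain E where E: "E \<subseteq> range x" "finite E"
    and EA: "\<forall>a\<in>carrier G. \<forall>b\<in>carrier G. (\<forall>y\<in>E. a divides b \<otimes> y) \<longrightarrow> (\<forall>y\<in>range x. a divides b \<otimes> y)"
    by (rule v_finE)
  from E obtain I where I: "finite I" "E = x ` I" by (meson finite_subset_image)
  define N where "N = Max (insert 0 I)"
  have "x N divides \<one> \<otimes> y" if "y \<in> E" for y
  proof -
    from that obtain i where "i \<in> I" "y = x i" using I by blast
    then have "i \<le> N" unfolding N_def using I by (intro Max_ge) auto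
    then show ?thesis using chain x \<open>y = x i\<close> by simp
  qed
  then have "x N divides \<one> \<otimes> x (Suc N)" using EA x by blast
  then have "x N divides x (Suc N)" using x by simp
  then show False using x(2)[of N] by (simp add: properfactor_def)
qed

lemma v_noetherian_imp_atomic:
  assumes "v_noetherian H"
  shows "atomic H"
proof -
  interpret comm_monoid_cancel H using assms by (simp add: v_noetherian_def)
  show ?thesis
    using v_fin_wf[OF v_noetherian_imp_v_fin[OF assms]] by (intro atomicI_wf is_comm_monoid_cancel)
qed

lemma atomic_divisor_closed:
  assumes H: "v_noetherian H" and S: "divisor_closed S H"
  shows "comm_monoid_cancel (H\<lparr>carrier := S\<rparr>)" "atomic (H\<lparr>carrier := S\<rparr>)"
    "Units (H\<lparr>carrier := S\<rparr>) = Units H"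
proof -
  interpret comm_monoid_cancel H using H by (simp add: v_noetherian_def)
  interpret S: submonoid S H using S by (simp add: divisor_closed_def)
  have sub: "S \<subseteq> carrier H" by (rule S.subset)
  have closed: "b \<in> S" if "a \<in> S" "b \<in> carrier H" "b divides\<^bsub>H\<^esub> a" for a b
    using S that unfolding divisor_closed_def by blast
  show cm: "comm_monoid_cancel (H\<lparr>carrier := S\<rparr>)"
  proof (rule comm_monoid_cancelI)
    show "comm_monoid (H\<lparr>carrier := S\<rparr>)"
      by (rule comm_monoidI) (simp_all add: subsetD[OF sub] m_ac)
  next
    fix a b c assume "a \<otimes>\<^bsub>H\<lparr>carrier := S\<rparr>\<^esub> c = b \<otimes>\<^bsub>H\<lparr>carrier := S\<rparr>\<^esub> c"
      and "a \<in> carrier (H\<lparr>carrier := S\<rparr>)" "b \<in> carrier (H\<lparr>carrier := S\<rparr>)" "c \<in> carrier (H\<lparr>carrier := S\<rparr>)"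
    then show "a = b" using r_cancel[of a c b] subsetD[OF sub] by simp
  qed
  have "divides": "a divides\<^bsub>H\<lparr>carrier := S\<rparr>\<^esub> b \<longleftrightarrow> a divides\<^bsub>H\<^esub> b" if "a \<in> S" "b \<in> S" for a b
  proof
    assume "a divides\<^bsub>H\<lparr>carrier := S\<rparr>\<^esub> b"
    then show "a divides\<^bsub>H\<^esub> b" using sub by (auto simp: factor_def)
  next
    assume "a divides\<^bsub>H\<^esub> b"
    then obtain c where c: "c \<in> carrier H" "b = a \<otimes>\<^bsub>H\<^esub> c" by (auto simp: factor_def)
    then have "c divides\<^bsub>H\<^esub> b" using that sub m_comm[of a c] by (auto simp: factor_def)
    then have "c \<in> S" using closed that c by blast
    then show "a divides\<^bsub>H\<lparr>carrier := S\<rparr>\<^esub> b" using c by (auto simp: factor_def)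
  qed
  have "{(x, y). x \<in> S \<and> y \<in> S \<and> properfactor (H\<lparr>carrier := S\<rparr>) x y}
      \<subseteq> {(x, y). x \<in> carrier H \<and> y \<in> carrier H \<and> properfactor H x y}"
    using sub by (auto simp: properfactor_def "divides")
  then have "wf {(x, y). x \<in> S \<and> y \<in> S \<and> properfactor (H\<lparr>carrier := S\<rparr>) x y}"
    using v_fin_wf[OF v_noetherian_imp_v_fin[OF H]] by (rule wf_subset[rotated])
  then show "atomic (H\<lparr>carrier := S\<rparr>)" using cm by (intro atomicI_wf) simp_all
  have "Units H \<subseteq> S"
    by (rule subsetI, rule closed[OF S.one_closed]) (simp_all add: unit_divides Units_closed)
  moreover have "x \<in> Units (H\<lparr>carrier := S\<rparr>) \<longleftrightarrow> x \<in> Units H" if x: "x \<in> S" for x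
  proof -
    interpret HS: comm_monoid_cancel "H\<lparr>carrier := S\<rparr>" by (rule cm)
    show ?thesis
      using HS.Unit_eq_dividesone[of x] Unit_eq_dividesone[of x] x sub "divides"[OF x S.one_closed] by auto
  qed
  moreover have "Units (H\<lparr>carrier := S\<rparr>) \<subseteq> S" by (auto simp: Units_def)
  ultimately show "Units (H\<lparr>carrier := S\<rparr>) = Units H" by blast
qed

section \<open>Transfer homomorphisms into reduced monoids\<close>

lemma monoid_homD:
  assumes "monoid_hom H B \<theta>"
  shows "x \<in> carrier H \<Longrightarrow> \<theta> x \<in> carrier B"
    and "x \<in> carrier H \<Longrightarrow> y \<in> carrier H \<Longrightarrow> \<theta> (x \<otimes>\<^bsub>H\<^esub> y) = \<theta> x \<otimes>\<^bsub>B\<^esub> \<theta> y"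
    and "\<theta> \<one>\<^bsub>H\<^esub> = \<one>\<^bsub>B\<^esub>"
  using assms by (auto simp: monoid_hom_def hom_def)

lemma monoid_homI:
  assumes "\<And>x. x \<in> carrier H \<Longrightarrow> \<theta> x \<in> carrier B"
    and "\<And>x y. x \<in> carrier H \<Longrightarrow> y \<in> carrier H \<Longrightarrow> \<theta> (x \<otimes>\<^bsub>H\<^esub> y) = \<theta> x \<otimes>\<^bsub>B\<^esub> \<theta> y"
    and "\<theta> \<one>\<^bsub>H\<^esub> = \<one>\<^bsub>B\<^esub>"
  shows "monoid_hom H B \<theta>"
  using assms by (auto simp: monoid_hom_def hom_def)

lemma monoid_hom_comp:
  assumes "monoid_hom H B \<theta>" "monoid_hom B C \<eta>"
  shows "monoid_hom H C (\<eta> \<circ> \<theta>)"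
  by (rule monoid_homI) (simp_all add: monoid_homD[OF assms(1)] monoid_homD[OF assms(2)])

lemma transfer_hom_reduced_iff:
  assumes "comm_monoid B" and B: "Units B = {\<one>\<^bsub>B\<^esub>}"
  shows "transfer_hom H B \<theta> \<longleftrightarrow> atomic H \<and> atomic B \<and> monoid_hom H B \<theta> \<and> carrier B = \<theta> ` carrier H \<and>
     {u \<in> carrier H. \<theta> u = \<one>\<^bsub>B\<^esub>} = Units H \<and>
     (\<forall>u \<in> carrier H. \<forall>b \<in> carrier B. \<forall>c \<in> carrier B. \<theta> u = b \<otimes>\<^bsub>B\<^esub> c \<longrightarrow>
        (\<exists>v \<in> carrier H. \<exists>w \<in> carrier H. u = v \<otimes>\<^bsub>H\<^esub> w \<and> \<theta> v = b \<and> \<theta> w = c))"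
proof (cases "monoid_hom H B \<theta>")
  case True
  interpret comm_monoid B by fact
  have "\<theta> ` carrier H \<subseteq> carrier B"
    using True by (auto simp: monoid_hom_def hom_def)
  then have "Units B <#>\<^bsub>B\<^esub> \<theta> ` carrier H <#>\<^bsub>B\<^esub> Units B = \<theta> ` carrier H"
    by (force simp: B set_mult_def)
  then show ?thesis
    by (simp add: transfer_hom_def B inv_one cong: conj_cong ball_cong imp_cong bex_cong)
next
  case False
  then show ?thesis by (simp add: transfer_hom_def)
qed

lemma transfer_hom_comp:
  assumes B: "comm_monoid B" "Units B = {\<one>\<^bsub>B\<^esub>}" and C: "comm_monoid C" "Units C = {\<one>\<^bsub>C\<^esub>}"
    and \<theta>: "transfer_hom H B \<theta>" and \<eta>: "transfer_hom B C \<eta>"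
  shows "transfer_hom H C (\<eta> \<circ> \<theta>)"
proof -
  have "\<theta> u \<in> carrier B" if "u \<in> carrier H" for u
    using \<theta> that by (auto simp: transfer_hom_def monoid_hom_def hom_def)
  then have "{u \<in> carrier H. \<eta> (\<theta> u) = \<one>\<^bsub>C\<^esub>} = {u \<in> carrier H. \<theta> u = \<one>\<^bsub>B\<^esub>}"
    using \<eta> B(2) unfolding transfer_hom_reduced_iff[OF C] by blast
  moreover have "\<exists>v\<in>carrier H. \<exists>w\<in>carrier H. u = v \<otimes>\<^bsub>H\<^esub> w \<and> \<eta> (\<theta> v) = b \<and> \<eta> (\<theta> w) = c"
    if u: "u \<in> carrier H" and bc: "b \<in> carrier C" "c \<in> carrier C" "\<eta> (\<theta> u) = b \<otimes>\<^bsub>C\<^esub> c" for u b c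
  proof -
    have "\<theta> u \<in> carrier B"
      using \<theta> u by (auto simp: transfer_hom_def monoid_hom_def hom_def)
    with bc \<eta> obtain v w where vw: "v \<in> carrier B" "w \<in> carrier B" "\<theta> u = v \<otimes>\<^bsub>B\<^esub> w" "\<eta> v = b" "\<eta> w = c"
      unfolding transfer_hom_reduced_iff[OF C] by blast
    with u \<theta> obtain x y where "x \<in> carrier H" "y \<in> carrier H" "u = x \<otimes>\<^bsub>H\<^esub> y" "\<theta> x = v" "\<theta> y = w"
      unfolding transfer_hom_reduced_iff[OF B] by blast
    then show ?thesis using vw by blast
  qed
  moreover have "monoid_hom H C (\<eta> \<circ> \<theta>)"
    using \<theta> \<eta> by (auto simp: transfer_hom_def intro: monoid_hom_comp)
  moreover have "carrier C = (\<eta> \<circ> \<theta>) ` carrier H"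
    using \<theta> \<eta> unfolding transfer_hom_reduced_iff[OF B] transfer_hom_reduced_iff[OF C] by (simp add: image_comp)
  ultimately show ?thesis
    using \<theta> \<eta> unfolding transfer_hom_reduced_iff[OF B] transfer_hom_reduced_iff[OF C] by simp
qed

text \<open>For \<open>H\<close> with divisor homomorphism \<open>\<pi>\<close>, the map \<open>\<psi>\<close> replaces primes by their classes, and whether a divisor is
  principal depends on its image under \<open>\<psi>\<close> only. So if \<open>\<psi> (\<pi> u) = bc\<close> with \<open>b, c\<close> in \<open>B\<close>, then a factorization of
  the divisor \<open>\<pi> u\<close> above \<open>bc\<close> consists of two principal divisors, and comes from a factorization of \<open>u\<close>.\<close>

lemma transfer_hom_via_divisors:
  assumes H: "comm_monoid_cancel H" "atomic H"
    and B: "comm_monoid B" "atomic B" "Units B = {\<one>\<^bsub>B\<^esub>}"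
    and BE: "carrier B \<subseteq> carrier E" "mult B = mult E" "one B = one E"
    and \<pi>: "monoid_hom H D \<pi>" and \<psi>: "monoid_hom D E \<psi>"
    and assoc: "\<And>a b. a \<in> carrier H \<Longrightarrow> b \<in> carrier H \<Longrightarrow> \<pi> a = \<pi> b \<Longrightarrow> a \<sim>\<^bsub>H\<^esub> b"
    and image: "\<And>d. d \<in> carrier D \<Longrightarrow> \<psi> d \<in> carrier B \<longleftrightarrow> d \<in> \<pi> ` carrier H"
    and surj: "\<psi> ` carrier D = carrier E"
    and split: "\<And>d b c. d \<in> carrier D \<Longrightarrow> b \<in> carrier E \<Longrightarrow> c \<in> carrier E \<Longrightarrow> \<psi> d = b \<otimes>\<^bsub>E\<^esub> c \<Longrightarrow>
       \<exists>v\<in>carrier D. \<exists>w\<in>carrier D. d = v \<otimes>\<^bsub>D\<^esub> w \<and> \<psi> v = b \<and> \<psi> w = c"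
    and trivial: "\<And>d. d \<in> carrier D \<Longrightarrow> \<psi> d = \<one>\<^bsub>E\<^esub> \<Longrightarrow> d = \<one>\<^bsub>D\<^esub>"
  shows "transfer_hom H B (\<psi> \<circ> \<pi>)"
  unfolding transfer_hom_reduced_iff[OF B(1,3)]
proof (intro conjI ballI impI)
  interpret H: comm_monoid_cancel H by (rule H)
  interpret B: comm_monoid B by (rule B)
  have \<pi>C: "\<pi> a \<in> carrier D" if "a \<in> carrier H" for a
    using \<pi> that by (auto simp: monoid_hom_def hom_def)
  have in_B: "\<psi> (\<pi> a) \<in> carrier B" if "a \<in> carrier H" for a
    using image[OF \<pi>C[OF that]] that by blast
  show hom: "monoid_hom H B (\<psi> \<circ> \<pi>)"
    using \<pi> \<psi> in_B \<pi>C by (auto simp: monoid_hom_def hom_def BE)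
  show "carrier B = (\<psi> \<circ> \<pi>) ` carrier H"
  proof (intro equalityI subsetI)
    fix b assume b: "b \<in> carrier B"
    then obtain d where d: "d \<in> carrier D" "b = \<psi> d" using BE surj by blast
    then show "b \<in> (\<psi> \<circ> \<pi>) ` carrier H" using image b by auto
  qed (use in_B in auto)
  show "{u \<in> carrier H. (\<psi> \<circ> \<pi>) u = \<one>\<^bsub>B\<^esub>} = Units H"
  proof (intro equalityI subsetI)
    fix u assume u: "u \<in> {u \<in> carrier H. (\<psi> \<circ> \<pi>) u = \<one>\<^bsub>B\<^esub>}"
    then have "\<pi> u = \<pi> \<one>\<^bsub>H\<^esub>" using trivial[OF \<pi>C] \<pi> by (auto simp: BE monoid_hom_def)
    then have "u \<sim>\<^bsub>H\<^esub> \<one>\<^bsub>H\<^esub>" using assoc u by simp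
    then show "u \<in> Units H" using u H.Unit_eq_dividesone by (simp add: associated_def)
  next
    fix u assume "u \<in> Units H"
    then obtain v where uv: "u \<in> carrier H" "v \<in> carrier H" "u \<otimes>\<^bsub>H\<^esub> v = \<one>\<^bsub>H\<^esub>" by (auto simp: Units_def)
    then have "(\<psi> \<circ> \<pi>) u \<otimes>\<^bsub>B\<^esub> (\<psi> \<circ> \<pi>) v = \<one>\<^bsub>B\<^esub>"
      using monoid_homD(2)[OF hom uv(1,2)] monoid_homD(3)[OF hom] by simp
    with B.Units_one_closed have "(\<psi> \<circ> \<pi>) u \<otimes>\<^bsub>B\<^esub> (\<psi> \<circ> \<pi>) v \<in> Units B" by simp
    then have "(\<psi> \<circ> \<pi>) u \<in> Units B"
      by (rule B.unit_factor[of _ "(\<psi> \<circ> \<pi>) v"]) (use in_B[OF uv(1)] in_B[OF uv(2)] in simp_all)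
    then show "u \<in> {u \<in> carrier H. (\<psi> \<circ> \<pi>) u = \<one>\<^bsub>B\<^esub>}" using B uv by simp
  qed
  fix u b c assume u: "u \<in> carrier H" and bc: "b \<in> carrier B" "c \<in> carrier B"
    and eq: "(\<psi> \<circ> \<pi>) u = b \<otimes>\<^bsub>B\<^esub> c"
  have "b \<in> carrier E" "c \<in> carrier E" "\<psi> (\<pi> u) = b \<otimes>\<^bsub>E\<^esub> c" using bc eq BE by auto
  then obtain d e where de: "d \<in> carrier D" "e \<in> carrier D" "\<pi> u = d \<otimes>\<^bsub>D\<^esub> e" "\<psi> d = b" "\<psi> e = c"
    using split[OF \<pi>C[OF u]] by blast
  then obtain v w where vw: "v \<in> carrier H" "w \<in> carrier H" "d = \<pi> v" "e = \<pi> w"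
    using image bc by blast
  then have "\<pi> (v \<otimes>\<^bsub>H\<^esub> w) = \<pi> u" using \<pi> de by (auto simp: monoid_hom_def hom_def)
  then have "u \<sim>\<^bsub>H\<^esub> v \<otimes>\<^bsub>H\<^esub> w" using assoc u vw by simp
  then obtain \<epsilon> where \<epsilon>: "\<epsilon> \<in> Units H" "u = v \<otimes>\<^bsub>H\<^esub> w \<otimes>\<^bsub>H\<^esub> \<epsilon>"
    using H.associatedD2 u vw by blast
  have \<epsilon>C: "\<epsilon> \<in> carrier H" using \<epsilon>(1) by (rule H.Units_closed)
  have "w \<otimes>\<^bsub>H\<^esub> \<epsilon> \<sim>\<^bsub>H\<^esub> w" using H.associatedI2'[of "w \<otimes>\<^bsub>H\<^esub> \<epsilon>" w \<epsilon>] vw \<epsilon> by simp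
  \<comment> \<open>Units are mapped to units, and those of the target are trivial.\<close>
  have "\<psi> (\<pi> \<epsilon>) = \<one>\<^bsub>B\<^esub>"
  proof -
    obtain \<delta> where d: "\<delta> \<in> carrier H" "\<epsilon> \<otimes>\<^bsub>H\<^esub> \<delta> = \<one>\<^bsub>H\<^esub>" using \<epsilon>(1) by (auto simp: Units_def)
    then have "(\<psi> \<circ> \<pi>) \<epsilon> \<otimes>\<^bsub>B\<^esub> (\<psi> \<circ> \<pi>) \<delta> = \<one>\<^bsub>B\<^esub>"
      using monoid_homD(2)[OF hom \<epsilon>C d(1)] monoid_homD(3)[OF hom] by simp
    with B.Units_one_closed have "(\<psi> \<circ> \<pi>) \<epsilon> \<otimes>\<^bsub>B\<^esub> (\<psi> \<circ> \<pi>) \<delta> \<in> Units B" by simp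
    then have "(\<psi> \<circ> \<pi>) \<epsilon> \<in> Units B"
      by (rule B.unit_factor[of _ "(\<psi> \<circ> \<pi>) \<delta>"]) (use in_B[OF \<epsilon>C] in_B[OF d(1)] in simp_all)
    then show ?thesis using B by simp
  qed
  then have "(\<psi> \<circ> \<pi>) (w \<otimes>\<^bsub>H\<^esub> \<epsilon>) = c"
    using monoid_homD(2)[OF hom vw(2) \<epsilon>C] vw de bc by simp
  moreover have "u = v \<otimes>\<^bsub>H\<^esub> (w \<otimes>\<^bsub>H\<^esub> \<epsilon>)" using \<epsilon>(2) \<epsilon>C vw by (simp add: H.m_assoc)
  ultimately show "\<exists>v\<in>carrier H. \<exists>w\<in>carrier H. u = v \<otimes>\<^bsub>H\<^esub> w \<and> (\<psi> \<circ> \<pi>) v = b \<and> (\<psi> \<circ> \<pi>) w = c"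
    using vw de \<epsilon>C by (intro bexI[of _ v] bexI[of _ "w \<otimes>\<^bsub>H\<^esub> \<epsilon>"]) auto
qed (use H B in auto)

section \<open>Sums of sequences and block monoids\<close>

context comm_group
begin

lemma seq_sum_superset:
  assumes "finite A" "set_mset S \<subseteq> A" "A \<subseteq> carrier G"
  shows "seq_sum G S = (\<Otimes>g\<in>A. g [^] count S g)"
  unfolding seq_sum_def using assms
  by (intro finprod_mono_neutral_cong_left) (auto simp: not_in_iff)

lemma seq_sum_empty [simp]: "seq_sum G {#} = \<one>"
  by (simp add: seq_sum_def)

lemma seq_sum_closed [simp]: "set_mset S \<subseteq> carrier G \<Longrightarrow> seq_sum G S \<in> carrier G"
  unfolding seq_sum_def by (intro finprod_closed) auto

lemma seq_sum_plus [simp]: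
  assumes "set_mset S \<subseteq> carrier G" "set_mset T \<subseteq> carrier G"
  shows "seq_sum G (S + T) = seq_sum G S \<otimes> seq_sum G T"
proof -
  let ?A = "set_mset S \<union> set_mset T"
  have A: "finite ?A" "?A \<subseteq> carrier G" using assms by auto
  have "seq_sum G (S + T) = (\<Otimes>g\<in>?A. g [^] count (S + T) g)"
    using A by (intro seq_sum_superset) auto
  also have "\<dots> = (\<Otimes>g\<in>?A. g [^] count S g \<otimes> g [^] count T g)"
    using A by (intro finprod_cong') (auto simp: nat_pow_mult)
  also have "\<dots> = (\<Otimes>g\<in>?A. g [^] count S g) \<otimes> (\<Otimes>g\<in>?A. g [^] count T g)"
    using A by (intro finprod_multf) auto
  also have "\<dots> = seq_sum G S \<otimes> seq_sum G T"
    using A by (subst (1 2) seq_sum_superset[symmetric]) auto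
  finally show ?thesis .
qed

lemma seq_sum_single [simp]: "g \<in> carrier G \<Longrightarrow> seq_sum G {#g#} = g"
  by (simp add: seq_sum_def)

lemma seq_sum_add_mset [simp]:
  "g \<in> carrier G \<Longrightarrow> set_mset S \<subseteq> carrier G \<Longrightarrow> seq_sum G (add_mset g S) = g \<otimes> seq_sum G S"
  using seq_sum_plus[of "{#g#}" S] by simp

lemma seq_sum_replicate [simp]: "g \<in> carrier G \<Longrightarrow> seq_sum G (replicate_mset n g) = g [^] n"
  by (induction n) (auto simp: m_comm)

lemma seq_sum_repeat:
  assumes S: "set_mset S \<subseteq> carrier G"
  shows "seq_sum G (repeat_mset n S) = seq_sum G S [^] n"
proof (induction n)
  case (Suc n)
  have "set_mset (repeat_mset n S) \<subseteq> set_mset S" by (induction n) auto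
  then show ?case using Suc S by (simp add: m_comm)
qed simp

end

lemma free_abelian_simps [simp]:
  "S \<in> carrier (free_abelian_monoid P) \<longleftrightarrow> set_mset S \<subseteq> P"
  "S \<otimes>\<^bsub>free_abelian_monoid P\<^esub> T = S + T" "\<one>\<^bsub>free_abelian_monoid P\<^esub> = {#}"
  by (auto simp: free_abelian_monoid_def)

lemma free_abelian_cancel: "comm_monoid_cancel (free_abelian_monoid P)"
proof (rule comm_monoid_cancelI)
  show "comm_monoid (free_abelian_monoid P)"
    by (rule comm_monoidI) auto
qed auto

lemma free_abelian_divides:
  "set_mset S \<subseteq> P \<Longrightarrow> set_mset T \<subseteq> P \<Longrightarrow> S divides\<^bsub>free_abelian_monoid P\<^esub> T \<longleftrightarrow> S \<subseteq># T"
  by (auto simp: factor_def subset_mset.le_iff_add)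

lemma block_monoid_simps [simp]:
  "S \<in> carrier (block_monoid G P) \<longleftrightarrow> set_mset S \<subseteq> P \<and> seq_sum G S = \<one>\<^bsub>G\<^esub>"
  "S \<otimes>\<^bsub>block_monoid G P\<^esub> T = S + T" "\<one>\<^bsub>block_monoid G P\<^esub> = {#}"
  by (auto simp: block_monoid_def free_abelian_monoid_def)

context comm_group
begin

context
  fixes P assumes P: "P \<subseteq> carrier G"
begin

lemma block_monoid_cancel: "comm_monoid_cancel (block_monoid G P)"
proof (rule comm_monoid_cancelI)
  show "comm_monoid (block_monoid G P)"
    by (rule comm_monoidI) (use P in auto)
qed auto

lemma block_monoid_Units: "Units (block_monoid G P) = {\<one>\<^bsub>block_monoid G P\<^esub>}"
  by (auto simp: Units_def)

lemma block_monoid_divides: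
  assumes "S \<in> carrier (block_monoid G P)" "T \<in> carrier (block_monoid G P)"
  shows "S divides\<^bsub>block_monoid G P\<^esub> T \<longleftrightarrow> S \<subseteq># T"
proof
  assume "S \<subseteq># T"
  then obtain U where U: "T = S + U" by (auto simp: subset_mset.le_iff_add)
  then have c: "set_mset U \<subseteq> P" "set_mset S \<subseteq> carrier G" "set_mset U \<subseteq> carrier G" using assms P by auto
  have "seq_sum G T = seq_sum G S \<otimes> seq_sum G U" unfolding U using c by simp
  then have "seq_sum G U = \<one>" using assms c by simp
  then show "S divides\<^bsub>block_monoid G P\<^esub> T" using U c by (auto simp: factor_def)
qed (auto simp: factor_def)

lemma block_monoid_atomic: "atomic (block_monoid G P)"
proof (rule atomicI_wf[OF block_monoid_cancel], rule wf_subset[OF wf_measure[of size]], clarify)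
  fix S T assume "S \<in> carrier (block_monoid G P)" "T \<in> carrier (block_monoid G P)"
    and "properfactor (block_monoid G P) S T"
  then have "S \<subseteq># T" "S \<noteq> T" by (auto simp: properfactor_def block_monoid_divides simp del: block_monoid_simps)
  then show "(S, T) \<in> measure size" by (simp add: mset_subset_size subset_mset.less_le)
qed

end

end

section \<open>Quotients of the quotient group\<close>

locale submonoid_quotient = comm_monoid_cancel G for G (structure) +
  fixes N assumes N: "N \<subseteq> carrier G" "\<one> \<in> N" "\<And>x y. x \<in> N \<Longrightarrow> y \<in> N \<Longrightarrow> x \<otimes> y \<in> N"
begin

interpretation Q: comm_group "quot_grp G"
  by (rule quot_grp_comm_group)

lemma quot_subgrp_subgroup: "subgroup (quot_subgrp G N) (quot_grp G)"
proof (rule Q.subgroupI)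
  show "quot_subgrp G N \<subseteq> carrier (quot_grp G)" using N(1) by (auto simp: quot_subgrp_def subset_iff)
  show "quot_subgrp G N \<noteq> {}" using N by (auto simp: quot_subgrp_def)
  fix x assume "x \<in> quot_subgrp G N"
  then obtain a b where x: "a \<in> N" "b \<in> N" "x = mk_frac G a b" by (auto simp: quot_subgrp_def)
  then have "inv\<^bsub>quot_grp G\<^esub> x = mk_frac G b a" using subsetD[OF N(1)] by simp
  then show "inv\<^bsub>quot_grp G\<^esub> x \<in> quot_subgrp G N" using x by (auto simp: quot_subgrp_def)
  fix y assume "y \<in> quot_subgrp G N"
  then obtain c d where y: "c \<in> N" "d \<in> N" "y = mk_frac G c d" by (auto simp: quot_subgrp_def)
  then have "x \<otimes>\<^bsub>quot_grp G\<^esub> y = mk_frac G (a \<otimes> c) (b \<otimes> d)" using x subsetD[OF N(1)] by simp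
  moreover have "a \<otimes> c \<in> N" "b \<otimes> d \<in> N" using x y N(3) by auto
  ultimately show "x \<otimes>\<^bsub>quot_grp G\<^esub> y \<in> quot_subgrp G N" unfolding quot_subgrp_def by blast
qed

lemma quotient_group: "comm_group (quot_grp G Mod quot_subgrp G N)"
  by (rule Q.abelian_FactGroup[OF quot_subgrp_subgroup])

definition quotient_class where "quotient_class a = quot_subgrp G N #>\<^bsub>quot_grp G\<^esub> emb G a"

lemma quotient_class_hom: "monoid_hom G (quot_grp G Mod quot_subgrp G N) quotient_class"
proof -
  interpret S: normal "quot_subgrp G N" "quot_grp G"
    using quot_subgrp_subgroup by (rule Q.subgroup_imp_normal)
  have "quotient_class (a \<otimes> b) = quotient_class a <#>\<^bsub>quot_grp G\<^esub> quotient_class b" if "a \<in> carrier G" "b \<in> carrier G" for a b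
    using that by (simp add: quotient_class_def S.rcos_sum)
  moreover have "quotient_class \<one> = quot_subgrp G N"
    using S.subset by (simp add: quotient_class_def emb_one)
  ultimately show ?thesis
    by (auto simp: monoid_hom_def hom_def FactGroup_def RCOSETS_def quotient_class_def intro: emb_closed)
qed

lemma quotient_class_eq_one_iff:
  assumes a: "a \<in> carrier G"
  shows "quotient_class a = \<one>\<^bsub>quot_grp G Mod quot_subgrp G N\<^esub> \<longleftrightarrow> (\<exists>p\<in>N. \<exists>q\<in>N. a \<otimes> q = p)"
proof -
  have "quotient_class a = quot_subgrp G N \<longleftrightarrow> emb G a \<in> quot_subgrp G N"
    using Q.coset_join1[OF _ _ quot_subgrp_subgroup] Q.coset_join2[OF _ quot_subgrp_subgroup] a
      subgroup.subset[OF quot_subgrp_subgroup]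
    by (auto simp: quotient_class_def)
  also have "\<dots> \<longleftrightarrow> (\<exists>p\<in>N. \<exists>q\<in>N. a \<otimes> q = p)"
  proof -
    have "emb G a = mk_frac G p q \<longleftrightarrow> a \<otimes> q = p" if "p \<in> N" "q \<in> N" for p q
      using that a subsetD[OF N(1)] by (simp add: emb_def mk_frac_eq_iff)
    then show ?thesis unfolding quot_subgrp_def by blast
  qed
  finally show ?thesis by (simp add: FactGroup_def)
qed

end

section \<open>Monoids embedded in a finite product of primary monoids\<close>

text \<open>The monoid embeds into the product of the \<open>R P\<close> in such a way that divisibility can be tested in the components
  (it is saturated) and the \<open>N\<close>-th power of each element of the product is in the image. This second property, used in
  the form \<open>concentrated\<close>, makes the minimal primes of the monoid correspond to the components.\<close>

locale finite_components = comm_monoid_cancel G for G :: "('a, 'm) monoid_scheme" (structure) +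
  fixes Y :: "'i set" and R :: "'i \<Rightarrow> ('b, 'n) monoid_scheme" and r :: "'i \<Rightarrow> 'a \<Rightarrow> 'b" and N :: nat
  assumes Y_finite: "finite Y"
    and R_cancel: "P \<in> Y \<Longrightarrow> comm_monoid_cancel (R P)"
    and R_reduced: "P \<in> Y \<Longrightarrow> Units (R P) = {\<one>\<^bsub>R P\<^esub>}"
    and R_v_fin: "P \<in> Y \<Longrightarrow> comm_monoid_cancel.v_fin (R P)"
    and R_primary: "P \<in> Y \<Longrightarrow> f \<in> carrier (R P) \<Longrightarrow> g \<in> carrier (R P) \<Longrightarrow> f \<noteq> \<one>\<^bsub>R P\<^esub> \<Longrightarrow>
        \<exists>n::nat. g divides\<^bsub>R P\<^esub> f [^]\<^bsub>R P\<^esub> n"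
    and R_nontrivial: "P \<in> Y \<Longrightarrow> \<exists>f\<in>carrier (R P). f \<noteq> \<one>\<^bsub>R P\<^esub>"
    and r_hom: "P \<in> Y \<Longrightarrow> monoid_hom G (R P) (r P)"
    and divides_iff: "a \<in> carrier G \<Longrightarrow> b \<in> carrier G \<Longrightarrow> a divides b \<longleftrightarrow> (\<forall>P\<in>Y. r P a divides\<^bsub>R P\<^esub> r P b)"
    and N_pos: "N > 0"
    and concentrated: "P \<in> Y \<Longrightarrow> f \<in> carrier (R P) \<Longrightarrow>
        \<exists>b\<in>carrier G. r P b = f [^]\<^bsub>R P\<^esub> N \<and> (\<forall>Q\<in>Y. Q \<noteq> P \<longrightarrow> r Q b = \<one>\<^bsub>R Q\<^esub>)"
begin

lemma r_simps [simp]: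
  "P \<in> Y \<Longrightarrow> a \<in> carrier G \<Longrightarrow> r P a \<in> carrier (R P)"
  "P \<in> Y \<Longrightarrow> a \<in> carrier G \<Longrightarrow> b \<in> carrier G \<Longrightarrow> r P (a \<otimes> b) = r P a \<otimes>\<^bsub>R P\<^esub> r P b"
  "P \<in> Y \<Longrightarrow> r P \<one> = \<one>\<^bsub>R P\<^esub>"
  using monoid_homD[OF r_hom] by auto

lemma r_pow [simp]: "P \<in> Y \<Longrightarrow> a \<in> carrier G \<Longrightarrow> r P (a [^] (n::nat)) = r P a [^]\<^bsub>R P\<^esub> n"
  by (induction n) simp_all

lemma R_mult_eq_one:
  assumes "P \<in> Y" "f \<in> carrier (R P)" "g \<in> carrier (R P)" "f \<otimes>\<^bsub>R P\<^esub> g = \<one>\<^bsub>R P\<^esub>"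
  shows "f = \<one>\<^bsub>R P\<^esub>"
proof -
  interpret R: comm_monoid_cancel "R P" by (rule R_cancel) fact
  have "f \<in> Units (R P)" by (rule R.unit_factor[of f g]) (use assms in simp_all)
  then show ?thesis using R_reduced assms by simp
qed

lemma R_pow_eq_one:
  assumes "P \<in> Y" "f \<in> carrier (R P)" "f [^]\<^bsub>R P\<^esub> (n::nat) = \<one>\<^bsub>R P\<^esub>" "n > 0"
  shows "f = \<one>\<^bsub>R P\<^esub>"
proof -
  interpret R: comm_monoid_cancel "R P" by (rule R_cancel) fact
  obtain k where "n = Suc k" using assms(4) by (cases n) auto
  then have "f \<otimes>\<^bsub>R P\<^esub> f [^]\<^bsub>R P\<^esub> k = \<one>\<^bsub>R P\<^esub>" using assms by (simp add: R.m_comm)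
  then show ?thesis by (rule R_mult_eq_one[rotated -1]) (use assms in simp_all)
qed

text \<open>The union of sets that suffice for the single components suffices for all of them, as there are only finitely many.\<close>

lemma components_v_fin: v_fin
  unfolding v_fin_def
proof (intro allI impI)
  fix A assume A: "A \<subseteq> carrier G"
  have "\<exists>E. E \<subseteq> A \<and> finite E \<and> (\<forall>f\<in>carrier (R P). \<forall>g\<in>carrier (R P).
      (\<forall>y\<in>E. f divides\<^bsub>R P\<^esub> g \<otimes>\<^bsub>R P\<^esub> r P y) \<longrightarrow> (\<forall>y\<in>A. f divides\<^bsub>R P\<^esub> g \<otimes>\<^bsub>R P\<^esub> r P y))" if P: "P \<in> Y" for P
  proof -
    interpret R: comm_monoid_cancel "R P" by (rule R_cancel) fact
    have "r P ` A \<subseteq> carrier (R P)" using A P by auto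
    with R_v_fin[OF P] obtain F where F: "F \<subseteq> r P ` A" "finite F"
      and FA: "\<forall>f\<in>carrier (R P). \<forall>g\<in>carrier (R P). (\<forall>y\<in>F. f divides\<^bsub>R P\<^esub> g \<otimes>\<^bsub>R P\<^esub> y) \<longrightarrow> (\<forall>y\<in>r P ` A. f divides\<^bsub>R P\<^esub> g \<otimes>\<^bsub>R P\<^esub> y)"
      by (rule R.v_finE)
    from F obtain E where "E \<subseteq> A" "finite E" "F = r P ` E" by (meson finite_subset_image)
    then show ?thesis using FA by auto
  qed
  then obtain E where E: "\<And>P. P \<in> Y \<Longrightarrow> E P \<subseteq> A" "\<And>P. P \<in> Y \<Longrightarrow> finite (E P)"
    and EA: "\<And>P f g y. P \<in> Y \<Longrightarrow> f \<in> carrier (R P) \<Longrightarrow> g \<in> carrier (R P) \<Longrightarrow>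
      \<forall>y\<in>E P. f divides\<^bsub>R P\<^esub> g \<otimes>\<^bsub>R P\<^esub> r P y \<Longrightarrow> y \<in> A \<Longrightarrow> f divides\<^bsub>R P\<^esub> g \<otimes>\<^bsub>R P\<^esub> r P y"
    by metis
  show "\<exists>E\<subseteq>A. finite E \<and> (\<forall>a\<in>carrier G. \<forall>b\<in>carrier G.
      (\<forall>y\<in>E. a divides b \<otimes> y) \<longrightarrow> (\<forall>y\<in>A. a divides b \<otimes> y))"
  proof (intro exI[of _ "\<Union>P\<in>Y. E P"] conjI ballI impI)
    show "(\<Union>P\<in>Y. E P) \<subseteq> A" "finite (\<Union>P\<in>Y. E P)" using E Y_finite by auto
    fix a b y assume ab: "a \<in> carrier G" "b \<in> carrier G" and y: "y \<in> A"
      and all: "\<forall>y\<in>(\<Union>P\<in>Y. E P). a divides b \<otimes> y"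
    have yC: "y \<in> carrier G" using y A by blast
    have "r P a divides\<^bsub>R P\<^esub> r P b \<otimes>\<^bsub>R P\<^esub> r P y" if P: "P \<in> Y" for P
    proof (rule EA[OF P _ _ _ y])
      show "\<forall>y\<in>E P. r P a divides\<^bsub>R P\<^esub> r P b \<otimes>\<^bsub>R P\<^esub> r P y"
      proof
        fix z assume z: "z \<in> E P"
        then have "z \<in> carrier G" using E P A by blast
        moreover have "a divides b \<otimes> z" using all z P by blast
        ultimately have "r P a divides\<^bsub>R P\<^esub> r P (b \<otimes> z)" using ab P by (simp add: divides_iff[of a "b \<otimes> z"])
        then show "r P a divides\<^bsub>R P\<^esub> r P b \<otimes>\<^bsub>R P\<^esub> r P z" using ab P \<open>z \<in> carrier G\<close> by simp
      qed
    qed (use ab P in simp_all)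
    then show "a divides b \<otimes> y" using ab yC by (simp add: divides_iff)
  qed
qed

definition center :: "'i \<Rightarrow> 'a set" where
  "center P = {x \<in> carrier G. r P x \<noteq> \<one>\<^bsub>R P\<^esub>}"

lemma center_prime:
  assumes P: "P \<in> Y"
  shows "prime_set (center P)" "center P \<noteq> {}"
proof -
  interpret R: comm_monoid_cancel "R P" by (rule R_cancel) fact
  have "x \<otimes> y \<in> center P" if x: "x \<in> center P" and y: "y \<in> carrier G" for x y
  proof -
    have "r P x \<otimes>\<^bsub>R P\<^esub> r P y \<noteq> \<one>\<^bsub>R P\<^esub>"
      using R_mult_eq_one[OF P, of "r P x" "r P y"] x y P by (auto simp: center_def)
    then show ?thesis using x y P by (simp add: center_def)
  qed
  then show "prime_set (center P)"
    using P by (auto simp: prime_set_def ideal_set_def center_def)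
  obtain f where f: "f \<in> carrier (R P)" "f \<noteq> \<one>\<^bsub>R P\<^esub>" using R_nontrivial[OF P] by blast
  then obtain b where "b \<in> carrier G" "r P b = f [^]\<^bsub>R P\<^esub> N" using concentrated[OF P] by blast
  then have "b \<in> center P" using R_pow_eq_one[OF P f(1) _ N_pos] f by (auto simp: center_def)
  then show "center P \<noteq> {}" by blast
qed

text \<open>Let \<open>z\<close> be in the prime \<open>Q\<close>. Since \<open>z\<^sup>N\<close> is associated to a product of elements concentrated in one
  component, one of these is in \<open>Q\<close>. As the components are primary, it divides a power of each
  element of the center of its component.\<close>

lemma prime_contains_center:
  assumes Q: "prime_set Q" and z: "z \<in> Q"
  shows "\<exists>P\<in>Y. center P \<subseteq> Q"
proof -
  have QC: "Q \<subseteq> carrier G" and ideal: "\<And>x y. x \<in> Q \<Longrightarrow> y \<in> carrier G \<Longrightarrow> x \<otimes> y \<in> Q"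
    and one: "\<one> \<notin> Q"
    and mult: "\<And>x y. x \<in> carrier G \<Longrightarrow> x \<notin> Q \<Longrightarrow> y \<in> carrier G \<Longrightarrow> y \<notin> Q \<Longrightarrow> x \<otimes> y \<notin> Q"
    using Q by (auto simp: prime_set_def ideal_set_def)
  have zC: "z \<in> carrier G" using z QC by blast
  have "\<forall>P. \<exists>b. P \<in> Y \<longrightarrow> b \<in> carrier G \<and> r P b = r P z [^]\<^bsub>R P\<^esub> N \<and> (\<forall>Q\<in>Y. Q \<noteq> P \<longrightarrow> r Q b = \<one>\<^bsub>R Q\<^esub>)"
    using concentrated zC r_simps(1) by blast
  then obtain b where b: "\<And>P. P \<in> Y \<Longrightarrow> b P \<in> carrier G" "\<And>P. P \<in> Y \<Longrightarrow> r P (b P) = r P z [^]\<^bsub>R P\<^esub> N"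
      "\<And>P Q. P \<in> Y \<Longrightarrow> Q \<in> Y \<Longrightarrow> Q \<noteq> P \<Longrightarrow> r Q (b P) = \<one>\<^bsub>R Q\<^esub>" by metis
  have "\<exists>P\<in>Y. b P \<in> Q"
  proof (rule ccontr)
    assume no: "\<not> ?thesis"
    have "\<exists>w\<in>carrier G. w \<notin> Q \<and> (\<forall>P\<in>F. r P w = r P z [^]\<^bsub>R P\<^esub> N) \<and> (\<forall>P\<in>Y - F. r P w = \<one>\<^bsub>R P\<^esub>)"
      if "finite F" "F \<subseteq> Y" for F
      using that
    proof (induction F)
      case empty
      then show ?case using one by (intro bexI[of _ \<one>]) auto
    next
      case (insert P F)
      then obtain w where w: "w \<in> carrier G" "w \<notin> Q" "\<forall>P\<in>F. r P w = r P z [^]\<^bsub>R P\<^esub> N" "\<forall>P\<in>Y - F. r P w = \<one>\<^bsub>R P\<^esub>"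
        by auto
      have P: "P \<in> Y" "P \<notin> F" "F \<subseteq> Y" using insert by auto
      have "r P' (b P \<otimes> w) = r P' z [^]\<^bsub>R P'\<^esub> N" if P': "P' \<in> insert P F" for P'
      proof -
        have "P' \<in> Y" using P P' by blast
        then interpret R: comm_monoid_cancel "R P'" by (rule R_cancel)
        show ?thesis
        proof (cases "P' = P")
          case True
          then have "r P' (b P) = r P' z [^]\<^bsub>R P'\<^esub> N" "r P' w = \<one>\<^bsub>R P'\<^esub>" using P b w by auto
          then show ?thesis using \<open>P' \<in> Y\<close> P b w zC by simp
        next
          case False
          then show ?thesis using P P' \<open>P' \<in> Y\<close> b w zC by auto
        qed
      qed
      moreover have "r P' (b P \<otimes> w) = \<one>\<^bsub>R P'\<^esub>" if P': "P' \<in> Y - insert P F" for P'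
      proof -
        have "P' \<in> Y" using P' by blast
        then interpret R: comm_monoid_cancel "R P'" by (rule R_cancel)
        show ?thesis using P P' b w by auto
      qed
      moreover have "b P \<otimes> w \<notin> Q" using no P b w by (intro mult) auto
      ultimately show ?case using b P w by (intro bexI[of _ "b P \<otimes> w"]) auto
    qed
    from this[OF Y_finite] obtain w where w: "w \<in> carrier G" "w \<notin> Q" "\<forall>P\<in>Y. r P w = r P z [^]\<^bsub>R P\<^esub> N"
      by auto
    have "z divides w"
      unfolding divides_iff[OF zC w(1)]
    proof
      fix P assume P: "P \<in> Y"
      interpret R: comm_monoid_cancel "R P" by (rule R_cancel) fact
      obtain k where "N = Suc k" using N_pos by (cases N) auto
      then have "r P w = r P z \<otimes>\<^bsub>R P\<^esub> r P z [^]\<^bsub>R P\<^esub> k" using w P zC by (simp add: R.m_comm)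
      then show "r P z divides\<^bsub>R P\<^esub> r P w" using P zC by auto
    qed
    then show False using ideal[OF z] w by (auto simp: factor_def)
  qed
  then obtain P where P: "P \<in> Y" "b P \<in> Q" by blast
  interpret R: comm_monoid_cancel "R P" by (rule R_cancel) fact
  have "center P \<subseteq> Q"
  proof
    fix y assume "y \<in> center P"
    then have y: "y \<in> carrier G" "r P y \<noteq> \<one>\<^bsub>R P\<^esub>" by (auto simp: center_def)
    have "\<exists>n::nat. r P (b P) divides\<^bsub>R P\<^esub> r P y [^]\<^bsub>R P\<^esub> n"
      using y b(1) P by (intro R_primary) simp_all
    then obtain n where n: "r P (b P) divides\<^bsub>R P\<^esub> r P y [^]\<^bsub>R P\<^esub> (n::nat)" ..
    have "b P divides y [^] n"
      unfolding divides_iff[OF b(1)[OF P(1)] nat_pow_closed[OF y(1)]]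
    proof
      fix P' assume P': "P' \<in> Y"
      interpret R': comm_monoid_cancel "R P'" by (rule R_cancel) fact
      show "r P' (b P) divides\<^bsub>R P'\<^esub> r P' (y [^] n)"
      proof (cases "P' = P")
        case True
        then show ?thesis using n P y by simp
      next
        case False
        then have "r P' (b P) = \<one>\<^bsub>R P'\<^esub>" using b P P' by simp
        then show ?thesis using P' y by (auto simp: factor_def)
      qed
    qed
    then have yn: "y [^] n \<in> Q" using ideal[OF P(2)] by (auto simp: factor_def)
    show "y \<in> Q"
    proof (rule ccontr)
      assume "y \<notin> Q"
      then have "y [^] m \<notin> Q" for m :: nat
        using y one mult by (induction m) auto
      then show False using yn by blast
    qed
  qed
  then show ?thesis using P by blast
qed

lemma center_antichain:
  assumes P: "P \<in> Y" "Q \<in> Y" "center P \<subseteq> center Q"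
  shows "P = Q"
proof (rule ccontr)
  assume "P \<noteq> Q"
  interpret R: comm_monoid_cancel "R P" by (rule R_cancel) fact
  obtain f where f: "f \<in> carrier (R P)" "f \<noteq> \<one>\<^bsub>R P\<^esub>" using R_nontrivial P by blast
  obtain b where b: "b \<in> carrier G" "r P b = f [^]\<^bsub>R P\<^esub> N" "\<forall>Q\<in>Y. Q \<noteq> P \<longrightarrow> r Q b = \<one>\<^bsub>R Q\<^esub>"
    using concentrated[OF P(1) f(1)] by blast
  then have "r Q b = \<one>\<^bsub>R Q\<^esub>" using P(2) \<open>P \<noteq> Q\<close> by simp
  then have "b \<in> center P" "b \<notin> center Q"
    using b(1,2) R_pow_eq_one[OF P(1) f(1) _ N_pos] f by (auto simp: center_def)
  then show False using P by blast
qed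

lemma min_prime_set_iff: "min_prime_set Q \<longleftrightarrow> (\<exists>P\<in>Y. Q = center P)"
proof
  assume Q: "min_prime_set Q"
  then obtain z where "prime_set Q" "z \<in> Q" by (auto simp: min_prime_set_def)
  then obtain P where "P \<in> Y" "center P \<subseteq> Q"
    using prime_contains_center by blast
  then have "center P = Q"
    using Q center_prime[OF \<open>P \<in> Y\<close>] unfolding min_prime_set_def by blast
  then show "\<exists>P\<in>Y. Q = center P" using \<open>P \<in> Y\<close> by blast
next
  assume "\<exists>P\<in>Y. Q = center P"
  then obtain P where P: "P \<in> Y" "Q = center P" by blast
  have "P' = center P" if P': "prime_set P'" "P' \<noteq> {}" "P' \<subseteq> center P" for P'
  proof -
    obtain P'' where "P'' \<in> Y" "center P'' \<subseteq> P'" using prime_contains_center P' by blast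
    moreover then have "P'' = P" using P P' by (intro center_antichain) auto
    ultimately show ?thesis using P' by auto
  qed
  then show "min_prime_set Q" using P center_prime by (auto simp: min_prime_set_def)
qed

lemma components_weakly_krull: "weakly_krull G"
  unfolding weakly_krull_iff
proof (intro conjI ballI impI)
  fix a assume "a \<in> carrier G"
  have "{P. min_prime_set P \<and> a \<in> P} \<subseteq> center ` Y" by (auto simp: min_prime_set_iff)
  then show "finite {P. min_prime_set P \<and> a \<in> P}" using Y_finite by (meson finite_imageI finite_subset)
next
  fix a b assume ab: "a \<in> carrier G" "b \<in> carrier G"
    and loc: "\<forall>P. min_prime_set P \<longrightarrow> (\<exists>s\<in>carrier G - P. a divides s \<otimes> b)"
  show "a divides b"
    unfolding divides_iff[OF ab]
  proof
    fix P assume P: "P \<in> Y"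
    interpret R: comm_monoid_cancel "R P" by (rule R_cancel) fact
    have "min_prime_set (center P)" using P min_prime_set_iff by blast
    then obtain s where s: "s \<in> carrier G - center P" "a divides s \<otimes> b" using loc by blast
    then have "s \<in> carrier G" "r P s = \<one>\<^bsub>R P\<^esub>" by (auto simp: center_def)
    moreover then have "r P a divides\<^bsub>R P\<^esub> r P (s \<otimes> b)"
      using s ab P divides_iff[of a "s \<otimes> b"] by blast
    ultimately show "r P a divides\<^bsub>R P\<^esub> r P b" using P ab by simp
  qed
qed

end

section \<open>Factorization of invertible ideals\<close>

locale krull_family = primary_family G X R r
  for G :: "('a, 'm) monoid_scheme" (structure) and X :: "'i set"
    and R :: "'i \<Rightarrow> ('b, 'n) monoid_scheme" and r :: "'i \<Rightarrow> 'a \<Rightarrow> 'b" +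
  fixes Xd Xs :: "'i set" and p :: "'i \<Rightarrow> 'b"
  assumes X_split: "X = Xd \<union> Xs" and X_disjoint: "Xd \<inter> Xs = {}"
    and Xs_finite: "finite Xs"
    and p_closed [simp]: "P \<in> Xd \<Longrightarrow> p P \<in> carrier (R P)" and p_not_one: "P \<in> Xd \<Longrightarrow> p P \<noteq> \<one>\<^bsub>R P\<^esub>"
    and p_generates: "P \<in> Xd \<Longrightarrow> f \<in> carrier (R P) \<Longrightarrow> \<exists>n::nat. f = p P [^]\<^bsub>R P\<^esub> n"
begin

lemma in_X [simp]: "P \<in> Xd \<Longrightarrow> P \<in> X" "P \<in> Xs \<Longrightarrow> P \<in> X"
  using X_split by auto

lemma p_pow_divides:
  assumes P: "P \<in> Xd"
  shows "p P [^]\<^bsub>R P\<^esub> (m::nat) divides\<^bsub>R P\<^esub> p P [^]\<^bsub>R P\<^esub> (n::nat) \<longleftrightarrow> m \<le> n"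
proof -
  interpret R: comm_monoid_cancel "R P" using P by (intro R_cancel) simp
  show ?thesis
  proof
    assume "m \<le> n"
    then have "p P [^]\<^bsub>R P\<^esub> n = p P [^]\<^bsub>R P\<^esub> m \<otimes>\<^bsub>R P\<^esub> p P [^]\<^bsub>R P\<^esub> (n - m)"
      using P by (simp add: R.nat_pow_mult)
    then show "p P [^]\<^bsub>R P\<^esub> m divides\<^bsub>R P\<^esub> p P [^]\<^bsub>R P\<^esub> n" using P by auto
  next
    assume dv: "p P [^]\<^bsub>R P\<^esub> m divides\<^bsub>R P\<^esub> p P [^]\<^bsub>R P\<^esub> n"
    show "m \<le> n"
    proof (rule ccontr)
      assume "\<not> m \<le> n"
      then obtain k where k: "m = n + Suc k" using less_iff_Suc_add[of n m] by auto
      have "p P [^]\<^bsub>R P\<^esub> m = p P [^]\<^bsub>R P\<^esub> n \<otimes>\<^bsub>R P\<^esub> p P [^]\<^bsub>R P\<^esub> Suc k"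
        unfolding k using P R.nat_pow_mult[of "p P" n "Suc k"] by simp
      then have "p P [^]\<^bsub>R P\<^esub> n \<otimes>\<^bsub>R P\<^esub> p P [^]\<^bsub>R P\<^esub> Suc k divides\<^bsub>R P\<^esub> p P [^]\<^bsub>R P\<^esub> n \<otimes>\<^bsub>R P\<^esub> \<one>\<^bsub>R P\<^esub>"
        using dv P by simp
      then have "p P [^]\<^bsub>R P\<^esub> Suc k divides\<^bsub>R P\<^esub> \<one>\<^bsub>R P\<^esub>"
        using P R.divides_mult_l[of "p P [^]\<^bsub>R P\<^esub> Suc k" "\<one>\<^bsub>R P\<^esub>" "p P [^]\<^bsub>R P\<^esub> n"] by (simp del: R.nat_pow_Suc)
      then have "p P [^]\<^bsub>R P\<^esub> k \<otimes>\<^bsub>R P\<^esub> p P = \<one>\<^bsub>R P\<^esub>" using R_divides_one P by simp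
      then have "p P divides\<^bsub>R P\<^esub> \<one>\<^bsub>R P\<^esub>" using P R.m_comm[of "p P [^]\<^bsub>R P\<^esub> k" "p P"]
        by (auto simp: factor_def intro!: bexI[of _ "p P [^]\<^bsub>R P\<^esub> k"])
      then show False using R_divides_one P p_not_one by simp
    qed
  qed
qed

lemma p_pow_inj:
  assumes P: "P \<in> Xd" and eq: "p P [^]\<^bsub>R P\<^esub> (m::nat) = p P [^]\<^bsub>R P\<^esub> (n::nat)"
  shows "m = n"
proof (rule antisym)
  show "m \<le> n" unfolding p_pow_divides[OF P, symmetric] eq by (simp add: p_pow_divides[OF P])
  show "n \<le> m" unfolding p_pow_divides[OF P, symmetric] eq by (simp add: p_pow_divides[OF P])
qed

definition divisors :: "('i multiset \<times> ('i \<Rightarrow> 'b)) monoid" where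
  "divisors = free_abelian_monoid Xd \<times>\<times> product_group Xs R"

text \<open>This is the isomorphism from \<open>F(Xd) \<times> T\<close> to the families of local generators: at the discrete localizations the
  exponent of the prime gives the generator, at the finitely many others the component of \<open>T\<close>.\<close>

definition family_of :: "'i multiset \<times> ('i \<Rightarrow> 'b) \<Rightarrow> 'i \<Rightarrow> 'b" where
  "family_of d = (\<lambda>P\<in>X. if P \<in> Xd then p P [^]\<^bsub>R P\<^esub> count (fst d) P else snd d P)"

lemma divisors_carrier: "d \<in> carrier divisors \<longleftrightarrow> set_mset (fst d) \<subseteq> Xd \<and> snd d \<in> (\<Pi>\<^sub>E P\<in>Xs. carrier (R P))"
  by (cases d) (auto simp: divisors_def)

lemma divisors_mult: "d \<otimes>\<^bsub>divisors\<^esub> e = (fst d + fst e, \<lambda>P\<in>Xs. snd d P \<otimes>\<^bsub>R P\<^esub> snd e P)"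
  by (cases d, cases e) (simp add: divisors_def)

lemma divisors_one: "\<one>\<^bsub>divisors\<^esub> = ({#}, \<lambda>P\<in>Xs. \<one>\<^bsub>R P\<^esub>)"
  by (simp add: divisors_def)

lemma family_of_Xd [simp]: "P \<in> Xd \<Longrightarrow> family_of d P = p P [^]\<^bsub>R P\<^esub> count (fst d) P"
  by (simp add: family_of_def)

lemma family_of_Xs [simp]: "P \<in> Xs \<Longrightarrow> family_of d P = snd d P"
  using X_disjoint by (auto simp: family_of_def)

lemma family_of_closed:
  assumes d: "d \<in> carrier divisors"
  shows "family_of d \<in> families"
proof -
  have "{P \<in> X. family_of d P \<noteq> \<one>\<^bsub>R P\<^esub>} \<subseteq> set_mset (fst d) \<union> Xs"
  proof
    fix P assume P: "P \<in> {P \<in> X. family_of d P \<noteq> \<one>\<^bsub>R P\<^esub>}"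
    interpret R: comm_monoid_cancel "R P" using P by (intro R_cancel) simp
    show "P \<in> set_mset (fst d) \<union> Xs"
    proof (cases "P \<in> Xd")
      case True
      then have "count (fst d) P \<noteq> 0" using P by (intro notI) simp
      then show ?thesis by auto
    qed (use P X_split in auto)
  qed
  moreover have "family_of d \<in> (\<Pi>\<^sub>E P\<in>X. carrier (R P))"
  proof (rule PiE_I)
    fix P assume P: "P \<in> X"
    interpret R: comm_monoid_cancel "R P" using P by (intro R_cancel) simp
    consider "P \<in> Xd" | "P \<in> Xs" using P X_split by blast
    then show "family_of d P \<in> carrier (R P)"
      using d by cases (auto simp: divisors_carrier)
  qed (simp add: family_of_def)
  ultimately show ?thesis
    unfolding families_def using Xs_finite by (auto intro: finite_subset)
qed

lemma family_of_eq_iff: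
  assumes "d \<in> carrier divisors" "e \<in> carrier divisors"
  shows "family_of d = family_of e \<longleftrightarrow> d = e"
proof
  assume eq: "family_of d = family_of e"
  have "count (fst d) P = count (fst e) P" for P
  proof (cases "P \<in> Xd")
    case True
    then show ?thesis using fun_cong[OF eq, of P] p_pow_inj by simp
  next
    case False
    then have "P \<notin># fst d" "P \<notin># fst e" using assms by (auto simp: divisors_carrier)
    then show ?thesis by (simp add: not_in_iff)
  qed
  then have "fst d = fst e" by (rule multiset_eqI)
  moreover have "snd d = snd e"
  proof (rule PiE_ext)
    show "snd d \<in> (\<Pi>\<^sub>E P\<in>Xs. carrier (R P))" "snd e \<in> (\<Pi>\<^sub>E P\<in>Xs. carrier (R P))"
      using assms by (auto simp: divisors_carrier)
    show "snd d P = snd e P" if "P \<in> Xs" for P using fun_cong[OF eq, of P] that by simp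
  qed
  ultimately show "d = e" by (simp add: prod_eq_iff)
qed simp

lemma family_of_surj:
  assumes f: "f \<in> families"
  shows "\<exists>d\<in>carrier divisors. f = family_of d"
proof -
  define n where "n P = (if P \<in> Xd \<and> f P \<noteq> \<one>\<^bsub>R P\<^esub> then (SOME n::nat. f P = p P [^]\<^bsub>R P\<^esub> n) else 0)" for P
  have n: "f P = p P [^]\<^bsub>R P\<^esub> n P" if P: "P \<in> Xd" for P
  proof -
    interpret R: comm_monoid_cancel "R P" using P by (intro R_cancel) simp
    show ?thesis
    proof (cases "f P = \<one>\<^bsub>R P\<^esub>")
      case False
      have "\<exists>n::nat. f P = p P [^]\<^bsub>R P\<^esub> n" using f P by (intro p_generates) simp_all
      then have "f P = p P [^]\<^bsub>R P\<^esub> (SOME n::nat. f P = p P [^]\<^bsub>R P\<^esub> n)" by (rule someI_ex)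
      then show ?thesis using False P by (simp add: n_def)
    qed (simp add: n_def)
  qed
  have "{P. 0 < n P} \<subseteq> {P \<in> X. f P \<noteq> \<one>\<^bsub>R P\<^esub>}" by (auto simp: n_def split: if_splits)
  then have "finite {P. 0 < n P}" using f by (auto simp: families_def intro: finite_subset)
  then have count: "count (Abs_multiset n) = n" by (simp add: count_Abs_multiset)
  define d where "d = (Abs_multiset n, restrict f Xs)"
  have "set_mset (Abs_multiset n) \<subseteq> Xd"
    unfolding set_mset_def count by (auto simp: n_def split: if_splits)
  then have "d \<in> carrier divisors" using f by (auto simp: d_def divisors_carrier)
  moreover have "f = family_of d"
  proof (rule PiE_ext)
    show "f \<in> (\<Pi>\<^sub>E P\<in>X. carrier (R P))" "family_of d \<in> (\<Pi>\<^sub>E P\<in>X. carrier (R P))"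
      using f family_of_closed[OF \<open>d \<in> _\<close>] by (auto simp: families_def)
    fix P assume "P \<in> X"
    then consider "P \<in> Xd" | "P \<in> Xs" using X_split by blast
    then show "f P = family_of d P" by cases (simp_all add: n d_def count)
  qed
  ultimately show ?thesis by blast
qed

lemma family_of_mult:
  assumes "d \<in> carrier divisors" "e \<in> carrier divisors"
  shows "family_of (d \<otimes>\<^bsub>divisors\<^esub> e) = (\<lambda>P\<in>X. family_of d P \<otimes>\<^bsub>R P\<^esub> family_of e P)"
proof (rule ext)
  fix P
  show "family_of (d \<otimes>\<^bsub>divisors\<^esub> e) P = (\<lambda>P\<in>X. family_of d P \<otimes>\<^bsub>R P\<^esub> family_of e P) P"
  proof (cases "P \<in> X")
    case True
    interpret R: comm_monoid_cancel "R P" using True by (intro R_cancel) simp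
    consider "P \<in> Xd" | "P \<in> Xs" using X_split True by blast
    then show ?thesis by cases (simp_all add: divisors_mult R.nat_pow_mult)
  qed (simp add: family_of_def)
qed

lemma family_of_one: "family_of \<one>\<^bsub>divisors\<^esub> = (\<lambda>P\<in>X. \<one>\<^bsub>R P\<^esub>)"
proof (rule ext)
  fix P show "family_of \<one>\<^bsub>divisors\<^esub> P = (\<lambda>P\<in>X. \<one>\<^bsub>R P\<^esub>) P"
  proof (cases "P \<in> X")
    case True
    interpret R: comm_monoid_cancel "R P" using True by (intro R_cancel) simp
    consider "P \<in> Xd" | "P \<in> Xs" using X_split True by blast
    then show ?thesis by cases (simp_all add: divisors_one)
  qed (simp add: family_of_def)
qed

lemma T_cancel: "comm_monoid_cancel (product_group Xs R)"
proof (rule comm_monoid_cancelI)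
  have R: "comm_monoid_cancel (R P)" if "P \<in> Xs" for P using that by (intro R_cancel) simp
  then have M: "comm_monoid (R P)" "monoid (R P)" if "P \<in> Xs" for P
    using that by (auto simp: comm_monoid_cancel_def comm_monoid_def)
  show "comm_monoid (product_group Xs R)"
    by (rule comm_monoidI)
       (auto simp: PiE_iff fun_eq_iff extensional_def M monoid.m_closed[OF M(2)] monoid.one_closed[OF M(2)]
          comm_monoid.m_ac[OF M(1)] monoid.l_one[OF M(2)])
  fix s t u
  assume eq: "s \<otimes>\<^bsub>product_group Xs R\<^esub> u = t \<otimes>\<^bsub>product_group Xs R\<^esub> u"
    and c: "s \<in> carrier (product_group Xs R)" "t \<in> carrier (product_group Xs R)" "u \<in> carrier (product_group Xs R)"
  show "s = t"
  proof (rule PiE_ext)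
    show "s \<in> (\<Pi>\<^sub>E P\<in>Xs. carrier (R P))" "t \<in> (\<Pi>\<^sub>E P\<in>Xs. carrier (R P))" using c by auto
    fix P assume P: "P \<in> Xs"
    interpret R: comm_monoid_cancel "R P" using P by (rule R)
    show "s P = t P" using fun_cong[OF eq, of P] P c R.r_cancel[of "s P" "u P" "t P"] by (auto simp: PiE_iff)
  qed
qed

lemma divisors_cancel: "comm_monoid_cancel divisors"
proof -
  interpret F: comm_monoid_cancel "free_abelian_monoid Xd" by (rule free_abelian_cancel)
  interpret T: comm_monoid_cancel "product_group Xs R" by (rule T_cancel)
  show ?thesis
  proof (rule comm_monoid_cancelI)
    show "comm_monoid divisors"
      unfolding divisors_def
      by (rule comm_monoidI) (auto simp del: mult_product_group one_product_group carrier_product_group simp: T.m_ac ac_simps)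
    fix a b c assume "a \<otimes>\<^bsub>divisors\<^esub> c = b \<otimes>\<^bsub>divisors\<^esub> c" "a \<in> carrier divisors" "b \<in> carrier divisors" "c \<in> carrier divisors"
    then show "a = b"
      unfolding divisors_def by (auto simp del: mult_product_group one_product_group carrier_product_group dest: T.r_cancel)
  qed
qed

end

lemma comm_monoid_cancel_transport:
  assumes D: "comm_monoid_cancel D" and h: "bij_betw h (carrier D) (carrier I)"
    and mult: "\<And>x y. x \<in> carrier D \<Longrightarrow> y \<in> carrier D \<Longrightarrow> h (x \<otimes>\<^bsub>D\<^esub> y) = h x \<otimes>\<^bsub>I\<^esub> h y"
    and one: "h \<one>\<^bsub>D\<^esub> = \<one>\<^bsub>I\<^esub>"
  shows "comm_monoid_cancel I"
proof -
  interpret D: comm_monoid_cancel D by (rule D)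
  have inj: "inj_on h (carrier D)" using h by (rule bij_betw_imp_inj_on)
  have C: "carrier I = h ` carrier D" using h by (simp add: bij_betw_def)
  show ?thesis
  proof (rule comm_monoid_cancelI)
    show "comm_monoid I"
      by (rule comm_monoidI) (auto simp: C mult[symmetric] one[symmetric] D.m_ac)
    fix a b c assume "a \<otimes>\<^bsub>I\<^esub> c = b \<otimes>\<^bsub>I\<^esub> c" "a \<in> carrier I" "b \<in> carrier I" "c \<in> carrier I"
    then obtain x y z where xyz: "x \<in> carrier D" "y \<in> carrier D" "z \<in> carrier D" "a = h x" "b = h y" "c = h z"
      and "h (x \<otimes>\<^bsub>D\<^esub> z) = h (y \<otimes>\<^bsub>D\<^esub> z)"
      by (auto simp: C mult)
    then have "x \<otimes>\<^bsub>D\<^esub> z = y \<otimes>\<^bsub>D\<^esub> z" using inj by (auto dest: inj_onD)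
    then show "a = b" using xyz D.r_cancel by blast
  qed
qed

lemma image_mset_surj:
  assumes "f ` A = B" "set_mset S \<subseteq> B"
  shows "\<exists>T. set_mset T \<subseteq> A \<and> S = image_mset f T"
proof (intro exI conjI)
  have "image_mset (\<lambda>x. f (inv_into A f x)) S = image_mset (\<lambda>x. x) S"
    using assms by (intro image_mset_cong f_inv_into_f) auto
  then show "S = image_mset f (image_mset (inv_into A f) S)"
    by (simp add: image_mset.compositionality comp_def)
  show "set_mset (image_mset (inv_into A f) S) \<subseteq> A" using assms by (auto intro: inv_into_into)
qed

lemma image_mset_free_abelian:
  assumes "f ` A = B"
  shows "image_mset f ` carrier (free_abelian_monoid A) = carrier (free_abelian_monoid B)"
proof (intro equalityI subsetI)
  fix S assume "S \<in> carrier (free_abelian_monoid B)"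
  then obtain T where "set_mset T \<subseteq> A" "S = image_mset f T"
    using image_mset_surj[OF assms, of S] by auto
  then show "S \<in> image_mset f ` carrier (free_abelian_monoid A)" by simp
next
  fix S assume "S \<in> image_mset f ` carrier (free_abelian_monoid A)"
  then obtain T where "set_mset T \<subseteq> A" "S = image_mset f T" by auto
  then have "set_mset S \<subseteq> f ` A" by auto
  then show "S \<in> carrier (free_abelian_monoid B)" by (simp add: assms)
qed

context krull_family
begin

text \<open>The element of \<open>F(Xd) \<times> T\<close> that corresponds to the principal ideal \<open>aH\<close>.\<close>

definition div_of :: "'a \<Rightarrow> 'i multiset \<times> ('i \<Rightarrow> 'b)" where
  "div_of a = (SOME d. d \<in> carrier divisors \<and> family_of d = (\<lambda>P\<in>X. r P a))"

lemma div_of: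
  assumes "a \<in> carrier G"
  shows "div_of a \<in> carrier divisors" "family_of (div_of a) = (\<lambda>P\<in>X. r P a)"
proof -
  have "\<exists>d. d \<in> carrier divisors \<and> family_of d = (\<lambda>P\<in>X. r P a)"
    using family_of_surj[OF principal_family[OF assms]] by metis
  from someI_ex[OF this] show "div_of a \<in> carrier divisors" "family_of (div_of a) = (\<lambda>P\<in>X. r P a)"
    by (auto simp: div_of_def)
qed

lemma div_of_hom: "monoid_hom G divisors div_of"
proof (rule monoid_homI)
  interpret D: comm_monoid_cancel divisors by (rule divisors_cancel)
  fix x y assume xy: "x \<in> carrier G" "y \<in> carrier G"
  have "family_of (div_of (x \<otimes> y)) = family_of (div_of x \<otimes>\<^bsub>divisors\<^esub> div_of y)"
    using xy by (auto simp: div_of family_of_mult intro!: restrict_ext)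
  then show "div_of (x \<otimes> y) = div_of x \<otimes>\<^bsub>divisors\<^esub> div_of y"
    by (rule family_of_eq_iff[THEN iffD1, rotated 2]) (use xy in \<open>simp_all add: div_of(1)\<close>)
next
  interpret D: comm_monoid_cancel divisors by (rule divisors_cancel)
  have "family_of (div_of \<one>) = family_of \<one>\<^bsub>divisors\<^esub>"
    by (auto simp: div_of family_of_one intro!: restrict_ext)
  then show "div_of \<one> = \<one>\<^bsub>divisors\<^esub>"
    by (rule family_of_eq_iff[THEN iffD1, rotated 2]) (simp_all add: div_of(1))
qed (rule div_of)

lemma div_of_divides:
  assumes a: "a \<in> carrier G" and b: "b \<in> carrier G" and d: "d \<in> carrier divisors"
    and eq: "div_of b = div_of a \<otimes>\<^bsub>divisors\<^esub> d"
  shows "a divides b"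
  unfolding divides_iff[OF a b]
proof
  fix P assume P: "P \<in> X"
  have "family_of (div_of b) P = family_of (div_of a) P \<otimes>\<^bsub>R P\<^esub> family_of d P"
    unfolding eq family_of_mult[OF div_of(1)[OF a] d] using P by simp
  then show "r P a divides\<^bsub>R P\<^esub> r P b"
    using P a b family_of_closed[OF d] by (auto simp: div_of)
qed

lemma div_of_eq_associated:
  assumes "a \<in> carrier G" "b \<in> carrier G" "div_of a = div_of b"
  shows "a \<sim> b"
proof -
  interpret D: comm_monoid_cancel divisors by (rule divisors_cancel)
  have "a divides b" "b divides a"
    using assms div_of by (auto intro!: div_of_divides[where d = "\<one>\<^bsub>divisors\<^esub>"])
  then show ?thesis by (simp add: associated_def)
qed

definition div_ideal :: "'i multiset \<times> ('i \<Rightarrow> 'b) \<Rightarrow> 'a fraction set" where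
  "div_ideal d = emb G ` ideal_of (family_of d)"

lemma div_ideal_bij: "bij_betw div_ideal (carrier divisors) (carrier (v_invertible_ideals G))"
  unfolding bij_betw_def
proof
  show "inj_on div_ideal (carrier divisors)"
  proof (rule inj_onI)
    fix d e assume d: "d \<in> carrier divisors" and e: "e \<in> carrier divisors" and "div_ideal d = div_ideal e"
    then have "ideal_of (family_of d) = ideal_of (family_of e)"
      unfolding div_ideal_def using ideal_of_subset by (subst (asm) emb_image_eq_iff) auto
    then have "family_of d = family_of e" using d e family_of_closed by (intro ideal_of_inj) auto
    then show "d = e" using d e by (simp add: family_of_eq_iff)
  qed
  show "div_ideal ` carrier divisors = carrier (v_invertible_ideals G)"
    unfolding v_invertible_carrier div_ideal_def using family_of_closed family_of_surj by blast
qed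

lemma div_ideal_mult:
  "d \<in> carrier divisors \<Longrightarrow> e \<in> carrier divisors \<Longrightarrow>
     div_ideal (d \<otimes>\<^bsub>divisors\<^esub> e) = div_ideal d \<otimes>\<^bsub>v_invertible_ideals G\<^esub> div_ideal e"
  by (simp add: div_ideal_def family_of_mult family_of_closed v_mult_ideal_of v_invertible_ideals_def)

lemma div_ideal_one: "div_ideal \<one>\<^bsub>divisors\<^esub> = \<one>\<^bsub>v_invertible_ideals G\<^esub>"
proof -
  have "ideal_of (\<lambda>P\<in>X. \<one>\<^bsub>R P\<^esub>) = carrier G" by (auto simp: ideal_of_def R_one_divides)
  then show ?thesis by (simp add: div_ideal_def family_of_one v_invertible_ideals_def base_def)
qed

lemma div_ideal_hom: "monoid_hom divisors (v_invertible_ideals G) div_ideal"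
  using div_ideal_bij by (intro monoid_homI div_ideal_mult div_ideal_one) (auto simp: bij_betw_def)

lemma v_invertible_cancel: "comm_monoid_cancel (v_invertible_ideals G)"
  by (rule comm_monoid_cancel_transport[OF divisors_cancel div_ideal_bij div_ideal_mult div_ideal_one])

lemma div_ideal_principal: "a \<in> carrier G \<Longrightarrow> principal_ideal G a = div_ideal (div_of a)"
  by (simp add: div_ideal_def div_of principal_ideal_of)

lemma div_ideal_prime:
  assumes P: "P \<in> Xd"
  shows "div_ideal ({#P#}, \<lambda>P\<in>Xs. \<one>\<^bsub>R P\<^esub>) = emb G ` {x \<in> carrier G. r P x \<noteq> \<one>\<^bsub>R P\<^esub>}"
proof -
  interpret R: comm_monoid_cancel "R P" using P by (intro R_cancel) simp
  have "family_of ({#P#}, \<lambda>P\<in>Xs. \<one>\<^bsub>R P\<^esub>) Q divides\<^bsub>R Q\<^esub> r Q x" if Q: "Q \<in> X" "Q \<noteq> P" "x \<in> carrier G" for x Q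
  proof -
    interpret R': comm_monoid_cancel "R Q" using Q by (intro R_cancel) simp
    have "family_of ({#P#}, \<lambda>P\<in>Xs. \<one>\<^bsub>R P\<^esub>) Q = \<one>\<^bsub>R Q\<^esub>"
    proof -
      consider "Q \<in> Xd" | "Q \<in> Xs" using Q X_split by blast
      then show ?thesis using Q by cases auto
    qed
    then show ?thesis using Q by (simp add: R_one_divides)
  qed
  then have "ideal_of (family_of ({#P#}, \<lambda>P\<in>Xs. \<one>\<^bsub>R P\<^esub>)) = {x \<in> carrier G. p P divides\<^bsub>R P\<^esub> r P x}"
    using P unfolding ideal_of_def by (intro Collect_cong conj_cong refl) (metis R.nat_pow_eone count_single family_of_Xd fst_conv in_X(1) p_closed)
  also have "\<dots> = {x \<in> carrier G. r P x \<noteq> \<one>\<^bsub>R P\<^esub>}"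
  proof (intro Collect_cong conj_cong refl)
    fix x assume x: "x \<in> carrier G"
    obtain n where n: "r P x = p P [^]\<^bsub>R P\<^esub> (n::nat)" using p_generates[OF P, of "r P x"] P x by auto
    show "p P divides\<^bsub>R P\<^esub> r P x \<longleftrightarrow> r P x \<noteq> \<one>\<^bsub>R P\<^esub>"
      using p_pow_divides[OF P, of 1 n] p_pow_inj[OF P, of n 0] P by (cases "n = 0") (auto simp: n)
  qed
  finally show ?thesis by (simp add: div_ideal_def)
qed

end

text \<open>\<open>\<kappa>\<close> is the class map on \<open>F(Xd) \<times> T\<close>, and its kernel consists of the principal divisors. In the application, \<open>C\<close>
  is the \<open>v\<close>-class group and \<open>\<iota>\<close> the canonical homomorphism.\<close>

locale krull_class = krull_family G X R r Xd Xs p + C: comm_group C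
  for G :: "('a, 'm) monoid_scheme" (structure) and X :: "'i set"
    and R :: "'i \<Rightarrow> ('b, 'n) monoid_scheme" and r :: "'i \<Rightarrow> 'a \<Rightarrow> 'b"
    and Xd Xs :: "'i set" and p :: "'i \<Rightarrow> 'b" and C :: "('c, 'k) monoid_scheme" +
  fixes \<kappa> :: "'i multiset \<times> ('i \<Rightarrow> 'b) \<Rightarrow> 'c" and \<iota> :: "('i \<Rightarrow> 'b) \<Rightarrow> 'c"
  assumes C_finite: "finite (carrier C)"
    and \<kappa>_hom: "monoid_hom divisors C \<kappa>"
    and \<kappa>_one: "d \<in> carrier divisors \<Longrightarrow> \<kappa> d = \<one>\<^bsub>C\<^esub> \<longleftrightarrow> d \<in> div_of ` carrier G"
    and \<iota>: "t \<in> carrier (product_group Xs R) \<Longrightarrow> \<iota> t = \<kappa> ({#}, t)"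
begin

abbreviation "T \<equiv> product_group Xs R"

definition prime_class where "prime_class P = \<kappa> ({#P#}, \<one>\<^bsub>T\<^esub>)"

interpretation T: comm_monoid_cancel T by (rule T_cancel)

lemma pair_in_divisors [simp]: "(S, t) \<in> carrier divisors \<longleftrightarrow> set_mset S \<subseteq> Xd \<and> t \<in> carrier T"
  by (simp add: divisors_def)

lemma pair_mult [simp]: "(S, t) \<otimes>\<^bsub>divisors\<^esub> (S', t') = (S + S', t \<otimes>\<^bsub>T\<^esub> t')"
  by (simp add: divisors_def)

lemma pair_one: "\<one>\<^bsub>divisors\<^esub> = ({#}, \<one>\<^bsub>T\<^esub>)"
  by (simp add: divisors_def)

declare carrier_product_group [simp del] mult_product_group [simp del] one_product_group [simp del]

lemma prime_class_closed [simp]: "P \<in> Xd \<Longrightarrow> prime_class P \<in> carrier C"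
  unfolding prime_class_def by (rule monoid_homD[OF \<kappa>_hom]) simp

lemma \<iota>_hom: "monoid_hom T C \<iota>"
proof (rule monoid_homI)
  fix s t assume st: "s \<in> carrier T" "t \<in> carrier T"
  then show "\<iota> s \<in> carrier C" using monoid_homD(1)[OF \<kappa>_hom] by (simp add: \<iota>)
  have "\<kappa> (({#}, s) \<otimes>\<^bsub>divisors\<^esub> ({#}, t)) = \<kappa> ({#}, s) \<otimes>\<^bsub>C\<^esub> \<kappa> ({#}, t)"
    using st by (intro monoid_homD(2)[OF \<kappa>_hom]) simp_all
  then show "\<iota> (s \<otimes>\<^bsub>T\<^esub> t) = \<iota> s \<otimes>\<^bsub>C\<^esub> \<iota> t" using st by (simp add: \<iota>)
qed (use monoid_homD(3)[OF \<kappa>_hom] in \<open>simp add: \<iota> pair_one\<close>)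

lemma \<kappa>_eq:
  assumes "set_mset S \<subseteq> Xd" "t \<in> carrier T"
  shows "\<kappa> (S, t) = seq_sum C (image_mset prime_class S) \<otimes>\<^bsub>C\<^esub> \<iota> t"
  using assms(1)
proof (induction S)
  case empty
  then show ?case using assms(2) monoid_homD(1)[OF \<iota>_hom] by (simp add: \<iota>)
next
  case (add P S)
  have "\<kappa> (({#P#}, \<one>\<^bsub>T\<^esub>) \<otimes>\<^bsub>divisors\<^esub> (S, t)) = prime_class P \<otimes>\<^bsub>C\<^esub> \<kappa> (S, t)"
    unfolding prime_class_def using add.prems assms(2) by (intro monoid_homD(2)[OF \<kappa>_hom]) simp_all
  then have "\<kappa> (add_mset P S, t) = prime_class P \<otimes>\<^bsub>C\<^esub> \<kappa> (S, t)" using assms(2) by simp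
  moreover have "set_mset (image_mset prime_class S) \<subseteq> carrier C" using add.prems by auto
  ultimately show ?case
    using add monoid_homD(1)[OF \<iota>_hom assms(2)] by (simp add: C.m_assoc del: set_image_mset)
qed

section \<open>The \<open>T\<close>-block monoid\<close>

abbreviation "B \<equiv> T_block_monoid C (prime_class ` Xd) T \<iota>"

lemma B_simps [simp]:
  "(S, t) \<in> carrier B \<longleftrightarrow> set_mset S \<subseteq> prime_class ` Xd \<and> t \<in> carrier T \<and> seq_sum C S \<otimes>\<^bsub>C\<^esub> \<iota> t = \<one>\<^bsub>C\<^esub>"
  "mult B = mult (free_abelian_monoid (prime_class ` Xd) \<times>\<times> T)"
  "\<one>\<^bsub>B\<^esub> = ({#}, \<one>\<^bsub>T\<^esub>)"
  by (auto simp: T_block_monoid_def)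

lemma classes_closed: "set_mset S \<subseteq> prime_class ` Xd \<Longrightarrow> set_mset S \<subseteq> carrier C"
  by auto

lemma B_class_mult:
  assumes "set_mset S \<subseteq> prime_class ` Xd" "set_mset S' \<subseteq> prime_class ` Xd" "t \<in> carrier T" "t' \<in> carrier T"
  shows "seq_sum C (S + S') \<otimes>\<^bsub>C\<^esub> \<iota> (t \<otimes>\<^bsub>T\<^esub> t') =
    (seq_sum C S \<otimes>\<^bsub>C\<^esub> \<iota> t) \<otimes>\<^bsub>C\<^esub> (seq_sum C S' \<otimes>\<^bsub>C\<^esub> \<iota> t')"
  using assms(3,4) monoid_homD[OF \<iota>_hom] classes_closed[OF assms(1)] classes_closed[OF assms(2)]
  by (simp add: C.m_ac)

lemma B_cancel: "comm_monoid_cancel B"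
proof (rule comm_monoid_cancelI)
  have closed: "x \<otimes>\<^bsub>B\<^esub> y \<in> carrier B" if "x \<in> carrier B" "y \<in> carrier B" for x y
    using that by (cases x, cases y) (auto simp: B_class_mult)
  show "comm_monoid B"
  proof (rule comm_monoidI)
    show "\<one>\<^bsub>B\<^esub> \<in> carrier B" using monoid_homD[OF \<iota>_hom] by simp
    fix x y z assume "x \<in> carrier B" "y \<in> carrier B" "z \<in> carrier B"
    then show "x \<otimes>\<^bsub>B\<^esub> y \<otimes>\<^bsub>B\<^esub> z = x \<otimes>\<^bsub>B\<^esub> (y \<otimes>\<^bsub>B\<^esub> z)"
      by (cases x, cases y, cases z) (simp add: T.m_assoc)
  next
    fix x y assume "x \<in> carrier B" "y \<in> carrier B"
    then show "x \<otimes>\<^bsub>B\<^esub> y = y \<otimes>\<^bsub>B\<^esub> x" by (cases x, cases y) (simp add: T.m_comm)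
  next
    fix x assume "x \<in> carrier B"
    then show "\<one>\<^bsub>B\<^esub> \<otimes>\<^bsub>B\<^esub> x = x" by (cases x) simp
  qed (rule closed)
  fix x y z assume "x \<otimes>\<^bsub>B\<^esub> z = y \<otimes>\<^bsub>B\<^esub> z" "x \<in> carrier B" "y \<in> carrier B" "z \<in> carrier B"
  then show "x = y" by (cases x, cases y, cases z) (auto dest: T.r_cancel)
qed

lemma T_mult_eq_one:
  assumes st: "s \<in> carrier T" "t \<in> carrier T" and eq: "s \<otimes>\<^bsub>T\<^esub> t = \<one>\<^bsub>T\<^esub>"
  shows "s = \<one>\<^bsub>T\<^esub>"
proof -
  have "s P = \<one>\<^bsub>R P\<^esub>" if P: "P \<in> Xs" for P
  proof -
    interpret R: comm_monoid_cancel "R P" using P by (intro R_cancel) simp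
    have c: "s P \<in> carrier (R P)" "t P \<in> carrier (R P)" using st P by (auto simp: carrier_product_group)
    have "s P \<otimes>\<^bsub>R P\<^esub> t P = \<one>\<^bsub>R P\<^esub>"
      using fun_cong[OF eq, of P] P by (simp add: mult_product_group one_product_group)
    then have "s P divides\<^bsub>R P\<^esub> \<one>\<^bsub>R P\<^esub>" using c by (auto simp: factor_def intro!: bexI[of _ "t P"])
    then show ?thesis using R_divides_one c P by simp
  qed
  then show ?thesis
    using st(1) by (auto simp: carrier_product_group one_product_group PiE_iff extensional_def fun_eq_iff)
qed

lemma B_Units: "Units B = {\<one>\<^bsub>B\<^esub>}"
proof -
  interpret B: comm_monoid_cancel B by (rule B_cancel)
  have "x = \<one>\<^bsub>B\<^esub>" if "x \<in> Units B" for x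
  proof -
    from that obtain y where "x \<in> carrier B" "y \<in> carrier B" "x \<otimes>\<^bsub>B\<^esub> y = \<one>\<^bsub>B\<^esub>"
      unfolding Units_def by blast
    then show ?thesis
      by (cases x, cases y) (auto intro: T_mult_eq_one)
  qed
  then show ?thesis using B.Units_one_closed by blast
qed

text \<open>A section of \<open>prime_class\<close>: the exponents of the classes in a sequence are read off at one prime
  per class, so that the block monoid gets its components from the family of \<open>H\<close>.\<close>

definition rep :: "'c \<Rightarrow> 'i" where "rep = inv_into Xd prime_class"

definition comp :: "'i \<Rightarrow> 'c multiset \<times> ('i \<Rightarrow> 'b) \<Rightarrow> 'b" where
  "comp P b = (if P \<in> Xd then p P [^]\<^bsub>R P\<^esub> count (fst b) (prime_class P) else snd b P)"

lemma rep: "g \<in> prime_class ` Xd \<Longrightarrow> rep g \<in> Xd \<and> prime_class (rep g) = g"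
  unfolding rep_def by (simp add: inv_into_into f_inv_into_f)

lemma comp_hom:
  assumes P: "P \<in> rep ` prime_class ` Xd \<union> Xs"
  shows "monoid_hom B (R P) (comp P)"
proof (rule monoid_homI)
  have PX: "P \<in> X" using P rep by auto
  interpret R: comm_monoid_cancel "R P" using PX by (rule R_cancel)
  have cases: "P \<in> Xd \<or> P \<notin> Xd \<and> P \<in> Xs" using P rep by auto
  fix x y assume "x \<in> carrier B" "y \<in> carrier B"
  then show "comp P x \<in> carrier (R P)" "comp P (x \<otimes>\<^bsub>B\<^esub> y) = comp P x \<otimes>\<^bsub>R P\<^esub> comp P y"
    using cases
    by (cases x, cases y; auto simp: comp_def R.nat_pow_mult carrier_product_group mult_product_group)+
next
  have PX: "P \<in> X" using P rep by auto
  interpret R: comm_monoid_cancel "R P" using PX by (rule R_cancel)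
  have cases: "P \<in> Xd \<or> P \<notin> Xd \<and> P \<in> Xs" using P rep by auto
  then show "comp P \<one>\<^bsub>B\<^esub> = \<one>\<^bsub>R P\<^esub>" by (auto simp: comp_def one_product_group)
qed

text \<open>Componentwise divisibility gives a quotient in \<open>F(G\<^sub>0) \<times> T\<close>, and its class is the quotient of two trivial classes.\<close>

lemma B_divides:
  assumes x: "x \<in> carrier B" and y: "y \<in> carrier B"
    and comp: "\<And>P. P \<in> rep ` prime_class ` Xd \<union> Xs \<Longrightarrow> comp P x divides\<^bsub>R P\<^esub> comp P y"
  shows "x divides\<^bsub>B\<^esub> y"
proof -
  obtain S t S' t' where xy: "x = (S, t)" "y = (S', t')" by (cases x, cases y) auto
  note S = x[unfolded xy B_simps(1)] and S' = y[unfolded xy B_simps(1)]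
  have "count S g \<le> count S' g" for g
  proof (cases "g \<in> prime_class ` Xd")
    case True
    note g = rep[OF True]
    then have "comp (rep g) x divides\<^bsub>R (rep g)\<^esub> comp (rep g) y" using comp True by blast
    then show ?thesis using g p_pow_divides[of "rep g"] by (simp add: comp_def xy)
  next
    case False
    then have "g \<notin># S" using S by blast
    then show ?thesis by (simp add: not_in_iff)
  qed
  then have "S \<subseteq># S'" by (rule mset_subset_eqI)
  then obtain U where U: "S' = S + U" by (auto simp: subset_mset.le_iff_add)
  have "\<forall>P\<in>Xs. \<exists>u. u \<in> carrier (R P) \<and> t' P = t P \<otimes>\<^bsub>R P\<^esub> u"
  proof
    fix P assume P: "P \<in> Xs"
    then have "P \<notin> Xd" using X_disjoint by blast
    then have "t P divides\<^bsub>R P\<^esub> t' P" using comp[of P] P by (simp add: comp_def xy)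
    then show "\<exists>u. u \<in> carrier (R P) \<and> t' P = t P \<otimes>\<^bsub>R P\<^esub> u" by (auto simp: factor_def)
  qed
  from bchoice[OF this] obtain u where u: "\<And>P. P \<in> Xs \<Longrightarrow> u P \<in> carrier (R P) \<and> t' P = t P \<otimes>\<^bsub>R P\<^esub> u P" by blast
  define v where "v = restrict u Xs"
  have v: "v \<in> carrier T" using u by (auto simp: v_def carrier_product_group)
  have "t' = t \<otimes>\<^bsub>T\<^esub> v"
    using S' u by (auto simp: v_def mult_product_group carrier_product_group PiE_iff extensional_def fun_eq_iff)
  have "set_mset U \<subseteq> prime_class ` Xd" using S' U by auto
  have "(seq_sum C S \<otimes>\<^bsub>C\<^esub> \<iota> t) \<otimes>\<^bsub>C\<^esub> (seq_sum C U \<otimes>\<^bsub>C\<^esub> \<iota> v) = \<one>\<^bsub>C\<^esub>"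
    using S S' B_class_mult[of S U t v] \<open>set_mset U \<subseteq> _\<close> v \<open>t' = _\<close> U by simp
  then have "seq_sum C U \<otimes>\<^bsub>C\<^esub> \<iota> v = \<one>\<^bsub>C\<^esub>"
    using S classes_closed[OF \<open>set_mset U \<subseteq> _\<close>] monoid_homD(1)[OF \<iota>_hom v] by simp
  then have "(U, v) \<in> carrier B" using v \<open>set_mset U \<subseteq> _\<close> by simp
  moreover have "y = x \<otimes>\<^bsub>B\<^esub> (U, v)" using xy U \<open>t' = _\<close> by simp
  ultimately show ?thesis by (auto simp: factor_def)
qed

text \<open>Every class becomes trivial in the power given by the order of the class group.\<close>

lemma B_concentrated:
  assumes P: "P \<in> rep ` prime_class ` Xd \<union> Xs" and f: "f \<in> carrier (R P)"
  shows "\<exists>b\<in>carrier B. comp P b = f [^]\<^bsub>R P\<^esub> order C \<and>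
    (\<forall>Q\<in>rep ` prime_class ` Xd \<union> Xs. Q \<noteq> P \<longrightarrow> comp Q b = \<one>\<^bsub>R Q\<^esub>)"
proof -
  have PX: "P \<in> X" using P rep by auto
  interpret R: comm_monoid_cancel "R P" using PX by (rule R_cancel)
  consider g where "g \<in> prime_class ` Xd" "P = rep g" | "P \<in> Xs" "P \<notin> Xd" using P X_disjoint by blast
  then show ?thesis
  proof cases
    case 1
    note g = rep[OF 1(1)]
    obtain k where k: "f = p P [^]\<^bsub>R P\<^esub> (k::nat)" using p_generates[of P f] g 1 f by auto
    let ?b = "(replicate_mset (k * order C) g, \<one>\<^bsub>T\<^esub>)"
    have gC: "g \<in> carrier C" using 1 by auto
    have "g [^]\<^bsub>C\<^esub> (k * order C) = (g [^]\<^bsub>C\<^esub> order C) [^]\<^bsub>C\<^esub> k" using gC by (simp add: C.nat_pow_pow mult.commute)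
    also have "\<dots> = \<one>\<^bsub>C\<^esub>" using gC by (simp add: C.pow_order_eq_1)
    finally have "?b \<in> carrier B"
      using 1 gC monoid_homD(3)[OF \<iota>_hom] by (auto simp: in_replicate_mset)
    moreover have "comp P ?b = f [^]\<^bsub>R P\<^esub> order C"
    proof -
      have "p P \<in> carrier (R P)" using g 1 by simp
      then show ?thesis using g 1(2) k R.nat_pow_pow[of "p P" k "order C"] by (simp add: comp_def)
    qed
    moreover have "comp Q ?b = \<one>\<^bsub>R Q\<^esub>" if Q: "Q \<in> rep ` prime_class ` Xd \<union> Xs" "Q \<noteq> P" for Q
    proof (cases "Q \<in> Xd")
      case True
      interpret R': comm_monoid_cancel "R Q" using True by (intro R_cancel) simp
      obtain h where h: "h \<in> prime_class ` Xd" "Q = rep h" using Q True X_disjoint by blast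
      then have "prime_class Q \<noteq> g" using rep[of h] Q 1 by auto
      then show ?thesis using True by (simp add: comp_def)
    next
      case False
      then have "Q \<in> Xs" using Q rep by auto
      then show ?thesis using False by (simp add: comp_def one_product_group)
    qed
    ultimately show ?thesis by blast
  next
    case 2
    define t where "t = (\<lambda>Q\<in>Xs. if Q = P then f else \<one>\<^bsub>R Q\<^esub>)"
    have RQ: "monoid (R Q)" if "Q \<in> Xs" for Q
      using R_cancel[OF in_X(2)[OF that]] by (simp add: comm_monoid_cancel_def comm_monoid_def)
    have t: "t \<in> carrier T" using f by (auto simp: t_def carrier_product_group monoid.one_closed[OF RQ])
    have pow: "(t [^]\<^bsub>T\<^esub> n) Q = (if Q = P then f [^]\<^bsub>R P\<^esub> n else \<one>\<^bsub>R Q\<^esub>)" if Q: "Q \<in> Xs" for Q and n :: nat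
    proof (induction n)
      case 0
      then show ?case using Q by (simp add: one_product_group)
    next
      case (Suc n)
      then show ?case using Q monoid.l_one[OF RQ[OF Q] monoid.one_closed[OF RQ[OF Q]]]
        by (simp add: mult_product_group t_def)
    qed
    have io_pow: "\<iota> (t [^]\<^bsub>T\<^esub> n) = \<iota> t [^]\<^bsub>C\<^esub> n" for n :: nat
      using t monoid_homD[OF \<iota>_hom] by (induction n) simp_all
    let ?b = "({#}, t [^]\<^bsub>T\<^esub> order C)"
    have "?b \<in> carrier B"
      using t io_pow[of "order C"] monoid_homD(1)[OF \<iota>_hom t] by (simp add: C.pow_order_eq_1)
    moreover have "comp P ?b = f [^]\<^bsub>R P\<^esub> order C"
      using 2 pow by (simp add: comp_def)
    moreover have "comp Q ?b = \<one>\<^bsub>R Q\<^esub>" if Q: "Q \<in> rep ` prime_class ` Xd \<union> Xs" "Q \<noteq> P" for Q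
    proof (cases "Q \<in> Xd")
      case False
      then have "Q \<in> Xs" using Q rep by auto
      then show ?thesis using False Q pow by (simp add: comp_def)
    qed (simp add: comp_def)
    ultimately show ?thesis by blast
  qed
qed

lemma B_components: "finite_components B (rep ` prime_class ` Xd \<union> Xs) R comp (order C)"
proof (intro finite_components.intro finite_components_axioms.intro B_cancel)
  have X: "P \<in> X" if "P \<in> rep ` prime_class ` Xd \<union> Xs" for P using that rep by auto
  have "finite (prime_class ` Xd)" using C_finite by (rule finite_subset[rotated]) auto
  then show "finite (rep ` prime_class ` Xd \<union> Xs)" using Xs_finite by simp
  show "order C > 0" using C_finite C.one_closed by (auto simp: order_def card_gt_0_iff)
  fix P assume P: "P \<in> rep ` prime_class ` Xd \<union> Xs"
  note PX = X[OF P]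
  show "comm_monoid_cancel (R P)" by (rule R_cancel[OF PX])
  show "Units (R P) = {\<one>\<^bsub>R P\<^esub>}" by (rule R_reduced[OF PX])
  show "comm_monoid_cancel.v_fin (R P)" by (rule local_v_fin[OF PX])
  show "\<exists>f\<in>carrier (R P). f \<noteq> \<one>\<^bsub>R P\<^esub>" using nontrivial[OF PX] r_closed[OF PX] by blast
  show "monoid_hom B (R P) (comp P)" by (rule comp_hom[OF P])
  fix f assume f: "f \<in> carrier (R P)"
  show "\<exists>b\<in>carrier B. comp P b = f [^]\<^bsub>R P\<^esub> order C \<and>
    (\<forall>Q\<in>rep ` prime_class ` Xd \<union> Xs. Q \<noteq> P \<longrightarrow> comp Q b = \<one>\<^bsub>R Q\<^esub>)"
    by (rule B_concentrated[OF P f])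
  fix g assume g: "g \<in> carrier (R P)" and "f \<noteq> \<one>\<^bsub>R P\<^esub>"
  obtain x where "x \<in> carrier G" "f = r P x" using r_surj[OF PX f] by blast
  moreover obtain y where "y \<in> carrier G" "g = r P y" using r_surj[OF PX g] by blast
  ultimately show "\<exists>n::nat. g divides\<^bsub>R P\<^esub> f [^]\<^bsub>R P\<^esub> n"
    using primary[OF PX, of x y] \<open>f \<noteq> _\<close> PX by simp
next
  fix a b assume ab: "a \<in> carrier B" "b \<in> carrier B"
  show "a divides\<^bsub>B\<^esub> b \<longleftrightarrow> (\<forall>P\<in>rep ` prime_class ` Xd \<union> Xs. comp P a divides\<^bsub>R P\<^esub> comp P b)"
  proof
    assume "a divides\<^bsub>B\<^esub> b"
    then obtain c where c: "c \<in> carrier B" "b = a \<otimes>\<^bsub>B\<^esub> c" unfolding factor_def by blast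
    show "\<forall>P\<in>rep ` prime_class ` Xd \<union> Xs. comp P a divides\<^bsub>R P\<^esub> comp P b"
      using monoid_homD[OF comp_hom] ab c unfolding factor_def by blast
  qed (use B_divides[OF ab] in blast)
qed

lemma B_v_noetherian: "v_noetherian B"
proof -
  interpret BC: finite_components B "rep ` prime_class ` Xd \<union> Xs" R comp "order C" by (rule B_components)
  show ?thesis by (rule BC.v_fin_imp_v_noetherian[OF BC.components_v_fin])
qed

lemma B_weakly_krull: "weakly_krull B"
proof -
  interpret BC: finite_components B "rep ` prime_class ` Xd \<union> Xs" R comp "order C" by (rule B_components)
  show ?thesis by (rule BC.components_weakly_krull)
qed

section \<open>The transfer homomorphism\<close>

lemma transfer_to_B:
  "transfer_hom G B ((\<lambda>d. (image_mset prime_class (fst d), snd d)) \<circ> div_of)"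
proof (rule transfer_hom_via_divisors[where D = divisors and E = "free_abelian_monoid (prime_class ` Xd) \<times>\<times> T"])
  interpret B: comm_monoid_cancel B by (rule B_cancel)
  show "comm_monoid_cancel G" by (rule is_comm_monoid_cancel)
  show "atomic G" using fin by (intro v_noetherian_imp_atomic v_fin_imp_v_noetherian)
  show "comm_monoid B" by (rule B.comm_monoid_axioms)
  show "atomic B" by (rule v_noetherian_imp_atomic[OF B_v_noetherian])
  show "Units B = {\<one>\<^bsub>B\<^esub>}" by (rule B_Units)
  show "carrier B \<subseteq> carrier (free_abelian_monoid (prime_class ` Xd) \<times>\<times> T)" by auto
  show "mult B = mult (free_abelian_monoid (prime_class ` Xd) \<times>\<times> T)" "\<one>\<^bsub>B\<^esub> = \<one>\<^bsub>free_abelian_monoid (prime_class ` Xd) \<times>\<times> T\<^esub>"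
    by simp_all
  show "monoid_hom G divisors div_of" by (rule div_of_hom)
  show "monoid_hom divisors (free_abelian_monoid (prime_class ` Xd) \<times>\<times> T) (\<lambda>d. (image_mset prime_class (fst d), snd d))"
  proof (rule monoid_homI)
    fix x y assume "x \<in> carrier divisors" "y \<in> carrier divisors"
    then show "(image_mset prime_class (fst x), snd x) \<in> carrier (free_abelian_monoid (prime_class ` Xd) \<times>\<times> T)"
      "(image_mset prime_class (fst (x \<otimes>\<^bsub>divisors\<^esub> y)), snd (x \<otimes>\<^bsub>divisors\<^esub> y)) =
       (image_mset prime_class (fst x), snd x) \<otimes>\<^bsub>free_abelian_monoid (prime_class ` Xd) \<times>\<times> T\<^esub>
       (image_mset prime_class (fst y), snd y)"
      by (cases x, cases y, auto)+
  qed (simp add: pair_one)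
  show "a \<sim> b" if "a \<in> carrier G" "b \<in> carrier G" "div_of a = div_of b" for a b
    using that by (rule div_of_eq_associated)
  show "(image_mset prime_class (fst d), snd d) \<in> carrier B \<longleftrightarrow> d \<in> div_of ` carrier G" if "d \<in> carrier divisors" for d
    using that \<kappa>_one[OF that] \<kappa>_eq by (cases d) auto
  show "(\<lambda>d. (image_mset prime_class (fst d), snd d)) ` carrier divisors = carrier (free_abelian_monoid (prime_class ` Xd) \<times>\<times> T)"
  proof (intro equalityI subsetI)
    fix x assume "x \<in> carrier (free_abelian_monoid (prime_class ` Xd) \<times>\<times> T)"
    then obtain S t where x: "x = (S, t)" "set_mset S \<subseteq> prime_class ` Xd" "t \<in> carrier T" by (cases x) auto
    obtain U where "set_mset U \<subseteq> Xd" "S = image_mset prime_class U" using image_mset_surj[OF refl x(2)] by blast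
    then show "x \<in> (\<lambda>d. (image_mset prime_class (fst d), snd d)) ` carrier divisors"
      using x by (intro image_eqI[of _ _ "(U, t)"]) auto
  next
    fix x assume "x \<in> (\<lambda>d. (image_mset prime_class (fst d), snd d)) ` carrier divisors"
    then show "x \<in> carrier (free_abelian_monoid (prime_class ` Xd) \<times>\<times> T)" by (auto intro!: imageI)
  qed
  fix d b c
  assume d: "d \<in> carrier divisors"
    and bc: "b \<in> carrier (free_abelian_monoid (prime_class ` Xd) \<times>\<times> T)" "c \<in> carrier (free_abelian_monoid (prime_class ` Xd) \<times>\<times> T)"
    and eq: "(image_mset prime_class (fst d), snd d) = b \<otimes>\<^bsub>free_abelian_monoid (prime_class ` Xd) \<times>\<times> T\<^esub> c"
  obtain S t where dS: "d = (S, t)" by (cases d)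
  obtain S1 t1 S2 t2 where b: "b = (S1, t1)" and c: "c = (S2, t2)" by (cases b, cases c) auto
  have eqs: "image_mset prime_class S = S1 + S2" "t = t1 \<otimes>\<^bsub>T\<^esub> t2" using eq dS b c by simp_all
  obtain U1 U2 where "S = U1 + U2" "S1 = image_mset prime_class U1" "S2 = image_mset prime_class U2"
    using image_mset_eq_plusD[OF eqs(1)] by blast
  then show "\<exists>v\<in>carrier divisors. \<exists>w\<in>carrier divisors. d = v \<otimes>\<^bsub>divisors\<^esub> w \<and>
      (image_mset prime_class (fst v), snd v) = b \<and> (image_mset prime_class (fst w), snd w) = c"
    using d bc dS b c eqs by (intro bexI[of _ "(U1, t1)"] bexI[of _ "(U2, t2)"]) auto
next
  fix d assume "d \<in> carrier divisors" "(image_mset prime_class (fst d), snd d) = \<one>\<^bsub>free_abelian_monoid (prime_class ` Xd) \<times>\<times> T\<^esub>"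
  then show "d = \<one>\<^bsub>divisors\<^esub>" by (cases d) (simp add: pair_one)
qed

section \<open>Divisor-closed submonoids away from the conductor\<close>

context
  fixes S assumes S: "divisor_closed S G" and regular: "\<And>a P. a \<in> S \<Longrightarrow> P \<in> Xs \<Longrightarrow> r P a = \<one>\<^bsub>R P\<^esub>"
begin

definition support where "support = {P \<in> Xd. \<exists>a\<in>S. r P a \<noteq> \<one>\<^bsub>R P\<^esub>}"

lemma S_sub: "S \<subseteq> carrier G"
  using S submonoid.subset unfolding divisor_closed_def by blast

lemma div_of_S:
  assumes a: "a \<in> S"
  shows "set_mset (fst (div_of a)) \<subseteq> support" "snd (div_of a) = \<one>\<^bsub>T\<^esub>"
proof -
  have aC: "a \<in> carrier G" using a S_sub by blast
  have fam: "family_of (div_of a) P = r P a" if "P \<in> X" for P using div_of(2)[OF aC] that by simp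
  show "set_mset (fst (div_of a)) \<subseteq> support"
  proof
    fix P assume P: "P \<in># fst (div_of a)"
    then have PX: "P \<in> Xd" using div_of(1)[OF aC] by (auto simp: divisors_carrier)
    interpret R: comm_monoid_cancel "R P" using PX by (intro R_cancel) simp
    have "r P a = p P [^]\<^bsub>R P\<^esub> count (fst (div_of a)) P" using fam[of P] PX by simp
    moreover have "count (fst (div_of a)) P \<noteq> 0" using P by (simp only: count_eq_zero_iff) simp
    ultimately have "r P a \<noteq> \<one>\<^bsub>R P\<^esub>" using p_pow_inj[OF PX, of "count (fst (div_of a)) P" 0] by fastforce
    then show "P \<in> support" using PX a by (auto simp: support_def)
  qed
  have "snd (div_of a) P = \<one>\<^bsub>R P\<^esub>" if "P \<in> Xs" for P
    using fam[of P] regular[OF a that] that by simp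
  then show "snd (div_of a) = \<one>\<^bsub>T\<^esub>"
    using div_of(1)[OF aC] by (auto simp: divisors_carrier one_product_group PiE_iff extensional_def fun_eq_iff)
qed

text \<open>For each term \<open>P\<close> of \<open>U\<close>, multiply by an element of \<open>S\<close> that lies in \<open>P\<close>.\<close>

lemma support_covered:
  assumes "set_mset U \<subseteq> support"
  shows "\<exists>c\<in>S. U \<subseteq># fst (div_of c)"
  using assms
proof (induction U)
  case empty
  then show ?case using S unfolding divisor_closed_def by (auto dest: submonoid.one_closed)
next
  case (add P U)
  then obtain c where c: "c \<in> S" "U \<subseteq># fst (div_of c)" by auto
  from add.prems obtain a where a: "P \<in> Xd" "a \<in> S" "r P a \<noteq> \<one>\<^bsub>R P\<^esub>" by (auto simp: support_def)
  have C: "a \<in> carrier G" "c \<in> carrier G" using a c S_sub by auto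
  interpret R: comm_monoid_cancel "R P" using a by (intro R_cancel) simp
  have "r P a = p P [^]\<^bsub>R P\<^esub> count (fst (div_of a)) P"
    using div_of(2)[OF C(1)] a family_of_Xd[of P "div_of a"] by simp
  then have "count (fst (div_of a)) P \<noteq> 0" using a by (intro notI) simp
  then have "{#P#} \<subseteq># fst (div_of a)" by simp
  then have "{#P#} + U \<subseteq># fst (div_of a) + fst (div_of c)" using c by (intro subset_mset.add_mono)
  moreover have "fst (div_of (a \<otimes> c)) = fst (div_of a) + fst (div_of c)"
    using monoid_homD(2)[OF div_of_hom C] by (simp add: divisors_mult)
  moreover have "a \<otimes> c \<in> S" using S a c unfolding divisor_closed_def by (auto dest: submonoid.m_closed)
  ultimately show ?case by (intro bexI[of _ "a \<otimes> c"]) simp_all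
qed

text \<open>A sequence of primes of the support whose class is trivial is the divisor of an element \<open>a\<close> of \<open>H\<close>. As it divides the divisor of
  an element of \<open>S\<close>, and \<open>S\<close> is divisor-closed, \<open>a\<close> is in \<open>S\<close>. So all sequences of trivial class come from \<open>S\<close>.\<close>

lemma transfer_from_S:
  "transfer_hom (G\<lparr>carrier := S\<rparr>) (block_monoid C (prime_class ` support))
     (image_mset prime_class \<circ> (fst \<circ> div_of))"
proof -
  have G_noeth: "v_noetherian G" using fin by (rule v_fin_imp_v_noetherian)
  note S_facts = atomic_divisor_closed[OF G_noeth S]
  have sub: "support \<subseteq> Xd" by (auto simp: support_def)
  have subC: "prime_class ` support \<subseteq> carrier C" using sub by auto
  interpret block: comm_monoid_cancel "block_monoid C (prime_class ` support)"
    by (rule C.block_monoid_cancel[OF subC])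
  show ?thesis
  proof (rule transfer_hom_via_divisors[where D = "free_abelian_monoid support" and E = "free_abelian_monoid (prime_class ` support)"])
    show "comm_monoid_cancel (G\<lparr>carrier := S\<rparr>)" "atomic (G\<lparr>carrier := S\<rparr>)" by (rule S_facts)+
    show "comm_monoid (block_monoid C (prime_class ` support))" by (rule block.comm_monoid_axioms)
    show "atomic (block_monoid C (prime_class ` support))" by (rule C.block_monoid_atomic[OF subC])
    show "Units (block_monoid C (prime_class ` support)) = {\<one>\<^bsub>block_monoid C (prime_class ` support)\<^esub>}"
      by (rule C.block_monoid_Units[OF subC])
    show "carrier (block_monoid C (prime_class ` support)) \<subseteq> carrier (free_abelian_monoid (prime_class ` support))" by auto
    show "mult (block_monoid C (prime_class ` support)) = mult (free_abelian_monoid (prime_class ` support))"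
      by (simp add: block_monoid_def)
    show "\<one>\<^bsub>block_monoid C (prime_class ` support)\<^esub> = \<one>\<^bsub>free_abelian_monoid (prime_class ` support)\<^esub>" by simp
    show "monoid_hom (G\<lparr>carrier := S\<rparr>) (free_abelian_monoid support) (fst \<circ> div_of)"
    proof (rule monoid_homI)
      fix x y assume xy: "x \<in> carrier (G\<lparr>carrier := S\<rparr>)" "y \<in> carrier (G\<lparr>carrier := S\<rparr>)"
      then show "(fst \<circ> div_of) x \<in> carrier (free_abelian_monoid support)"
        using div_of_S by simp
      show "(fst \<circ> div_of) (x \<otimes>\<^bsub>G\<lparr>carrier := S\<rparr>\<^esub> y) = (fst \<circ> div_of) x \<otimes>\<^bsub>free_abelian_monoid support\<^esub> (fst \<circ> div_of) y"
        using xy subsetD[OF S_sub] monoid_homD(2)[OF div_of_hom, of x y] by (simp add: divisors_mult)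
    qed (use monoid_homD(3)[OF div_of_hom] in \<open>simp add: pair_one\<close>)
    show "monoid_hom (free_abelian_monoid support) (free_abelian_monoid (prime_class ` support)) (image_mset prime_class)"
      by (rule monoid_homI) auto
  next
    fix a b assume "a \<in> carrier (G\<lparr>carrier := S\<rparr>)" "b \<in> carrier (G\<lparr>carrier := S\<rparr>)" "(fst \<circ> div_of) a = (fst \<circ> div_of) b"
    then have ab: "a \<in> S" "b \<in> S" "div_of a = div_of b" using div_of_S by (auto simp: prod_eq_iff)
    then have "a \<sim> b" using S_sub by (intro div_of_eq_associated) auto
    then obtain u where u: "u \<in> Units G" "a = b \<otimes> u" using associatedD2 ab S_sub by blast
    interpret GS: comm_monoid_cancel "G\<lparr>carrier := S\<rparr>" by (rule S_facts)
    show "a \<sim>\<^bsub>G\<lparr>carrier := S\<rparr>\<^esub> b"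
      using u ab S_facts(3) by (intro GS.associatedI2'[of a b u]) auto
  next
    fix d assume d: "d \<in> carrier (free_abelian_monoid support)"
    then have dd: "set_mset d \<subseteq> support" by simp
    then have in_div: "(d, \<one>\<^bsub>T\<^esub>) \<in> carrier divisors" using sub by auto
    have \<kappa>d: "\<kappa> (d, \<one>\<^bsub>T\<^esub>) = seq_sum C (image_mset prime_class d)"
    proof -
      have "set_mset (image_mset prime_class d) \<subseteq> carrier C" using dd sub by auto
      then show ?thesis
        using dd sub \<kappa>_eq[of d "\<one>\<^bsub>T\<^esub>"] monoid_homD(3)[OF \<iota>_hom] by (simp del: set_image_mset)
    qed
    show "image_mset prime_class d \<in> carrier (block_monoid C (prime_class ` support)) \<longleftrightarrow>
        d \<in> (fst \<circ> div_of) ` carrier (G\<lparr>carrier := S\<rparr>)"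
    proof
      assume "image_mset prime_class d \<in> carrier (block_monoid C (prime_class ` support))"
      then obtain a where a: "a \<in> carrier G" "div_of a = (d, \<one>\<^bsub>T\<^esub>)"
        using \<kappa>_one[OF in_div] \<kappa>d by auto
      obtain c where c: "c \<in> S" "d \<subseteq># fst (div_of c)" using support_covered[OF dd] by blast
      then obtain e where e: "fst (div_of c) = d + e" by (auto simp: subset_mset.le_iff_add)
      have cC: "c \<in> carrier G" using c S_sub by blast
      have "(e, \<one>\<^bsub>T\<^esub>) \<in> carrier divisors" using div_of(1)[OF cC] e by (simp add: divisors_carrier[of "div_of c"])
      moreover have "div_of c = div_of a \<otimes>\<^bsub>divisors\<^esub> (e, \<one>\<^bsub>T\<^esub>)"
        unfolding a(2) using e div_of_S(2)[OF c(1)] by (intro prod_eqI) simp_all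
      ultimately have "a divides c" using div_of_divides a cC by blast
      then have "a \<in> S" using S a c unfolding divisor_closed_def by blast
      then show "d \<in> (fst \<circ> div_of) ` carrier (G\<lparr>carrier := S\<rparr>)" using a by (auto intro!: image_eqI[of _ _ a])
    next
      assume "d \<in> (fst \<circ> div_of) ` carrier (G\<lparr>carrier := S\<rparr>)"
      then obtain a where a: "a \<in> S" "d = fst (div_of a)" by auto
      then have "div_of a = (d, \<one>\<^bsub>T\<^esub>)" using div_of_S by (simp add: prod_eq_iff)
      then have "\<kappa> (d, \<one>\<^bsub>T\<^esub>) = \<one>\<^bsub>C\<^esub>" using \<kappa>_one[OF in_div] a S_sub by (metis imageI subsetD)
      then show "image_mset prime_class d \<in> carrier (block_monoid C (prime_class ` support))"
        using \<kappa>d dd by auto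
    qed
  next
    show "image_mset prime_class ` carrier (free_abelian_monoid support) = carrier (free_abelian_monoid (prime_class ` support))"
      by (rule image_mset_free_abelian[OF refl])
  next
    fix d b c assume d: "d \<in> carrier (free_abelian_monoid support)"
      and "image_mset prime_class d = b \<otimes>\<^bsub>free_abelian_monoid (prime_class ` support)\<^esub> c"
    then obtain v w where "d = v + w" "b = image_mset prime_class v" "c = image_mset prime_class w"
      using image_mset_eq_plusD[of prime_class d b c] by auto
    then show "\<exists>v\<in>carrier (free_abelian_monoid support). \<exists>w\<in>carrier (free_abelian_monoid support).
       d = v \<otimes>\<^bsub>free_abelian_monoid support\<^esub> w \<and> image_mset prime_class v = b \<and> image_mset prime_class w = c"
      using d by (intro bexI[of _ v] bexI[of _ w]) auto
  qed auto
qed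

end

end

section \<open>Block monoids with a divisor theory\<close>

context comm_group
begin

text \<open>The element \<open>g\<close> is the greatest common divisor of two blocks: a power of \<open>g\<close>, and a block that contains \<open>g\<close> exactly once,
  which exists by assumption.\<close>

lemma block_divisor_theory:
  assumes fin: "finite (carrier G)" and P: "P \<subseteq> carrier G"
    and ex: "\<And>g. g \<in> P \<Longrightarrow> \<exists>U. set_mset U \<subseteq> P - {g} \<and> g \<otimes> seq_sum G U = \<one>"
  shows "divisor_theory (block_monoid G P) P (\<lambda>B. B)"
  unfolding divisor_theory_def
proof (intro conjI ballI impI)
  show "comm_monoid_cancel (block_monoid G P)" by (rule block_monoid_cancel[OF P])
  show "monoid_hom (block_monoid G P) (free_abelian_monoid P) (\<lambda>B. B)"
    by (rule monoid_homI) auto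
  fix a b assume ab: "a \<in> carrier (block_monoid G P)" "b \<in> carrier (block_monoid G P)"
    and "a divides\<^bsub>free_abelian_monoid P\<^esub> b"
  then have "a \<subseteq># b" by (simp add: free_abelian_divides)
  then show "a divides\<^bsub>block_monoid G P\<^esub> b" using block_monoid_divides[OF P ab] by blast
next
  fix g assume g: "g \<in> P"
  then obtain U where U: "set_mset U \<subseteq> P - {g}" "g \<otimes> seq_sum G U = \<one>" using ex by blast
  have gC: "g \<in> carrier G" and UC: "set_mset U \<subseteq> carrier G" using g U P by auto
  define a where "a = add_mset g U"
  define b where "b = replicate_mset (order G) g"
  have order: "order G > 0" using fin by (auto simp: order_def card_gt_0_iff)
  have a: "a \<in> carrier (block_monoid G P)" using g gC U UC by (auto simp: a_def)
  have b: "b \<in> carrier (block_monoid G P)"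
    using g gC pow_order_eq_1 by (auto simp: b_def in_replicate_mset)
  have ab: "set_mset a \<subseteq> P" "set_mset b \<subseteq> P" using a b by auto
  have g_le: "{#g#} \<subseteq># a" "{#g#} \<subseteq># b"
    using order by (auto simp: a_def b_def in_replicate_mset)
  have greatest: "c \<subseteq># {#g#}" if c: "c \<subseteq># a" "c \<subseteq># b" for c
  proof (rule mset_subset_eqI)
    fix h
    have "count c h \<le> count b h" "count c h \<le> count a h" using c by (auto intro: mset_subset_eq_count)
    moreover have "count U g = 0" using U by (auto simp: not_in_iff)
    ultimately show "count c h \<le> count {#g#} h"
      by (cases "h = g") (auto simp: a_def b_def)
  qed
  have "is_gcd (free_abelian_monoid P) {#g#} {a, b}"
    unfolding is_gcd_def greatest_def
  proof (intro conjI ballI)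
    show "{#g#} \<in> Lower (division_rel (free_abelian_monoid P)) {a, b}"
      using g g_le ab by (auto simp: Lower_def free_abelian_divides)
    fix c assume "c \<in> Lower (division_rel (free_abelian_monoid P)) {a, b}"
    then have "set_mset c \<subseteq> P" "c \<subseteq># a" "c \<subseteq># b"
      using ab by (auto simp: Lower_def free_abelian_divides)
    then show "c \<sqsubseteq>\<^bsub>division_rel (free_abelian_monoid P)\<^esub> {#g#}"
      using greatest[of c] g by (simp add: free_abelian_divides)
  qed (auto simp: Lower_def)
  then show "\<exists>X. finite X \<and> X \<noteq> {} \<and> X \<subseteq> carrier (block_monoid G P) \<and>
      is_gcd (free_abelian_monoid P) {#g#} ((\<lambda>B. B) ` X)"
    using a b by (intro exI[of _ "{a, b}"]) auto
qed

text \<open>The exponents \<open>k\<close> for which \<open>g\<^sup>k\<close> is in the subgroup generated by the other elements of \<open>P\<close> are the multiples of the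
  least positive one, and each multiplicity of \<open>g\<close> in a block is such an exponent. Sequences suffice to describe the
  subgroup, since in a finite group inverses are positive powers.\<close>

lemma block_multiplicity:
  assumes fin: "finite (carrier G)" and P: "P \<subseteq> carrier G" and g: "g \<in> carrier G"
  obtains m where "m > 0" "\<exists>U. set_mset U \<subseteq> P - {g} \<and> g [^] m \<otimes> seq_sum G U = \<one>"
    "\<And>X. X \<in> carrier (block_monoid G P) \<Longrightarrow> m dvd count X g"
proof -
  define \<Phi> where "\<Phi> k \<longleftrightarrow> (\<exists>U. set_mset U \<subseteq> P - {g} \<and> g [^] k \<otimes> seq_sum G U = \<one>)" for k :: nat
  have order: "order G > 0" using fin by (auto simp: order_def card_gt_0_iff)
  have "\<Phi> (order G)" using g by (auto simp: \<Phi>_def pow_order_eq_1 intro!: exI[of _ "{#}"])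
  then have ex: "\<exists>m. m > 0 \<and> \<Phi> m" using order by blast
  define m where "m = (LEAST m. m > 0 \<and> \<Phi> m)"
  have m: "m > 0" "\<Phi> m" using LeastI_ex[OF ex] by (auto simp: m_def)
  have least: "m \<le> k" if "k > 0" "\<Phi> k" for k
    unfolding m_def by (rule Least_le) (use that in simp)
  obtain V where V: "set_mset V \<subseteq> P - {g}" "g [^] m \<otimes> seq_sum G V = \<one>" using m by (auto simp: \<Phi>_def)
  have VC: "set_mset V \<subseteq> carrier G" using V P by auto
  have "m dvd count X g" if X: "X \<in> carrier (block_monoid G P)" for X
  proof -
    define k where "k = count X g"
    define q where "q = k div m"
    define U where "U = filter_mset (\<lambda>h. h \<noteq> g) X"
    have U: "set_mset U \<subseteq> P - {g}" "set_mset U \<subseteq> carrier G" using X P by (auto simp: U_def)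
    have "X = replicate_mset k g + U"
      by (rule multiset_eqI) (auto simp: k_def U_def)
    then have "seq_sum G X = g [^] k \<otimes> seq_sum G U"
      using g U by (simp add: subset_iff in_replicate_mset)
    then have "g [^] k \<otimes> seq_sum G U = \<one>" using X by simp
    moreover have "g [^] k = g [^] (k mod m) \<otimes> (g [^] m) [^] q"
      using g by (simp add: nat_pow_pow nat_pow_mult q_def)
    ultimately have eq: "g [^] (k mod m) \<otimes> (g [^] m) [^] q \<otimes> seq_sum G U = \<one>" by simp
    \<comment> \<open>By the choice of \<open>V\<close>, \<open>g\<^sup>m\<close> is the inverse of its sum, hence a positive power of its sum.\<close>
    have "(g [^] m) [^] q = seq_sum G V [^] (q * (order G - 1))"
    proof -
      have "seq_sum G V [^] (order G - 1) \<otimes> seq_sum G V = seq_sum G V [^] order G"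
        using nat_pow_Suc[of "seq_sum G V" "order G - 1"] order by simp
      also have "\<dots> = \<one>" using VC by (simp add: pow_order_eq_1)
      finally have "seq_sum G V [^] (order G - 1) \<otimes> seq_sum G V = g [^] m \<otimes> seq_sum G V"
        using V by simp
      then have "seq_sum G V [^] (order G - 1) = g [^] m" using VC g by simp
      then show ?thesis using VC by (simp add: nat_pow_pow mult.commute flip: \<open>_ = g [^] m\<close>)
    qed
    then have "g [^] (k mod m) \<otimes> seq_sum G (U + repeat_mset (q * (order G - 1)) V) = \<one>"
    proof -
      have sub: "set_mset (repeat_mset n V) \<subseteq> set_mset V" for n by (induction n) auto
      have "set_mset (repeat_mset (q * (order G - 1)) V) \<subseteq> carrier G" using sub VC by blast
      then show ?thesis
        using eq U VC g \<open>(g [^] m) [^] q = _\<close> by (simp add: seq_sum_repeat m_ac)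
    qed
    moreover have "set_mset (U + repeat_mset (q * (order G - 1)) V) \<subseteq> P - {g}"
    proof -
      have "set_mset (repeat_mset n V) \<subseteq> set_mset V" for n by (induction n) auto
      from this[of "q * (order G - 1)"] show ?thesis using U V by auto
    qed
    ultimately have "\<Phi> (k mod m)" unfolding \<Phi>_def by blast
    moreover have "k mod m < m" using m(1) by simp
    ultimately have "k mod m = 0" using least[of "k mod m"] by linarith
    then show ?thesis by (simp add: k_def dvd_eq_mod_eq_0)
  qed
  then show ?thesis using m that by (auto simp: \<Phi>_def)
qed

text \<open>Divide the multiplicity of \<open>g\<close> by \<open>m\<close> and rename \<open>g\<close> to \<open>g\<^sup>m\<close>. The first step is injective on blocks, and its image is
  described by the sum after the second step, so this is again the situation of a divisor homomorphism followed by a map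
  to classes. The second step need not be injective, as \<open>g\<^sup>m\<close> may be another element of \<open>P\<close>.\<close>

lemma block_replace_transfer:
  assumes P: "P \<subseteq> carrier G" and g: "g \<in> P" and m: "m > 0"
    and dvd: "\<And>X. X \<in> carrier (block_monoid G P) \<Longrightarrow> m dvd count X g"
  shows "\<exists>\<theta>. transfer_hom (block_monoid G P) (block_monoid G (insert (g [^] m) (P - {g}))) \<theta>"
proof -
  define P' where "P' = insert (g [^] m) (P - {g})"
  define f where "f h = (if h = g then g [^] m else h)" for h
  define \<pi> where "\<pi> X = filter_mset (\<lambda>h. h \<noteq> g) X + replicate_mset (count X g div m) g" for X
  define expand where "expand X = filter_mset (\<lambda>h. h \<noteq> g) X + replicate_mset (m * count X g) g" for X
  have gC: "g \<in> carrier G" using g P by blast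
  have P': "P' \<subseteq> carrier G" using P gC by (auto simp: P'_def)
  have fP: "f ` P = P'" using g by (auto simp: f_def P'_def)
  have \<pi>_expand: "\<pi> (expand X) = X" for X
    using m by (intro multiset_eqI) (auto simp: \<pi>_def expand_def)
  have sum_expand: "seq_sum G (image_mset f X) = seq_sum G (expand X)" if X: "set_mset X \<subseteq> P" for X
  proof -
    have "X = filter_mset (\<lambda>h. h \<noteq> g) X + replicate_mset (count X g) g"
      by (rule multiset_eqI) auto
    then have "image_mset f X = image_mset f (filter_mset (\<lambda>h. h \<noteq> g) X) + replicate_mset (count X g) (g [^] m)"
      using image_mset_union[of f "filter_mset (\<lambda>h. h \<noteq> g) X" "replicate_mset (count X g) g"]
      by (simp add: f_def)
    also have "image_mset f (filter_mset (\<lambda>h. h \<noteq> g) X) = image_mset (\<lambda>h. h) (filter_mset (\<lambda>h. h \<noteq> g) X)"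
      by (rule image_mset_cong) (auto simp: f_def)
    finally have eq: "image_mset f X = filter_mset (\<lambda>h. h \<noteq> g) X + replicate_mset (count X g) (g [^] m)" by simp
    have c: "set_mset (filter_mset (\<lambda>h. h \<noteq> g) X) \<subseteq> carrier G" using X P by auto
    have c': "set_mset (replicate_mset n h) \<subseteq> carrier G" if "h \<in> carrier G" for n h
      using that by (auto simp: in_replicate_mset)
    show ?thesis
      unfolding eq expand_def using c c' gC by (simp add: nat_pow_pow del: set_mset_filter set_mset_replicate_mset_subset)
  qed
  have expand_sub: "set_mset (expand X) \<subseteq> P" if "set_mset X \<subseteq> P" for X
    using that g by (auto simp: expand_def in_replicate_mset)
  interpret B: comm_monoid_cancel "block_monoid G P" by (rule block_monoid_cancel[OF P])
  interpret B': comm_monoid_cancel "block_monoid G P'" by (rule block_monoid_cancel[OF P'])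
  have "transfer_hom (block_monoid G P) (block_monoid G P') (image_mset f \<circ> \<pi>)"
  proof (rule transfer_hom_via_divisors[where D = "free_abelian_monoid P" and E = "free_abelian_monoid P'"])
    show "comm_monoid_cancel (block_monoid G P)" by (rule block_monoid_cancel[OF P])
    show "atomic (block_monoid G P)" by (rule block_monoid_atomic[OF P])
    show "comm_monoid (block_monoid G P')" by (rule B'.comm_monoid_axioms)
    show "atomic (block_monoid G P')" by (rule block_monoid_atomic[OF P'])
    show "Units (block_monoid G P') = {\<one>\<^bsub>block_monoid G P'\<^esub>}" by (rule block_monoid_Units[OF P'])
    show "carrier (block_monoid G P') \<subseteq> carrier (free_abelian_monoid P')" by auto
    show "mult (block_monoid G P') = mult (free_abelian_monoid P')" by (simp add: block_monoid_def)
    show "\<one>\<^bsub>block_monoid G P'\<^esub> = \<one>\<^bsub>free_abelian_monoid P'\<^esub>" by simp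
    show "monoid_hom (block_monoid G P) (free_abelian_monoid P) \<pi>"
    proof (rule monoid_homI)
      fix X Y assume X: "X \<in> carrier (block_monoid G P)" and Y: "Y \<in> carrier (block_monoid G P)"
      show "\<pi> X \<in> carrier (free_abelian_monoid P)"
        using X g by (auto simp: \<pi>_def in_replicate_mset)
      show "\<pi> (X \<otimes>\<^bsub>block_monoid G P\<^esub> Y) = \<pi> X \<otimes>\<^bsub>free_abelian_monoid P\<^esub> \<pi> Y"
        using dvd[OF X] div_plus_div_distrib_dvd_left[of m "count X g" "count Y g"]
        by (intro multiset_eqI) (auto simp: \<pi>_def)
    qed (simp add: \<pi>_def)
    show "monoid_hom (free_abelian_monoid P) (free_abelian_monoid P') (image_mset f)"
      using fP by (intro monoid_homI) auto
  next
    fix X Y assume X: "X \<in> carrier (block_monoid G P)" and Y: "Y \<in> carrier (block_monoid G P)" and eq: "\<pi> X = \<pi> Y"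
    have "count X h = count Y h" for h
    proof (cases "h = g")
      case True
      have "count (\<pi> X) g = count (\<pi> Y) g" by (simp add: eq)
      then have "count X g div m = count Y g div m" by (simp add: \<pi>_def)
      then show ?thesis using dvd[OF X] dvd[OF Y] True by (metis dvd_div_mult_self)
    next
      case False
      have "count (\<pi> X) h = count (\<pi> Y) h" by (simp add: eq)
      then show ?thesis using False by (simp add: \<pi>_def)
    qed
    then have "X = Y" by (rule multiset_eqI)
    then show "X \<sim>\<^bsub>block_monoid G P\<^esub> Y" using X by (simp del: block_monoid_simps)
  next
    fix d assume d: "d \<in> carrier (free_abelian_monoid P)"
    show "image_mset f d \<in> carrier (block_monoid G P') \<longleftrightarrow> d \<in> \<pi> ` carrier (block_monoid G P)"
    proof
      assume "image_mset f d \<in> carrier (block_monoid G P')"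
      then have "expand d \<in> carrier (block_monoid G P)" using d expand_sub[of d] sum_expand[of d] by simp
      then show "d \<in> \<pi> ` carrier (block_monoid G P)" using \<pi>_expand[of d] by (metis imageI)
    next
      assume "d \<in> \<pi> ` carrier (block_monoid G P)"
      then obtain X where X: "X \<in> carrier (block_monoid G P)" "d = \<pi> X" by blast
      have "expand d = X"
        using dvd[OF X(1)] unfolding X(2) by (intro multiset_eqI) (auto simp: expand_def \<pi>_def)
      then have "seq_sum G (image_mset f d) = \<one>" using sum_expand[of d] d X by simp
      then show "image_mset f d \<in> carrier (block_monoid G P')" using d fP by auto
    qed
  next
    show "image_mset f ` carrier (free_abelian_monoid P) = carrier (free_abelian_monoid P')"
      by (rule image_mset_free_abelian[OF fP])
  next
    fix d b c assume d: "d \<in> carrier (free_abelian_monoid P)" and "image_mset f d = b \<otimes>\<^bsub>free_abelian_monoid P'\<^esub> c"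
    then obtain v w where "d = v + w" "b = image_mset f v" "c = image_mset f w"
      using image_mset_eq_plusD[of f d b c] by auto
    then show "\<exists>v\<in>carrier (free_abelian_monoid P). \<exists>w\<in>carrier (free_abelian_monoid P).
       d = v \<otimes>\<^bsub>free_abelian_monoid P\<^esub> w \<and> image_mset f v = b \<and> image_mset f w = c"
      using d by (intro bexI[of _ v] bexI[of _ w]) auto
  qed auto
  then show ?thesis unfolding P'_def by blast
qed

text \<open>Replacing \<open>g\<close> by \<open>g\<^sup>m\<close> divides the order of \<open>g\<close> by \<open>m\<close>, so the process ends; it ends when each element
  is in the subgroup generated by the others.\<close>

lemma transfer_to_divisor_theory:
  assumes fin: "finite (carrier G)" and "P \<subseteq> carrier G" and "transfer_hom H (block_monoid G P) \<theta>"
  shows "\<exists>P' \<theta>'. P' \<subseteq> carrier G \<and> divisor_theory (block_monoid G P') P' (\<lambda>B. B) \<and>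
    transfer_hom H (block_monoid G P') \<theta>'"
  using assms(2,3)
proof (induction "\<Sum>g\<in>P. ord g" arbitrary: P \<theta> rule: less_induct)
  case less
  note P = less.prems(1)
  show ?case
  proof (cases "\<forall>g\<in>P. \<exists>U. set_mset U \<subseteq> P - {g} \<and> g \<otimes> seq_sum G U = \<one>")
    case True
    then have "divisor_theory (block_monoid G P) P (\<lambda>B. B)" using block_divisor_theory[OF fin P] by blast
    then show ?thesis using less.prems by blast
  next
    case False
    then obtain g where g: "g \<in> P" "\<not> (\<exists>U. set_mset U \<subseteq> P - {g} \<and> g \<otimes> seq_sum G U = \<one>)" by blast
    have gC: "g \<in> carrier G" using g P by blast
    obtain m where m: "m > 0" "\<exists>U. set_mset U \<subseteq> P - {g} \<and> g [^] m \<otimes> seq_sum G U = \<one>"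
      "\<And>X. X \<in> carrier (block_monoid G P) \<Longrightarrow> m dvd count X g"
      using block_multiplicity[OF fin P gC] by blast
    have "m \<noteq> 1" using m(2) g(2) gC by auto
    let ?P = "insert (g [^] m) (P - {g})"
    obtain \<eta> where \<eta>: "transfer_hom (block_monoid G P) (block_monoid G ?P) \<eta>"
      using block_replace_transfer[OF P g(1) m(1,3)] by blast
    have P': "?P \<subseteq> carrier G" using P gC by auto
    have ord_pos: "ord g > 0" using ord_ge_1[OF fin gC] by simp
    have "replicate_mset (ord g) g \<in> carrier (block_monoid G P)"
      using g gC by (auto simp: in_replicate_mset)
    from m(3)[OF this] have "m dvd ord g" by simp
    then have "ord (g [^] m) = ord g div m" using ord_pow[OF gC] m(1) by simp
    also have "\<dots> < ord g" using m(1) \<open>m \<noteq> 1\<close> ord_pos by (intro div_less_dividend) auto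
    finally have less_ord: "ord (g [^] m) < ord g" .
    have finP: "finite P" using P fin by (rule finite_subset)
    have "(\<Sum>h\<in>?P. ord h) \<le> ord (g [^] m) + (\<Sum>h\<in>P - {g}. ord h)"
      using finP by (cases "g [^] m \<in> P - {g}") (simp_all add: insert_absorb)
    also have "\<dots> < ord g + (\<Sum>h\<in>P - {g}. ord h)" using less_ord by simp
    also have "\<dots> = (\<Sum>h\<in>P. ord h)" using finP g(1) by (simp add: sum.remove)
    finally have smaller: "(\<Sum>h\<in>?P. ord h) < (\<Sum>h\<in>P. ord h)" .
    interpret B: comm_monoid_cancel "block_monoid G P" by (rule block_monoid_cancel[OF P])
    interpret B': comm_monoid_cancel "block_monoid G ?P" by (rule block_monoid_cancel[OF P'])
    have "transfer_hom H (block_monoid G ?P) (\<eta> \<circ> \<theta>)"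
      using block_monoid_Units[OF P] block_monoid_Units[OF P'] less.prems(2) \<eta>
      by (intro transfer_hom_comp[where B = "block_monoid G P"] B.comm_monoid_axioms B'.comm_monoid_axioms)
    then show ?thesis using less.hyps[OF smaller P'] by blast
  qed
qed

end

section \<open>The localizations of a weakly Krull monoid\<close>

context comm_monoid_cancel
begin

lemma min_primes_prime: "P \<in> min_primes G \<Longrightarrow> prime_s_ideal G P"
  by (simp add: min_primes_def)

lemma weakly_krull_primary_family:
  assumes fin: v_fin and wk: "weakly_krull G" and nonempty: "min_primes G \<noteq> {}"
  shows "primary_family G (min_primes G) (\<lambda>P. reduced (local_monoid G P)) loc_res"
proof (intro primary_family.intro primary_family_axioms.intro is_comm_monoid_cancel)
  fix P assume P: "P \<in> min_primes G"
  note prime = min_primes_prime[OF P] and pull = min_primes_pull[OF P]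
  interpret L: comm_monoid_cancel "local_monoid G P" by (rule local_cancel[OF prime])
  interpret R: comm_monoid_cancel "reduced (local_monoid G P)" by (rule L.reduced_cancel)
  show "comm_monoid_cancel (reduced (local_monoid G P))" by (rule L.reduced_cancel)
  show "Units (reduced (local_monoid G P)) = {\<one>\<^bsub>reduced (local_monoid G P)\<^esub>}" by (rule L.reduced_Units)
  show "loc_res P \<one> = \<one>\<^bsub>reduced (local_monoid G P)\<^esub>" by (rule loc_res_one[OF prime])
  have pull_nonempty: "pull P \<noteq> {}" using pull(2) by (simp add: min_prime_set_def)
  then show "\<exists>e\<in>carrier G. loc_res P e \<noteq> \<one>\<^bsub>reduced (local_monoid G P)\<^esub>"
    using loc_res_eq_one_iff[OF prime] pull_subset by blast
  show "\<exists>a\<in>carrier G. f = loc_res P a" if "f \<in> carrier (reduced (local_monoid G P))" for f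
    using that by (rule loc_res_surj[OF prime])
  fix a assume a: "a \<in> carrier G"
  show "loc_res P a \<in> carrier (reduced (local_monoid G P))" by (rule loc_res_closed[OF prime a])
  fix b assume b: "b \<in> carrier G"
  show "loc_res P (a \<otimes> b) = loc_res P a \<otimes>\<^bsub>reduced (local_monoid G P)\<^esub> loc_res P b"
    by (rule loc_res_mult[OF prime a b])
  show dv: "loc_res P a divides\<^bsub>reduced (local_monoid G P)\<^esub> loc_res P b \<longleftrightarrow>
      (\<exists>s\<in>carrier G. loc_res P s = \<one>\<^bsub>reduced (local_monoid G P)\<^esub> \<and> a divides s \<otimes> b)"
    using loc_res_divides[OF prime a b] loc_res_eq_one_iff[OF prime] by auto
  assume "loc_res P a \<noteq> \<one>\<^bsub>reduced (local_monoid G P)\<^esub>"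
  then have "a \<in> pull P" using loc_res_eq_one_iff[OF prime a] by simp
  then obtain s n where s: "s \<in> carrier G - pull P" "b divides s \<otimes> a [^] (n::nat)"
    using min_prime_primary[OF pull(2) b] by blast
  then show "\<exists>n::nat. loc_res P b divides\<^bsub>reduced (local_monoid G P)\<^esub> loc_res P (a [^] n)"
    using loc_res_divides[OF prime b, of "a [^] n"] a by blast
next
  fix P Q assume P: "P \<in> min_primes G" and Q: "Q \<in> min_primes G" and "P \<noteq> Q"
  note prime = min_primes_prime[OF P] min_primes_prime[OF Q]
  note pulls = min_primes_pull[OF P] min_primes_pull[OF Q]
  have "\<not> pull Q \<subseteq> pull P"
  proof
    assume "pull Q \<subseteq> pull P"
    then have "pull Q = pull P" using pulls by (auto simp: min_prime_set_def)
    then show False using pulls(1,3) \<open>P \<noteq> Q\<close> by simp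
  qed
  then obtain e where "e \<in> pull Q" "e \<notin> pull P" by blast
  moreover then have "e \<in> carrier G" using pull_subset by blast
  ultimately show "\<exists>e\<in>carrier G. loc_res P e = \<one>\<^bsub>reduced (local_monoid G P)\<^esub> \<and>
      loc_res Q e \<noteq> \<one>\<^bsub>reduced (local_monoid G Q)\<^esub>"
    using loc_res_eq_one_iff[OF prime(1)] loc_res_eq_one_iff[OF prime(2)] by blast
next
  fix a assume a: "a \<in> carrier G"
  have "{P \<in> min_primes G. loc_res P a \<noteq> \<one>\<^bsub>reduced (local_monoid G P)\<^esub>} \<subseteq> {P \<in> min_primes G. emb G a \<in> P}"
    using loc_res_eq_one_iff[OF min_primes_prime a] a by (auto simp: pull_def)
  moreover have "finite {P \<in> min_primes G. emb G a \<in> P}"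
    using wk a by (auto simp: weakly_krull_def base_def)
  ultimately show "finite {P \<in> min_primes G. loc_res P a \<noteq> \<one>\<^bsub>reduced (local_monoid G P)\<^esub>}"
    by (rule finite_subset)
next
  fix a b assume ab: "a \<in> carrier G" "b \<in> carrier G"
    and loc: "\<And>P. P \<in> min_primes G \<Longrightarrow> loc_res P a divides\<^bsub>reduced (local_monoid G P)\<^esub> loc_res P b"
  have "\<exists>s\<in>carrier G - P. a divides s \<otimes> b" if P: "min_prime_set P" for P
  proof -
    have sub: "P \<subseteq> carrier G" using P by (auto simp: min_prime_set_def prime_set_def ideal_set_def)
    then have mem: "emb G ` P \<in> min_primes G" using min_primes_emb P by blast
    show ?thesis
      using loc[OF mem] loc_res_divides[OF min_primes_prime[OF mem] ab] pull_emb[OF sub] by simp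
  qed
  then show "a divides b" using wk ab unfolding weakly_krull_iff by blast
qed (use fin nonempty in simp_all)

text \<open>Without minimal primes a weakly Krull monoid is the empty intersection of localizations, hence a group, and its
  conductor is everything.\<close>

lemma proper_conductor_imp_min_primes:
  assumes wk: "weakly_krull G" and proper: "conductor G \<subset> base G"
  shows "min_primes G \<noteq> {}"
proof
  interpret Q: comm_group "quot_grp G" by (rule quot_grp_comm_group)
  assume "min_primes G = {}"
  then have base: "base G = carrier (quot_grp G)" using wk by (simp add: weakly_krull_def)
  have "conductor G = base G"
    by (auto simp: conductor_def colon_def base complete_integral_closure_def)
  then show False using proper by simp
qed

text \<open>The inner condition says that \<open>b/a\<close> is in the complete integral closure, so an element \<open>d\<close> of the conductor multiplies it
  into \<open>H\<close>; for a prime \<open>P\<close> of \<open>Preg G\<close> it can be chosen outside \<open>P\<close>.\<close>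

lemma conductor_multiplier:
  assumes P: "P \<in> Preg G" and proper: "conductor G \<subset> base G"
  shows "\<exists>d\<in>carrier G. loc_res P d = \<one>\<^bsub>reduced (local_monoid G P)\<^esub> \<and>
     (\<forall>a\<in>carrier G. \<forall>b\<in>carrier G. \<forall>c\<in>carrier G. (\<forall>n::nat. a [^] n divides c \<otimes> b [^] n) \<longrightarrow> a divides d \<otimes> b)"
proof -
  interpret Q: comm_group "quot_grp G" by (rule quot_grp_comm_group)
  have PX: "P \<in> min_primes G" and "\<not> conductor G \<subseteq> P" using P by (auto simp: Preg_def Pstar_def)
  then obtain x where x: "x \<in> conductor G" "x \<notin> P" by blast
  then obtain d where d: "d \<in> carrier G" "x = emb G d" using proper by (auto simp: base_def)
  have "a divides d \<otimes> b"
    if abc: "a \<in> carrier G" "b \<in> carrier G" "c \<in> carrier G" and n: "\<forall>n::nat. a [^] n divides c \<otimes> b [^] n" for a b c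
  proof -
    have "emb G c \<otimes>\<^bsub>quot_grp G\<^esub> mk_frac G b a [^]\<^bsub>quot_grp G\<^esub> n \<in> base G" for n :: nat
      using abc n by (simp add: emb_def mk_frac_in_base)
    moreover have "emb G c \<in> base G" using abc by (simp add: base_def)
    ultimately have "mk_frac G b a \<in> complete_integral_closure G"
      using abc unfolding complete_integral_closure_def by (intro CollectI conjI bexI[of _ "emb G c"] allI) simp_all
    then have "x \<otimes>\<^bsub>quot_grp G\<^esub> mk_frac G b a \<in> base G" using x by (simp add: conductor_def colon_def)
    then show ?thesis using abc d by (simp add: emb_def mk_frac_in_base)
  qed
  moreover have "loc_res P d = \<one>\<^bsub>reduced (local_monoid G P)\<^esub>"
    using loc_res_eq_one_iff[OF min_primes_prime[OF PX] d(1)] x d by (simp add: pull_def)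
  ultimately show ?thesis using d by blast
qed

end

section \<open>The \<open>v\<close>-class group of a weakly Krull monoid\<close>

text \<open>The choice of uniformizers \<open>p P\<close> of the discrete localizations is a parameter, so that the general theory can be applied by
  interpretation.\<close>

locale weakly_krull_setting = comm_monoid_cancel H for H :: "('a, 'm) monoid_scheme" (structure) +
  fixes p :: "'a fraction set \<Rightarrow> 'a fraction set"
  assumes fin: v_fin and wk: "weakly_krull H"
    and conductor_nonempty: "conductor H \<noteq> {}" and conductor_proper: "conductor H \<subset> base H"
    and C_finite: "finite (carrier (v_class_group H))"
    and p: "P \<in> Preg H \<Longrightarrow> p P \<in> carrier (reduced (local_monoid H P)) \<and> p P \<noteq> \<one>\<^bsub>reduced (local_monoid H P)\<^esub> \<and>
      (\<forall>f\<in>carrier (reduced (local_monoid H P)). \<exists>n::nat. f = p P [^]\<^bsub>reduced (local_monoid H P)\<^esub> n)"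

sublocale weakly_krull_setting \<subseteq>
  krull_family H "min_primes H" "\<lambda>P. reduced (local_monoid H P)" loc_res "Preg H" "Pstar H" p
proof (intro krull_family.intro krull_family_axioms.intro)
  show "primary_family H (min_primes H) (\<lambda>P. reduced (local_monoid H P)) loc_res"
    using weakly_krull_primary_family[OF fin wk proper_conductor_imp_min_primes[OF wk conductor_proper]] .
  show "min_primes H = Preg H \<union> Pstar H" "Preg H \<inter> Pstar H = {}"
    by (auto simp: Preg_def Pstar_def)
  obtain f where f: "f \<in> conductor H" using conductor_nonempty by blast
  then have "finite {P \<in> min_primes H. f \<in> P}" using wk conductor_proper by (auto simp: weakly_krull_def)
  moreover have "Pstar H \<subseteq> {P \<in> min_primes H. f \<in> P}" using f by (auto simp: Pstar_def)
  ultimately show "finite (Pstar H)" by (rule finite_subset[rotated])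
qed (use p in auto)

context weakly_krull_setting
begin

abbreviation "I \<equiv> v_invertible_ideals H"
abbreviation "N \<equiv> principal_ideal H ` carrier H"

lemma principal_submonoid: "submonoid_quotient I N"
proof (intro submonoid_quotient.intro submonoid_quotient_axioms.intro v_invertible_cancel)
  show "N \<subseteq> carrier I"
    using monoid_homD(1)[OF div_ideal_hom div_of(1)] by (auto simp: div_ideal_principal)
  have "principal_ideal H \<one> = \<one>\<^bsub>I\<^esub>"
    using monoid_homD(3)[OF div_of_hom] div_ideal_one by (simp add: div_ideal_principal)
  then show "\<one>\<^bsub>I\<^esub> \<in> N" by (metis imageI one_closed)
  fix x y assume "x \<in> N" "y \<in> N"
  then obtain a b where ab: "a \<in> carrier H" "b \<in> carrier H" "x = principal_ideal H a" "y = principal_ideal H b" by blast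
  then have "x \<otimes>\<^bsub>I\<^esub> y = principal_ideal H (a \<otimes> b)"
    using monoid_homD(2)[OF div_of_hom, of a b] div_of(1) by (simp add: div_ideal_principal div_ideal_mult)
  then show "x \<otimes>\<^bsub>I\<^esub> y \<in> N" using ab by blast
qed

definition divisor_class :: "'a fraction set multiset \<times> ('a fraction set \<Rightarrow> 'a fraction set) \<Rightarrow> 'a fraction set fraction set" where
  "divisor_class d = ideal_class H (div_ideal d)"

lemma ideal_class_hom: "monoid_hom I (v_class_group H) (ideal_class H)"
  using submonoid_quotient.quotient_class_hom[OF principal_submonoid]
  by (simp add: v_class_group_def ideal_class_def[abs_def] submonoid_quotient.quotient_class_def[OF principal_submonoid, abs_def])

lemma divisor_class_one:
  assumes d: "d \<in> carrier divisors"
  shows "divisor_class d = \<one>\<^bsub>v_class_group H\<^esub> \<longleftrightarrow> d \<in> div_of ` carrier H"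
proof -
  interpret D: comm_monoid_cancel divisors by (rule divisors_cancel)
  interpret I: comm_monoid_cancel I by (rule v_invertible_cancel)
  have dI: "div_ideal d \<in> carrier I" using monoid_homD(1)[OF div_ideal_hom d] .
  have inj: "inj_on div_ideal (carrier divisors)" using div_ideal_bij by (rule bij_betw_imp_inj_on)
  have "divisor_class d = \<one>\<^bsub>v_class_group H\<^esub> \<longleftrightarrow> (\<exists>p\<in>N. \<exists>q\<in>N. div_ideal d \<otimes>\<^bsub>I\<^esub> q = p)"
    using submonoid_quotient.quotient_class_eq_one_iff[OF principal_submonoid dI]
    by (simp add: divisor_class_def v_class_group_def ideal_class_def submonoid_quotient.quotient_class_def[OF principal_submonoid])
  also have "\<dots> \<longleftrightarrow> (\<exists>a\<in>carrier H. \<exists>b\<in>carrier H. d \<otimes>\<^bsub>divisors\<^esub> div_of b = div_of a)"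
  proof -
    have "div_ideal d \<otimes>\<^bsub>I\<^esub> principal_ideal H b = principal_ideal H a \<longleftrightarrow> d \<otimes>\<^bsub>divisors\<^esub> div_of b = div_of a"
      if "a \<in> carrier H" "b \<in> carrier H" for a b
      using that d div_of(1) inj_on_eq_iff[OF inj, of "d \<otimes>\<^bsub>divisors\<^esub> div_of b" "div_of a"]
      by (simp add: div_ideal_principal div_ideal_mult[symmetric])
    then show ?thesis by auto
  qed
  also have "\<dots> \<longleftrightarrow> d \<in> div_of ` carrier H"
  proof
    assume "\<exists>a\<in>carrier H. \<exists>b\<in>carrier H. d \<otimes>\<^bsub>divisors\<^esub> div_of b = div_of a"
    then obtain a b where ab: "a \<in> carrier H" "b \<in> carrier H" "div_of a = div_of b \<otimes>\<^bsub>divisors\<^esub> d"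
      using D.m_comm[OF d div_of(1)] by metis
    then have "b divides a" using d by (intro div_of_divides) auto
    then obtain c where c: "c \<in> carrier H" "a = b \<otimes> c" by (auto simp: factor_def)
    then have "div_of b \<otimes>\<^bsub>divisors\<^esub> div_of c = div_of b \<otimes>\<^bsub>divisors\<^esub> d"
      using ab monoid_homD(2)[OF div_of_hom, of b c] by simp
    then have "div_of c = d" using ab c d div_of(1) D.l_cancel by blast
    then show "d \<in> div_of ` carrier H" using c by blast
  next
    assume "d \<in> div_of ` carrier H"
    then obtain a where "a \<in> carrier H" "d = div_of a" by blast
    then show "\<exists>a\<in>carrier H. \<exists>b\<in>carrier H. d \<otimes>\<^bsub>divisors\<^esub> div_of b = div_of a"
      using monoid_homD(3)[OF div_of_hom] d by (intro bexI[of _ a] bexI[of _ \<one>]) simp_all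
  qed
  finally show ?thesis .
qed

lemma p_component_ideal_of:
  assumes f: "f \<in> families" and P: "P \<in> min_primes H"
  shows "p_component H P (emb H ` ideal_of f) = f P"
proof -
  obtain c where c: "c \<in> ideal_of f" "loc_res P c = f P" using ideal_of_generator[OF f P] by blast
  have "p_component H P (emb H ` ideal_of f) = loc_res P c"
    using ideal_of_is_ideal[OF f] c P by (intro p_component_eq min_primes_prime) (auto simp: ideal_of_def)
  then show ?thesis using c by simp
qed

text \<open>A \<open>v\<close>-invertible ideal is determined by its components, so the definite description of \<open>T_ideal\<close> has a unique solution.\<close>

lemma T_ideal_eq:
  assumes t: "t \<in> carrier (T_monoid H)"
  shows "T_ideal H t = div_ideal ({#}, t)"
proof -
  have d: "({#}, t) \<in> carrier divisors" using t by (simp add: divisors_def T_monoid_def)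
  have one: "family_of ({#}, t) P = \<one>\<^bsub>reduced (local_monoid H P)\<^esub>" if "P \<in> Preg H" for P
    using that by simp
  show ?thesis
    unfolding T_ideal_def
  proof (rule the_equality)
    show "div_ideal ({#}, t) \<in> carrier I \<and>
        (\<forall>P\<in>Pstar H. p_component H P (div_ideal ({#}, t)) = t P) \<and>
        (\<forall>P\<in>Preg H. p_component H P (div_ideal ({#}, t)) = \<one>\<^bsub>reduced (local_monoid H P)\<^esub>)"
      using monoid_homD(1)[OF div_ideal_hom d] one
      by (simp add: div_ideal_def p_component_ideal_of family_of_closed[OF d])
    fix A assume A: "A \<in> carrier I \<and> (\<forall>P\<in>Pstar H. p_component H P A = t P) \<and>
        (\<forall>P\<in>Preg H. p_component H P A = \<one>\<^bsub>reduced (local_monoid H P)\<^esub>)"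
    then have "A \<in> div_ideal ` carrier divisors"
      by (simp only: bij_betw_imp_surj_on[OF div_ideal_bij])
    then obtain e where e: "e \<in> carrier divisors" "A = div_ideal e"
      by (elim imageE)
    have "family_of e P = family_of ({#}, t) P" for P
    proof (cases "P \<in> min_primes H")
      case True
      then have "p_component H P A = family_of e P"
        using e by (simp add: div_ideal_def p_component_ideal_of family_of_closed)
      moreover have "P \<in> Pstar H \<or> P \<in> Preg H" using True by (auto simp: Preg_def)
      ultimately show ?thesis using A one by auto
    qed (simp add: family_of_def)
    then have "family_of e = family_of ({#}, t)" by (rule ext)
    then show "A = div_ideal ({#}, t)" using e d by (simp add: family_of_eq_iff)
  qed
qed

end

sublocale weakly_krull_setting \<subseteq>
  krull_class H "min_primes H" "\<lambda>P. reduced (local_monoid H P)" loc_res "Preg H" "Pstar H" p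
    "v_class_group H" divisor_class "iota H"
proof (intro krull_class.intro krull_class_axioms.intro krull_family_axioms)
  show "comm_group (v_class_group H)"
    unfolding v_class_group_def by (rule submonoid_quotient.quotient_group[OF principal_submonoid])
  show "finite (carrier (v_class_group H))" by (rule C_finite)
  show "monoid_hom divisors (v_class_group H) divisor_class"
    using monoid_hom_comp[OF div_ideal_hom ideal_class_hom] by (simp add: divisor_class_def[abs_def] comp_def)
  show "divisor_class d = \<one>\<^bsub>v_class_group H\<^esub> \<longleftrightarrow> d \<in> div_of ` carrier H" if "d \<in> carrier divisors" for d
    using that by (rule divisor_class_one)
  fix t assume "t \<in> carrier (product_group (Pstar H) (\<lambda>P. reduced (local_monoid H P)))"
  then show "iota H t = divisor_class ({#}, t)"
    using T_ideal_eq[of t] by (simp only: iota_def divisor_class_def T_monoid_def)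
qed

context weakly_krull_setting
begin

lemma prime_class_eq: "P \<in> Preg H \<Longrightarrow> prime_class P = ideal_class H P"
proof -
  assume P: "P \<in> Preg H"
  then have PX: "P \<in> min_primes H" by simp
  have "{x \<in> carrier H. loc_res P x \<noteq> \<one>\<^bsub>reduced (local_monoid H P)\<^esub>} = pull P"
    using loc_res_eq_one_iff[OF min_primes_prime[OF PX]] pull_subset by auto
  then have "div_ideal ({#P#}, \<one>\<^bsub>T\<^esub>) = P"
    using div_ideal_prime[OF P] min_primes_pull(1)[OF PX] by (simp add: Product_Groups.one_product_group)
  then show ?thesis by (simp add: prime_class_def divisor_class_def)
qed

lemma G_P_eq: "G_P H = prime_class ` Preg H"
  unfolding G_P_def using prime_class_eq by (intro image_cong) auto

lemma T_block_monoid_eq: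
  "T_block_monoid (v_class_group H) (G_P H) (T_monoid H) (iota H) = B"
  by (simp only: T_monoid_def G_P_eq)

lemma divisor_closed_transfer:
  assumes S: "divisor_closed S H"
    and trivial: "\<And>a P. a \<in> S \<Longrightarrow> P \<in> Pstar H \<Longrightarrow>
      p_component H P (principal_ideal H a) = \<one>\<^bsub>reduced (local_monoid H P)\<^esub>"
  shows "\<exists>GS \<theta>. GS \<subseteq> carrier (v_class_group H) \<and>
    divisor_theory (block_monoid (v_class_group H) GS) GS (\<lambda>B. B) \<and>
    transfer_hom (H\<lparr>carrier := S\<rparr>) (block_monoid (v_class_group H) GS) \<theta>"
proof -
  have "S \<subseteq> carrier H" using S submonoid.subset unfolding divisor_closed_def by blast
  have regular: "loc_res P a = \<one>\<^bsub>reduced (local_monoid H P)\<^esub>" if a: "a \<in> S" and P: "P \<in> Pstar H" for a P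
  proof -
    have "a \<in> carrier H" using a \<open>S \<subseteq> carrier H\<close> by blast
    then have "p_component H P (principal_ideal H a) = loc_res P a"
      using p_component_ideal_of[OF principal_family, of a P] P by (simp add: principal_ideal_of)
    then show ?thesis using trivial[OF a P] by simp
  qed
  have "prime_class ` support S \<subseteq> carrier (v_class_group H)"
    by (auto simp: support_def[OF S regular])
  from C.transfer_to_divisor_theory[OF C_finite this transfer_from_S[OF S regular]]
  show ?thesis .
qed

end

theorem theorem4p5:
  fixes H :: "('a, 'm) monoid_scheme"
  assumes "v_noetherian H" and "weakly_krull H"
    and "conductor H \<noteq> {}" and "conductor H \<subset> base H"
    and "finite (carrier (v_class_group H))"
  shows "(G_P H \<subseteq> carrier (v_class_group H) \<and>
          monoid_hom (T_monoid H) (v_class_group H) (iota H) \<and>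
          (\<exists>\<beta>. transfer_hom H (T_block_monoid (v_class_group H) (G_P H) (T_monoid H) (iota H)) \<beta>) \<and>
          v_noetherian (T_block_monoid (v_class_group H) (G_P H) (T_monoid H) (iota H)) \<and>
          weakly_krull (T_block_monoid (v_class_group H) (G_P H) (T_monoid H) (iota H))) \<and>
         (\<forall>S. divisor_closed S H \<and>
              (\<forall>a \<in> S. \<forall>P \<in> Pstar H.
                 p_component H P (principal_ideal H a) = \<one>\<^bsub>reduced (local_monoid H P)\<^esub>) \<longrightarrow>
              (\<exists>GS \<theta>. GS \<subseteq> carrier (v_class_group H) \<and>
                 divisor_theory (block_monoid (v_class_group H) GS) GS (\<lambda>B. B) \<and>
                 transfer_hom (H\<lparr>carrier := S\<rparr>) (block_monoid (v_class_group H) GS) \<theta>))"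
proof -
  interpret H: comm_monoid_cancel H using assms(1) by (simp add: v_noetherian_def)
  have fin: H.v_fin by (rule H.v_noetherian_imp_v_fin[OF assms(1)])
  interpret F: primary_family H "min_primes H" "\<lambda>P. reduced (local_monoid H P)" H.loc_res
    by (rule H.weakly_krull_primary_family[OF fin assms(2) H.proper_conductor_imp_min_primes[OF assms(2,4)]])
  have "\<exists>p\<in>carrier (reduced (local_monoid H P)). p \<noteq> \<one>\<^bsub>reduced (local_monoid H P)\<^esub> \<and>
      (\<forall>f\<in>carrier (reduced (local_monoid H P)). \<exists>n::nat. f = p [^]\<^bsub>reduced (local_monoid H P)\<^esub> n)"
    if P: "P \<in> Preg H" for P
  proof -
    obtain d where "d \<in> carrier H" "H.loc_res P d = \<one>\<^bsub>reduced (local_monoid H P)\<^esub>"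
      "\<forall>a\<in>carrier H. \<forall>b\<in>carrier H. \<forall>c\<in>carrier H.
         (\<forall>n::nat. a [^]\<^bsub>H\<^esub> n divides\<^bsub>H\<^esub> c \<otimes>\<^bsub>H\<^esub> b [^]\<^bsub>H\<^esub> n) \<longrightarrow> a divides\<^bsub>H\<^esub> d \<otimes>\<^bsub>H\<^esub> b"
      using H.conductor_multiplier[OF P assms(4)] by blast
    moreover have "P \<in> min_primes H" using P by (simp add: Preg_def)
    ultimately show ?thesis by (intro F.discrete_localization) blast+
  qed
  then obtain p where "\<And>P. P \<in> Preg H \<Longrightarrow> p P \<in> carrier (reduced (local_monoid H P)) \<and>
      p P \<noteq> \<one>\<^bsub>reduced (local_monoid H P)\<^esub> \<and>
      (\<forall>f\<in>carrier (reduced (local_monoid H P)). \<exists>n::nat. f = p P [^]\<^bsub>reduced (local_monoid H P)\<^esub> n)"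
    by metis
  then interpret W: weakly_krull_setting H p
    using fin assms by unfold_locales auto
  show ?thesis
    unfolding W.T_block_monoid_eq
  proof (intro conjI allI impI)
    show "G_P H \<subseteq> carrier (v_class_group H)" by (auto simp: W.G_P_eq)
    show "monoid_hom (T_monoid H) (v_class_group H) (iota H)"
      unfolding T_monoid_def by (rule W.\<iota>_hom)
    show "\<exists>\<beta>. transfer_hom H W.B \<beta>" using W.transfer_to_B by blast
    show "v_noetherian W.B" "weakly_krull W.B" by (rule W.B_v_noetherian W.B_weakly_krull)+
  qed (elim conjE, rule W.divisor_closed_transfer, simp_all)
qed

end
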